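(* In the setting and notation of the context, for each $n\in\mathbb N$ and $f^{(n)}\in\mathcal D^{(n)}$, $$P(f^{(n)})=\int_{T^n}\sigma(dt_1)\cdots\sigma(dt_n)\,f^{(n)}(t_1,\dots,t_n)\,{:}\omega(t_1)\cdots\omega(t_n){:}\,.$$
   Context: $T$ is a locally compact, second countable Hausdorff space without isolated points, $\sigma$ a Radon non-atomic measure on $T$ with $\sigma(O)>0$ for every non-empty open $O$. $\mathcal D^{(n)}=C_0(T^n)$ (real continuous functions with compact support), $\mathcal D=\mathcal D^{(1)}$, $\mathcal D^{(0)}=\mathbb R$. $\mathcal H=L^2(T,\sigma)$ (real), $\mathcal F(\mathcal H)=\mathbb R\oplus\bigoplus_{n\ge1}\mathcal H^{\otimes n}$ is the full Fock space, $\Omega=(1,0,0,\dots)$. A function $\lambda\in C(T)$ (real continuous) is fixed. Formally $\omega(t)=\partial_t^\dagger+\partial_t+\lambda(t)\partial_t^\dagger\partial_t$, where $\partial_t^\dagger,\partial_t$ are the creation and annihilation operators at the point $t$ with $\partial_s\partial_t^\dagger=\delta(s,t)$. Rigorously, smeared products are defined as follows. For a function $h(t_1,\dots,t_k;y_1,\dots,y_m)$ ($k\ge1$, all variables in $T$) put $(Ch)(t_1,\dots,t_{k-1};y_1,\dots,y_{m+1})=h(t_1,\dots,t_{k-1},y_1;y_2,\dots,y_{m+1})$ (corresponding to $\partial_{t_k}^\dagger$), $(Ah)(t_1,\dots,t_{k-1};y_1,\dots,y_{m-1})=\int_T\sigma(dt)\,h(t_1,\dots,t_{k-1},t;t,y_1,\dots,y_{m-1})$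 (corresponding to $\partial_{t_k}$), $(Nh)(t_1,\dots,t_{k-1};y_1,\dots,y_m)=\lambda(y_1)h(t_1,\dots,t_{k-1},y_1;y_1,\dots,y_m)$ (corresponding to $\lambda(t_k)\partial_{t_k}^\dagger\partial_{t_k}$), with $Ah=Nh=0$ if $m=0$. For a word $w=(w_1,\dots,w_n)\in\{C,A,N\}^n$ and a kernel $f^{(n)}$, let $w(f^{(n)})$ be the bounded operator on $\mathcal F(\mathcal H)$ with $w(f^{(n)})g^{(m)}=w_1w_2\cdots w_n(f^{(n)}\otimes g^{(m)})$ ($w_n$ applied first), where $(f^{(n)}\otimes g^{(m)})(t;y)=f^{(n)}(t)g^{(m)}(y)$. Monomial: $\langle f^{(n)},\omega^{\otimes n}\rangle=\int_{T^n}\sigma(dt_1)\cdots\sigma(dt_n)f^{(n)}(t_1,\dots,t_n)\omega(t_1)\cdots\omega(t_n):=\sum_{w\in\{C,A,N\}^n}w(f^{(n)})$; constants are monomials of order $0$. $\mathbf{CP}$ (resp. $\mathbf{CP}^{(n)}$) is the set of finite sums of monomials with kernels in $\mathcal D^{(i)}$, $i\in\mathbb N_0$ (resp. $i\le n$). Free Wick product ${:}\omega(t_1)\cdots\omega(t_n){:}$: formally expand $\omega(t_1)\cdots\omega(t_n)$ and remove all terms containing $\partial_{t_i}\partial_{t_{i+1}}^\dagger$ for some $i$. Rigorously, $\int_{T^n}\sigma(dt_1)\cdots\sigma(dt_n)f^{(n)}(t_1,\dots,t_n){:}\omega(t_1)\cdots\omega(t_n){:}$ is the sum of $w(f^{(n)})$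 over the $2n+1$ words $C^n$, $C^{i-1}A^{n-i+1}$ and $C^{i-1}NA^{n-i}$, $i=1,\dots,n$ (i.e. the words with no consecutive $w_i\in\{A,N\}$, $w_{i+1}\in\{C,N\}$). $L^2(\tau)$ is the closure of $\mathbf{CP}$ in the norm $\|P\|_{L^2(\tau)}=\|P\Omega\|_{\mathcal F(\mathcal H)}$ (a nonzero element of $\mathbf{CP}$ has nonzero norm). $\mathbf{MP}^{(n)}$ is the closure of $\mathbf{CP}^{(n)}$ in $L^2(\tau)$, $\mathbf{OP}^{(n)}=\mathbf{MP}^{(n)}\ominus\mathbf{MP}^{(n-1)}$. For $f^{(n)}\in\mathcal D^{(n)}$, $P(f^{(n)})$ is the orthogonal projection in $L^2(\tau)$ of $\langle f^{(n)},\omega^{\otimes n}\rangle$ onto $\mathbf{OP}^{(n)}$; it is known that $P(f^{(n)})$ belongs to $\mathbf{CP}$, and so $P(f^{(n)})$ is regarded as a bounded operator on $\mathcal F(\mathcal H)$; the claimed equality is an equality of operators. *)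

theory Defs
  imports "HOL-Analysis.Analysis"
begin

definition radon_measure :: "'a::topological_space measure \<Rightarrow> bool" where
  "radon_measure \<sigma> \<longleftrightarrow>
     sets \<sigma> = sets borel \<and>
     (\<forall>K. compact K \<longrightarrow> emeasure \<sigma> K < \<infinity>) \<and>
     (\<forall>B\<in>sets borel. emeasure \<sigma> B = (SUP K\<in>{K. K \<subseteq> B \<and> compact K}. emeasure \<sigma> K))"

definition nonatomic :: "'a measure \<Rightarrow> bool" where
  "nonatomic \<sigma> \<longleftrightarrow>
     (\<forall>B\<in>sets \<sigma>. 0 < emeasure \<sigma> B \<longrightarrow>
        (\<exists>B'\<in>sets \<sigma>. B' \<subseteq> B \<and> 0 < emeasure \<sigma> B' \<and> emeasure \<sigma> B' < emeasure \<sigma> B))"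

text \<open>
  A function of \<open>n\<close> variables in \<open>T\<close> is a function on lists, of which only the values on lists of
  length \<open>n\<close> matter; \<open>coords n\<close> turns it into a function on the product space
  \<open>T\<^sup>n = (\<Pi>\<^sub>E i\<in>{..<n}. T)\<close>.
\<close>

definition coords :: "nat \<Rightarrow> ('a list \<Rightarrow> real) \<Rightarrow> (nat \<Rightarrow> 'a) \<Rightarrow> real" where
  "coords n f = (\<lambda>x. f (map x [0..<n]))"

abbreviation power_topology :: "nat \<Rightarrow> (nat \<Rightarrow> 'a::topological_space) topology" where
  "power_topology n \<equiv> product_topology (\<lambda>_. euclidean) {..<n}"

abbreviation power_measure :: "'a measure \<Rightarrow> nat \<Rightarrow> (nat \<Rightarrow> 'a) measure" where
  "power_measure \<sigma> n \<equiv> Pi\<^sub>M {..<n} (\<lambda>_. \<sigma>)"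

definition test_functions :: "nat \<Rightarrow> ('a::topological_space list \<Rightarrow> real) set" where
  "test_functions n =
     {f. continuous_map (power_topology n) euclideanreal (coords n f) \<and>
         compactin (power_topology n)
           (power_topology n closure_of {x \<in> topspace (power_topology n). coords n f x \<noteq> 0})}"


subsection \<open>The full Fock space\<close>

text \<open>
  The tensor power \<open>\<H>\<^sup>\<otimes>\<^sup>n\<close> is \<open>L\<^sup>2(T\<^sup>n, \<sigma>\<^sup>n)\<close>.  A vector of the Fock space is represented by a
  function \<open>g\<close> on lists, whose restriction to the lists of length \<open>n\<close> is its \<open>n\<close>-th component.
  Square integrable functions are not quotiented; two of them are the same vector iff
  \<open>fock_eq\<close> holds.
\<close>

definition fock_space :: "'a measure \<Rightarrow> ('a list \<Rightarrow> real) set" where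
  "fock_space \<sigma> =
     {g. (\<forall>n. coords n g \<in> borel_measurable (power_measure \<sigma> n) \<and>
              integrable (power_measure \<sigma> n) (\<lambda>x. (coords n g x)\<^sup>2)) \<and>
         summable (\<lambda>n. \<integral>x. (coords n g x)\<^sup>2 \<partial>power_measure \<sigma> n)}"

definition fock_eq :: "'a measure \<Rightarrow> ('a list \<Rightarrow> real) \<Rightarrow> ('a list \<Rightarrow> real) \<Rightarrow> bool" where
  "fock_eq \<sigma> g h \<longleftrightarrow>
     g \<in> fock_space \<sigma> \<and> h \<in> fock_space \<sigma> \<and>
     (\<forall>n. AE x in power_measure \<sigma> n. coords n g x = coords n h x)"

definition fock_inner :: "'a measure \<Rightarrow> ('a list \<Rightarrow> real) \<Rightarrow> ('a list \<Rightarrow> real) \<Rightarrow> real" where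
  "fock_inner \<sigma> g h = (\<Sum>n. \<integral>x. coords n g x * coords n h x \<partial>power_measure \<sigma> n)"

definition fock_norm :: "'a measure \<Rightarrow> ('a list \<Rightarrow> real) \<Rightarrow> real" where
  "fock_norm \<sigma> g = sqrt (fock_inner \<sigma> g g)"

definition vacuum :: "'a list \<Rightarrow> real" where
  "vacuum ys = (if ys = [] then 1 else 0)"

type_synonym 'a operator = "('a list \<Rightarrow> real) \<Rightarrow> ('a list \<Rightarrow> real)"

text \<open>
  Equality of operators on the Fock space.  Since \<open>fock_eq\<close> only relates members of the Fock
  space, \<open>op_eq \<sigma> P Q\<close> includes that both \<open>P\<close> and \<open>Q\<close> map the Fock space into itself.
\<close>

definition op_eq :: "'a measure \<Rightarrow> 'a operator \<Rightarrow> 'a operator \<Rightarrow> bool" where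
  "op_eq \<sigma> P Q \<longleftrightarrow> (\<forall>g\<in>fock_space \<sigma>. fock_eq \<sigma> (P g) (Q g))"

definition op_diff :: "'a operator \<Rightarrow> 'a operator \<Rightarrow> 'a operator" where
  "op_diff P Q = (\<lambda>g ys. P g ys - Q g ys)"


subsection \<open>Words in creation, annihilation and neutral operators\<close>

datatype letter = Create | Annihilate | Neutral

text \<open>
  The letters act on kernels \<open>h(t\<^sub>1,\<dots>,t\<^sub>k; y\<^sub>1,\<dots>,y\<^sub>m)\<close>, written \<open>h [t\<^sub>1,\<dots>,t\<^sub>k] [y\<^sub>1,\<dots>,y\<^sub>m]\<close>, for all
  \<open>m\<close> simultaneously: the component \<open>h\<^sub>m\<close> is the restriction to second arguments of length \<open>m\<close>.
  Hence the value of \<open>Ch\<close> and \<open>Nh\<close> at \<open>ys\<close> stems from \<open>h\<^sub>m\<close> with \<open>m = length ys - 1\<close> and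
  \<open>m = length ys\<close>, that of \<open>Ah\<close> from \<open>m = length ys + 1\<close>.  In particular \<open>Ah\<^sub>0\<close> and \<open>Nh\<^sub>0\<close> contribute
  nothing.
\<close>

type_synonym 'a kernel = "'a list \<Rightarrow> 'a list \<Rightarrow> real"

primrec letter_op :: "'a measure \<Rightarrow> ('a \<Rightarrow> real) \<Rightarrow> letter \<Rightarrow> 'a kernel \<Rightarrow> 'a kernel" where
  "letter_op \<sigma> lam Create h =
     (\<lambda>ts ys. case ys of [] \<Rightarrow> 0 | y # ys' \<Rightarrow> h (ts @ [y]) ys')"
| "letter_op \<sigma> lam Annihilate h =
     (\<lambda>ts ys. \<integral>t. h (ts @ [t]) (t # ys) \<partial>\<sigma>)"
| "letter_op \<sigma> lam Neutral h =
     (\<lambda>ts ys. case ys of [] \<Rightarrow> 0 | y # ys' \<Rightarrow> lam y * h (ts @ [y]) (y # ys'))"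

definition word_op ::
  "'a measure \<Rightarrow> ('a \<Rightarrow> real) \<Rightarrow> letter list \<Rightarrow> ('a list \<Rightarrow> real) \<Rightarrow> 'a operator" where
  "word_op \<sigma> lam w f g = foldr (letter_op \<sigma> lam) w (\<lambda>ts ys. f ts * g ys) []"

definition monomial ::
  "'a measure \<Rightarrow> ('a \<Rightarrow> real) \<Rightarrow> nat \<Rightarrow> ('a list \<Rightarrow> real) \<Rightarrow> 'a operator" where
  "monomial \<sigma> lam n f = (\<lambda>g ys. \<Sum>w\<in>{w. length w = n}. word_op \<sigma> lam w f g ys)"

definition wick_words :: "nat \<Rightarrow> letter list set" where
  "wick_words n =
     {replicate n Create} \<union>
     {replicate (i - 1) Create @ replicate (n - i + 1) Annihilate | i. 1 \<le> i \<and> i \<le> n} \<union>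
     {replicate (i - 1) Create @ [Neutral] @ replicate (n - i) Annihilate | i. 1 \<le> i \<and> i \<le> n}"

text \<open>
  These are the words without a factor \<open>\<partial>\<^sub>t\<^sub>i\<partial>\<^sup>\<dagger>\<^sub>t\<^sub>i\<^sub>+\<^sub>1\<close>: no letter \<open>A\<close> or \<open>N\<close> is directly followed by
  \<open>C\<close> or \<open>N\<close>.
\<close>

lemma wick_words_Suc:
  "wick_words (Suc n) =
     insert (Neutral # replicate n Annihilate)
       (insert (replicate (Suc n) Annihilate) ((#) Create ` wick_words n))"
  (is "?L = ?R")
proof (intro equalityI subsetI)
  fix w assume "w \<in> ?L"
  then consider "w = replicate (Suc n) Create"
    | i where "1 \<le> i" "i \<le> Suc n"
        "w = replicate (i - 1) Create @ replicate (Suc n - i + 1) Annihilate"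
    | i where "1 \<le> i" "i \<le> Suc n"
        "w = replicate (i - 1) Create @ [Neutral] @ replicate (Suc n - i) Annihilate"
    unfolding wick_words_def by blast
  then show "w \<in> ?R"
  proof cases
    case 1
    then show ?thesis by (auto simp: wick_words_def)
  next
    case (2 i)
    show ?thesis
    proof (cases "i = 1")
      case False
      then obtain j where j: "i = Suc j" "1 \<le> j" using 2 by (cases i) auto
      have "w = Create # replicate (j - 1) Create @ replicate (n - j + 1) Annihilate"
        using 2 j by (cases j) auto
      then show ?thesis using 2 j unfolding wick_words_def by fastforce
    qed (use 2 in auto)
  next
    case (3 i)
    show ?thesis
    proof (cases "i = 1")
      case False
      then obtain j where j: "i = Suc j" "1 \<le> j" using 3 by (cases i) auto
      have "w = Create # replicate (j - 1) Create @ [Neutral] @ replicate (n - j) Annihilate"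
        using 3 j by (cases j) auto
      then show ?thesis using 3 j unfolding wick_words_def by fastforce
    qed (use 3 in auto)
  qed
next
  fix w assume "w \<in> ?R"
  then consider "w = Neutral # replicate n Annihilate"
    | "w = replicate (Suc n) Annihilate"
    | "w = Create # replicate n Create"
    | i where "1 \<le> i" "i \<le> n"
        "w = Create # replicate (i - 1) Create @ replicate (n - i + 1) Annihilate"
    | i where "1 \<le> i" "i \<le> n"
        "w = Create # replicate (i - 1) Create @ [Neutral] @ replicate (n - i) Annihilate"
    unfolding wick_words_def by blast
  then show "w \<in> ?L"
  proof cases
    case 1
    then have "w = replicate (1 - 1) Create @ [Neutral] @ replicate (Suc n - 1) Annihilate" by simp
    then show ?thesis unfolding wick_words_def by fastforce
  next
    case 2
    then have "w = replicate (1 - 1) Create @ replicate (Suc n - 1 + 1) Annihilate" by simp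
    then show ?thesis unfolding wick_words_def by fastforce
  next
    case 3
    then show ?thesis by (simp add: wick_words_def)
  next
    case (4 i)
    then have "w = replicate (Suc i - 1) Create @ replicate (Suc n - Suc i + 1) Annihilate"
      by (cases i) auto
    moreover have "1 \<le> Suc i" "Suc i \<le> Suc n" using 4 by auto
    ultimately show ?thesis unfolding wick_words_def by blast
  next
    case (5 i)
    then have "w = replicate (Suc i - 1) Create @ [Neutral] @ replicate (Suc n - Suc i) Annihilate"
      by (cases i) auto
    moreover have "1 \<le> Suc i" "Suc i \<le> Suc n" using 5 by auto
    ultimately show ?thesis unfolding wick_words_def by blast
  qed
qed

lemma wick_words_eq:
  "wick_words n =
     {w. length w = n \<and>
         (\<forall>i. Suc i < n \<longrightarrow>
            \<not> (w ! i \<in> {Annihilate, Neutral} \<and> w ! Suc i \<in> {Create, Neutral}))}"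
proof -
  define good :: "letter list \<Rightarrow> bool" where
    "good = successively
       (\<lambda>a b. \<not> (a \<in> {Annihilate, Neutral} \<and> b \<in> {Create, Neutral}))"
  have good_C: "good (Create # w) \<longleftrightarrow> good w" for w
    unfolding good_def by (cases w) auto
  have good_AN: "good (x # w) \<longleftrightarrow> w = replicate (length w) Annihilate"
    if "x \<in> {Annihilate, Neutral}" for x w
    using that
  proof (induction w arbitrary: x)
    case Nil
    then show ?case by (simp add: good_def)
  next
    case (Cons y w)
    have "good (x # y # w) \<longleftrightarrow> y \<notin> {Create, Neutral} \<and> good (y # w)"
      using Cons.prems unfolding good_def by auto
    then show ?case using Cons.IH[of y] by (cases y) auto
  qed
  have "w \<in> wick_words n \<longleftrightarrow> length w = n \<and> good w" for w
  proof (induction n arbitrary: w)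
    case 0
    then show ?case by (auto simp: wick_words_def good_def)
  next
    case (Suc n)
    show ?case
    proof (cases w)
      case (Cons x v)
      show ?thesis
        using Suc.IH[of v] good_C[of v] good_AN[of x v] Cons
        by (cases x) (auto simp: wick_words_Suc)
    qed (auto simp: wick_words_Suc)
  qed
  then show ?thesis unfolding good_def by (auto simp: successively_conv_nth)
qed

definition free_wick_product ::
  "'a measure \<Rightarrow> ('a \<Rightarrow> real) \<Rightarrow> nat \<Rightarrow> ('a list \<Rightarrow> real) \<Rightarrow> 'a operator" where
  "free_wick_product \<sigma> lam n f = (\<lambda>g ys. \<Sum>w\<in>wick_words n. word_op \<sigma> lam w f g ys)"


subsection \<open>Noncommutative polynomials and orthogonalization\<close>

definition CP_le ::
  "'a::topological_space measure \<Rightarrow> ('a \<Rightarrow> real) \<Rightarrow> nat \<Rightarrow> 'a operator set" where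
  "CP_le \<sigma> lam n =
     {P. \<exists>xs. (\<forall>(i, f)\<in>set xs. i \<le> n \<and> f \<in> test_functions i) \<and>
              op_eq \<sigma> P (\<lambda>g ys. \<Sum>(i, f)\<leftarrow>xs. monomial \<sigma> lam i f g ys)}"

definition CP :: "'a::topological_space measure \<Rightarrow> ('a \<Rightarrow> real) \<Rightarrow> 'a operator set" where
  "CP \<sigma> lam = (\<Union>n. CP_le \<sigma> lam n)"

definition tau_inner :: "'a measure \<Rightarrow> 'a operator \<Rightarrow> 'a operator \<Rightarrow> real" where
  "tau_inner \<sigma> P Q = fock_inner \<sigma> (P vacuum) (Q vacuum)"

definition tau_norm :: "'a measure \<Rightarrow> 'a operator \<Rightarrow> real" where
  "tau_norm \<sigma> P = fock_norm \<sigma> (P vacuum)"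

text \<open>
  \<open>L\<^sup>2(\<tau>)\<close> is the completion of \<open>CP\<close> with respect to \<open>tau_norm\<close>: its elements are represented by
  Cauchy sequences in \<open>CP\<close>, with the limit inner product, and \<open>CP\<close> is embedded by constant sequences.
\<close>

definition L2_tau ::
  "'a::topological_space measure \<Rightarrow> ('a \<Rightarrow> real) \<Rightarrow> (nat \<Rightarrow> 'a operator) set" where
  "L2_tau \<sigma> lam =
     {X. (\<forall>k. X k \<in> CP \<sigma> lam) \<and>
         (\<forall>e>0. \<exists>K. \<forall>j\<ge>K. \<forall>k\<ge>K. tau_norm \<sigma> (op_diff (X j) (X k)) < e)}"

definition L2_diff ::
  "(nat \<Rightarrow> 'a operator) \<Rightarrow> (nat \<Rightarrow> 'a operator) \<Rightarrow> (nat \<Rightarrow> 'a operator)" where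
  "L2_diff X Y = (\<lambda>k. op_diff (X k) (Y k))"

definition L2_inner ::
  "'a measure \<Rightarrow> (nat \<Rightarrow> 'a operator) \<Rightarrow> (nat \<Rightarrow> 'a operator) \<Rightarrow> real" where
  "L2_inner \<sigma> X Y = lim (\<lambda>k. tau_inner \<sigma> (X k) (Y k))"

definition L2_norm :: "'a measure \<Rightarrow> (nat \<Rightarrow> 'a operator) \<Rightarrow> real" where
  "L2_norm \<sigma> X = sqrt (L2_inner \<sigma> X X)"

definition L2_embed :: "'a operator \<Rightarrow> (nat \<Rightarrow> 'a operator)" where
  "L2_embed P = (\<lambda>_. P)"

definition MP ::
  "'a::topological_space measure \<Rightarrow> ('a \<Rightarrow> real) \<Rightarrow> nat \<Rightarrow> (nat \<Rightarrow> 'a operator) set" where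
  "MP \<sigma> lam n =
     {X \<in> L2_tau \<sigma> lam.
        \<forall>e>0. \<exists>P\<in>CP_le \<sigma> lam n. L2_norm \<sigma> (L2_diff X (L2_embed P)) < e}"

definition OP ::
  "'a::topological_space measure \<Rightarrow> ('a \<Rightarrow> real) \<Rightarrow> nat \<Rightarrow> (nat \<Rightarrow> 'a operator) set" where
  "OP \<sigma> lam n =
     {X \<in> MP \<sigma> lam n. 1 \<le> n \<longrightarrow> (\<forall>Y\<in>MP \<sigma> lam (n - 1). L2_inner \<sigma> X Y = 0)}"

definition is_orthogonal_projection ::
  "'a measure \<Rightarrow> (nat \<Rightarrow> 'a operator) set \<Rightarrow> (nat \<Rightarrow> 'a operator) \<Rightarrow> (nat \<Rightarrow> 'a operator) \<Rightarrow> bool"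
where
  "is_orthogonal_projection \<sigma> S Z X \<longleftrightarrow>
     X \<in> S \<and> (\<forall>Y\<in>S. L2_inner \<sigma> (L2_diff Z X) Y = 0)"

text \<open>
  \<open>is_P \<sigma> lam n f R\<close>: the operator \<open>R\<close> in \<open>CP\<close> is \<open>P(f)\<close>, the orthogonal projection in \<open>L\<^sup>2(\<tau>)\<close> of the
  monomial with kernel \<open>f\<close> onto \<open>OP\<^sup>(\<^sup>n\<^sup>)\<close>.  This is a relation because operators are only determined
  up to \<open>op_eq\<close>.
\<close>

definition is_P ::
  "'a::topological_space measure \<Rightarrow> ('a \<Rightarrow> real) \<Rightarrow> nat \<Rightarrow> ('a list \<Rightarrow> real) \<Rightarrow> 'a operator \<Rightarrow> bool"
where
  "is_P \<sigma> lam n f R \<longleftrightarrow>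
     R \<in> CP \<sigma> lam \<and>
     is_orthogonal_projection \<sigma> (OP \<sigma> lam n) (L2_embed (monomial \<sigma> lam n f)) (L2_embed R)"

end

theory Submission imports Defs begin

text \<open>
  The Wick product with kernel \<open>f\<close> of \<open>n\<close> variables maps the vacuum to \<open>f\<close> itself, because the only
  Wick word without a letter killing the vacuum is \<open>C\<^sup>n\<close> (\<open>free_wick_product_vacuum\<close>).  Two facts
  turn this into a description of the orthogonal projection.

  First, the monomial and the Wick product with kernel \<open>f\<close> differ by a polynomial of lower order, and
  conversely every polynomial of order \<open>n\<close> is a sum of Wick products of order at most \<open>n\<close>.  Both
  follow from the contraction identity
  \<open>\<omega>(s):\<omega>(t\<^sub>1)\<dots>\<omega>(t\<^sub>m): = :\<omega>(s)\<omega>(t\<^sub>1)\<dots>\<omega>(t\<^sub>m): + lam(s)\<delta>(s,t\<^sub>1):\<omega>(s)\<omega>(t\<^sub>2)\<dots>\<omega>(t\<^sub>m): + \<delta>(s,t\<^sub>1):\<omega>(t\<^sub>2)\<dots>\<omega>(t\<^sub>m):\<close>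
  (\<open>contraction\<close>, \<open>mixed_in_filtration\<close>): multiplied from the left by further factors \<open>\<omega>\<close>, it moves
  one factor after the other into the Wick product, at the cost of terms of lower order whose kernels
  are again continuous with compact support.

  Second, polynomials of order below \<open>n\<close> map the vacuum to vectors of particle number below \<open>n\<close>
  (\<open>kernel_orthogonal_CP_le\<close>), so they are orthogonal to the Wick product.  The Wick product therefore
  lies in the space \<open>OP\<close>, and the monomial minus the Wick product, being of lower order, is orthogonal
  to that space.  This identifies the projection as an element of \<open>L\<^sup>2(\<tau>)\<close>.  It is an equality of
  operators since the vacuum separates polynomials (\<open>vacuum_separating\<close>): a sum of Wick products can
  be read off from its value at the vacuum.

  The analytic difficulty is that annihilation operators integrate over a variable shared by the
  kernel and the vector \<open>g\<close>, where the integrals converge for almost all arguments only.  All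
  identities are therefore proved pointwise on a set of \<open>good\<close> arguments, which has full measure and
  is chosen for \<open>g\<close> and a compact set \<open>K\<close>, uniformly in all kernels supported in \<open>K\<close>.  It is
  defined by the finiteness of positive majorants, which also prove that words act on the Fock
  space (\<open>fock_nn_integral_majorant\<close>, \<open>word_op_bound\<close>).
\<close>

section \<open>The Borel structure on lists\<close>

definition list_of :: "nat \<Rightarrow> (nat \<Rightarrow> 'a) \<Rightarrow> 'a list" where
  "list_of n x = map x [0..<n]"

lemma length_list_of [simp]: "length (list_of n x) = n"
  by (simp add: list_of_def)

lemma coords_list_of: "coords n g = (\<lambda>x. g (list_of n x))"
  by (simp add: coords_def list_of_def)

lemma list_of_0 [simp]: "list_of 0 x = []"
  by (simp add: list_of_def)

lemma list_of_Suc: "list_of (Suc n) x = x 0 # list_of n (\<lambda>i. x (Suc i))"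
  by (simp add: list_of_def map_upt_Suc del: upt_Suc)

lemma list_of_snoc: "list_of (Suc n) x = list_of n x @ [x n]"
  by (simp add: list_of_def)

lemma list_of_cong: "(\<And>i. i < n \<Longrightarrow> x i = y i) \<Longrightarrow> list_of n x = list_of n y"
  by (simp add: list_of_def)

lemma list_of_restrict [simp]: "list_of n (restrict x {..<n}) = list_of n x"
  by (rule list_of_cong) simp

lemma list_of_nth: "length ts = n \<Longrightarrow> list_of n (\<lambda>i. ts ! i) = ts"
  by (auto simp: list_of_def map_nth)

lemma nth_list_of [simp]: "i < n \<Longrightarrow> list_of n x ! i = x i"
  by (simp add: list_of_def)

abbreviation borel_power :: "nat \<Rightarrow> (nat \<Rightarrow> 'a::topological_space) measure" where
  "borel_power n \<equiv> Pi\<^sub>M {..<n} (\<lambda>_. borel)"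

text \<open>
  The final \<open>\<sigma>\<close>-algebra for the maps \<open>list_of n\<close>: it presents the space of lists as the disjoint
  union of the powers of the base space.  With it a measurability statement about all components
  of a Fock space vector becomes one statement about a function on lists, and such statements
  can be composed with list operations.
\<close>

definition list_borel :: "'a::topological_space list measure" where
  "list_borel = sigma UNIV {A. \<forall>n. list_of n -` A \<inter> space (borel_power n) \<in> sets (borel_power n)}"

lemma space_list_borel [simp]: "space list_borel = UNIV"
  by (simp add: list_borel_def)

lemma sets_list_borel:
  "sets list_borel = {A. \<forall>n. list_of n -` A \<inter> space (borel_power n) \<in> sets (borel_power n)}"
    (is "_ = ?S")
proof -
  have "sigma_algebra UNIV ?S"
    unfolding sigma_algebra_iff2
  proof (intro conjI allI impI ballI)
    fix A assume A: "A \<in> ?S"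
    have "list_of n -` (UNIV - A) \<inter> space (borel_power n) =
        space (borel_power n) - list_of n -` A \<inter> space (borel_power n)" for n
      by auto
    with A show "UNIV - A \<in> ?S" by auto
  next
    fix A :: "nat \<Rightarrow> 'a list set" assume A: "range A \<subseteq> ?S"
    have "list_of n -` (\<Union>i. A i) \<inter> space (borel_power n) \<in> sets (borel_power n)" for n
    proof -
      have "list_of n -` (\<Union>i. A i) \<inter> space (borel_power n) =
          (\<Union>i. list_of n -` A i \<inter> space (borel_power n))"
        by auto
      also have "\<dots> \<in> sets (borel_power n)"
        using A by (intro sets.countable_UN) auto
      finally show ?thesis .
    qed
    then show "(\<Union>i. A i) \<in> ?S" by blast
  qed auto
  then show ?thesis
    unfolding list_borel_def by (simp add: sigma_algebra.sigma_sets_eq)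
qed

lemma measurable_list_of [measurable]: "list_of n \<in> borel_power n \<rightarrow>\<^sub>M list_borel"
  by (auto simp: measurable_def sets_list_borel)

lemma measurable_length [measurable]: "length \<in> list_borel \<rightarrow>\<^sub>M count_space UNIV"
  by (auto simp: measurable_def sets_list_borel vimage_def)

lemma measurable_nth_list_of:
  "(\<lambda>x. list_of m x ! i) \<in> borel_power m \<rightarrow>\<^sub>M (borel :: 'a::topological_space measure)"
proof (cases "i < m")
  case False
  \<comment> \<open>Beyond the end of a list, \<open>nth\<close> has an unspecified value that depends on \<open>i - m\<close> only.\<close>
  then have "list_of m x ! i = ([] :: 'a list) ! (i - m)" for x :: "nat \<Rightarrow> 'a"
    using nth_append_right[of "list_of m x" i "[]"] by simp
  then show ?thesis by simp
qed simp

lemma measurable_from_list_borel_iff: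
  "F \<in> list_borel \<rightarrow>\<^sub>M N \<longleftrightarrow> (\<forall>n. (\<lambda>x. F (list_of n x)) \<in> borel_power n \<rightarrow>\<^sub>M N)"
proof
  assume "\<forall>n. (\<lambda>x. F (list_of n x)) \<in> borel_power n \<rightarrow>\<^sub>M N"
  then have F: "(\<lambda>x. F (list_of n x)) \<in> borel_power n \<rightarrow>\<^sub>M N" for n by blast
  show "F \<in> list_borel \<rightarrow>\<^sub>M N"
  proof (rule measurableI)
    fix ys :: "'a list"
    have "(\<lambda>i\<in>{..<length ys}. ys ! i) \<in> space (borel_power (length ys))"
      by (simp add: space_PiM)
    from measurable_space[OF F this] show "F ys \<in> space N" by (simp add: list_of_nth)
  next
    fix A assume "A \<in> sets N"
    from measurable_sets[OF F this] show "F -` A \<inter> space list_borel \<in> sets list_borel"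
      by (simp add: sets_list_borel vimage_def)
  qed
qed auto

lemma measurable_nth_list_borel [measurable]: "(\<lambda>ys. ys ! i) \<in> list_borel \<rightarrow>\<^sub>M borel"
  by (simp add: measurable_from_list_borel_iff measurable_nth_list_of)

text \<open>
  A product with a countable disjoint union is the disjoint union of the products.  A list is
  recovered from its length and its coordinates, both of which depend measurably on it, so the
  function is put together from its restrictions to the countably many lengths.
\<close>

lemma measurable_pair_list_borelI:
  assumes F: "\<And>n. (\<lambda>(p, x). F p (list_of n x)) \<in> M \<Otimes>\<^sub>M borel_power n \<rightarrow>\<^sub>M N"
  shows "(\<lambda>(p, ys). F p ys) \<in> M \<Otimes>\<^sub>M list_borel \<rightarrow>\<^sub>M N"
proof -
  have 1: "(\<lambda>z. F (fst z) (list_of n (\<lambda>i\<in>{..<n}. snd z ! i))) \<in> M \<Otimes>\<^sub>M list_borel \<rightarrow>\<^sub>M N" for n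
  proof -
    have "(\<lambda>z. (fst z, \<lambda>i\<in>{..<n}. snd z ! i)) \<in> M \<Otimes>\<^sub>M list_borel \<rightarrow>\<^sub>M M \<Otimes>\<^sub>M borel_power n"
      by measurable
    from measurable_compose[OF this F[of n]] show ?thesis by simp
  qed
  have "(\<lambda>z. F (fst z) (list_of (length (snd z)) (\<lambda>i\<in>{..<length (snd z)}. snd z ! i)))
      \<in> M \<Otimes>\<^sub>M list_borel \<rightarrow>\<^sub>M N"
    by (rule measurable_compose_countable[where g = "\<lambda>z. length (snd z)"
          and f = "\<lambda>n z. F (fst z) (list_of n (\<lambda>i\<in>{..<n}. snd z ! i))", OF 1]) measurable
  then show ?thesis by (simp add: list_of_nth split_beta')
qed

lemma measurable_Cons_list_borel:
  "(\<lambda>(t, ys). t # ys) \<in> borel \<Otimes>\<^sub>M list_borel \<rightarrow>\<^sub>M list_borel"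
proof (rule measurable_pair_list_borelI)
  fix n
  have [measurable]: "(\<lambda>z. \<lambda>i\<in>{..<Suc n}. case i of 0 \<Rightarrow> fst z | Suc j \<Rightarrow> snd z j)
      \<in> borel \<Otimes>\<^sub>M borel_power n \<rightarrow>\<^sub>M (borel_power (Suc n) :: (nat \<Rightarrow> 'a) measure)"
    by (rule measurable_restrict) (auto split: nat.split)
  have "(\<lambda>(t, x). t # list_of n x) =
      (\<lambda>z. list_of (Suc n) (\<lambda>i\<in>{..<Suc n}. case i of 0 \<Rightarrow> fst z :: 'a | Suc j \<Rightarrow> snd z j))"
    by (auto simp: list_of_Suc simp del: list_of_restrict intro!: list_of_cong)
  also have "\<dots> \<in> borel \<Otimes>\<^sub>M borel_power n \<rightarrow>\<^sub>M list_borel" by measurable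
  finally show "(\<lambda>(t, x). t # list_of n x) \<in> borel \<Otimes>\<^sub>M borel_power n \<rightarrow>\<^sub>M (list_borel :: 'a list measure)" .
qed

lemma measurable_Cons [measurable (raw)]:
  assumes "t \<in> M \<rightarrow>\<^sub>M borel" "ys \<in> M \<rightarrow>\<^sub>M list_borel"
  shows "(\<lambda>p. t p # ys p) \<in> M \<rightarrow>\<^sub>M list_borel"
  using measurable_compose[OF measurable_Pair[OF assms] measurable_Cons_list_borel] by simp

lemma measurable_snoc_list_borel:
  "(\<lambda>(t, ts). ts @ [t]) \<in> borel \<Otimes>\<^sub>M list_borel \<rightarrow>\<^sub>M list_borel"
proof (rule measurable_pair_list_borelI)
  fix n
  have [measurable]: "(\<lambda>z. \<lambda>i\<in>{..<Suc n}. if i < n then snd z i else fst z)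
      \<in> borel \<Otimes>\<^sub>M borel_power n \<rightarrow>\<^sub>M (borel_power (Suc n) :: (nat \<Rightarrow> 'a) measure)"
  proof (rule measurable_restrict)
    fix i
    show "(\<lambda>z. if i < n then snd z i else fst z)
        \<in> borel \<Otimes>\<^sub>M borel_power n \<rightarrow>\<^sub>M (borel :: 'a measure)"
      by (cases "i < n") auto
  qed
  have "(\<lambda>(t, x). list_of n x @ [t]) =
      (\<lambda>z. list_of (Suc n) (\<lambda>i\<in>{..<Suc n}. if i < n then snd z i else (fst z :: 'a)))"
    by (auto simp: list_of_snoc simp del: list_of_restrict intro!: list_of_cong)
  also have "\<dots> \<in> borel \<Otimes>\<^sub>M borel_power n \<rightarrow>\<^sub>M list_borel" by measurable
  finally show "(\<lambda>(t, x). list_of n x @ [t]) \<in> borel \<Otimes>\<^sub>M borel_power n \<rightarrow>\<^sub>M (list_borel :: 'a list measure)" .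
qed

lemma measurable_snoc [measurable (raw)]:
  assumes "t \<in> M \<rightarrow>\<^sub>M borel" "ts \<in> M \<rightarrow>\<^sub>M list_borel"
  shows "(\<lambda>p. ts p @ [t p]) \<in> M \<rightarrow>\<^sub>M list_borel"
  using measurable_compose[OF measurable_Pair[OF assms] measurable_snoc_list_borel] by simp

lemma measurable_Nil [measurable]: "(\<lambda>_. []) \<in> M \<rightarrow>\<^sub>M list_borel"
  by simp

lemma measurable_hd [measurable]: "hd \<in> list_borel \<rightarrow>\<^sub>M borel"
proof -
  have "(\<lambda>ys. if length ys = 0 then hd [] else ys ! 0) \<in> list_borel \<rightarrow>\<^sub>M (borel :: 'a measure)"
    by measurable
  also have "(\<lambda>ys. if length ys = 0 then hd [] else ys ! 0) = (hd :: 'a list \<Rightarrow> 'a)"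
    by (auto simp: hd_conv_nth)
  finally show ?thesis .
qed

lemma measurable_tl [measurable]: "tl \<in> list_borel \<rightarrow>\<^sub>M list_borel"
  unfolding measurable_from_list_borel_iff
proof
  fix n
  show "(\<lambda>x. tl (list_of n x)) \<in> borel_power n \<rightarrow>\<^sub>M (list_borel :: 'a list measure)"
  proof (cases n)
    case (Suc m)
    have [measurable]: "(\<lambda>x. \<lambda>i\<in>{..<m}. x (Suc i))
        \<in> borel_power n \<rightarrow>\<^sub>M (borel_power m :: (nat \<Rightarrow> 'a) measure)"
      by (rule measurable_restrict) (simp add: Suc)
    have "(\<lambda>x. list_of m (\<lambda>i\<in>{..<m}. x (Suc i))) \<in> borel_power n \<rightarrow>\<^sub>M (list_borel :: 'a list measure)"
      by (rule measurable_compose[of "\<lambda>x. \<lambda>i\<in>{..<m}. x (Suc i)" _ "borel_power m"]) measurable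
    then show ?thesis by (simp add: Suc list_of_Suc)
  qed simp
qed

lemma measurable_case_list_borel [measurable (raw)]:
  assumes ys: "ys \<in> M \<rightarrow>\<^sub>M list_borel" and c: "c \<in> M \<rightarrow>\<^sub>M N"
    and F: "(\<lambda>(p, y, zs). F p y zs) \<in> M \<Otimes>\<^sub>M borel \<Otimes>\<^sub>M list_borel \<rightarrow>\<^sub>M N"
  shows "(\<lambda>p. case ys p of [] \<Rightarrow> c p | y # zs \<Rightarrow> F p y zs) \<in> M \<rightarrow>\<^sub>M N"
proof -
  note [measurable] = ys c
  have [measurable]: "(\<lambda>p. F p (hd (ys p)) (tl (ys p))) \<in> M \<rightarrow>\<^sub>M N"
    using measurable_compose[of "\<lambda>p. (p, hd (ys p), tl (ys p))" M "M \<Otimes>\<^sub>M borel \<Otimes>\<^sub>M list_borel", OF _ F]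
    by simp
  have "(\<lambda>p. if length (ys p) = 0 then c p else F p (hd (ys p)) (tl (ys p))) \<in> M \<rightarrow>\<^sub>M N"
    by measurable
  also have "(\<lambda>p. if length (ys p) = 0 then c p else F p (hd (ys p)) (tl (ys p))) =
      (\<lambda>p. case ys p of [] \<Rightarrow> c p | y # zs \<Rightarrow> F p y zs)"
    by (auto split: list.split)
  finally show ?thesis .
qed

section \<open>Integration over all powers of the space\<close>

instance letter :: countable
  by countable_datatype

text \<open>
  Local compactness of the base space enters through \<open>\<sigma>\<close>-finiteness of the measure, which makes
  Fubini's theorem available.
\<close>

locale fock_model =
  fixes \<sigma> :: "'a::{t2_space, second_countable_topology} measure"
    and lam :: "'a \<Rightarrow> real"
  assumes sets_sigma [measurable_cong]: "sets \<sigma> = sets borel"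
    and sigma_finite_sigma: "sigma_finite_measure \<sigma>"
    and compact_finite: "\<And>K. compact K \<Longrightarrow> emeasure \<sigma> K < \<infinity>"
    and open_positive: "\<And>U. open U \<Longrightarrow> U \<noteq> {} \<Longrightarrow> 0 < emeasure \<sigma> U"
    and continuous_lam: "continuous_on UNIV lam"
begin

sublocale sigma_finite_measure \<sigma>
  by (rule sigma_finite_sigma)

sublocale product_sigma_finite "\<lambda>_::nat. \<sigma>"
  by (simp add: product_sigma_finite_def sigma_finite_sigma)

sublocale pair_sigma_finite \<sigma> \<sigma> ..

lemma space_sigma [simp]: "space \<sigma> = UNIV"
  using sets_eq_imp_space_eq[OF sets_sigma] by simp

lemma lam_measurable [measurable]: "lam \<in> borel_measurable borel"
  using continuous_lam by (rule borel_measurable_continuous_onI)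

lemma sets_power_measure [measurable_cong]: "sets (power_measure \<sigma> n) = sets (borel_power n)"
  by (intro sets_PiM_cong) (auto simp: sets_sigma)

lemma sigma_finite_power: "sigma_finite_measure (power_measure \<sigma> n)"
  by (rule product_sigma_finite.sigma_finite) (simp_all add: product_sigma_finite_axioms)

lemma compact_sets_borel: "compact K \<Longrightarrow> K \<in> sets (borel :: 'a measure)"
  by (simp add: compact_imp_closed)

text \<open>
  Prepending a coordinate carries the product measure to the product measure, because it does so
  on boxes.  Words act on the first entries of a list, so the recursion has to run over \<open>Cons\<close>,
  whereas the splitting of a finite product along \<open>insert\<close> adds the last coordinate.
\<close>

lemma distr_power_measure_Cons:
  "distr (\<sigma> \<Otimes>\<^sub>M power_measure \<sigma> n) (power_measure \<sigma> (Suc n))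
     (\<lambda>z. \<lambda>i\<in>{..<Suc n}. case i of 0 \<Rightarrow> fst z | Suc j \<Rightarrow> snd z j) = power_measure \<sigma> (Suc n)"
    (is "distr ?M ?N ?\<phi> = _")
proof (rule PiM_eqI)
  have meas: "?\<phi> \<in> ?M \<rightarrow>\<^sub>M ?N"
    by (rule measurable_restrict) (auto split: nat.split)
  interpret P: sigma_finite_measure "power_measure \<sigma> n" by (rule sigma_finite_power)
  fix A :: "nat \<Rightarrow> 'a set"
  assume A: "\<And>i. i \<in> {..<Suc n} \<Longrightarrow> A i \<in> sets \<sigma>"
  have "?\<phi> -` Pi\<^sub>E {..<Suc n} A \<inter> space ?M = A 0 \<times> Pi\<^sub>E {..<n} (\<lambda>i. A (Suc i))"
  proof (intro set_eqI iffI)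
    fix z assume "z \<in> A 0 \<times> Pi\<^sub>E {..<n} (\<lambda>i. A (Suc i))"
    then show "z \<in> ?\<phi> -` Pi\<^sub>E {..<Suc n} A \<inter> space ?M"
      by (cases z) (auto simp: space_pair_measure space_PiM PiE_iff split: nat.split)
  next
    fix z assume "z \<in> ?\<phi> -` Pi\<^sub>E {..<Suc n} A \<inter> space ?M"
    then have *: "(case i of 0 \<Rightarrow> fst z | Suc j \<Rightarrow> snd z j) \<in> A i" if "i < Suc n" for i
      using that by (auto simp: PiE_iff)
    have "fst z \<in> A 0" using *[of 0] by simp
    moreover have "snd z i \<in> A (Suc i)" if "i < n" for i using *[of "Suc i"] that by simp
    moreover have "snd z \<in> extensional {..<n}"
      using \<open>z \<in> _\<close> by (auto simp: space_pair_measure space_PiM PiE_iff)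
    ultimately show "z \<in> A 0 \<times> Pi\<^sub>E {..<n} (\<lambda>i. A (Suc i))"
      by (simp add: mem_Times_iff PiE_iff)
  qed
  moreover have "Pi\<^sub>E {..<Suc n} A \<in> sets ?N"
    using A by (intro sets_PiM_I_finite) auto
  ultimately have "emeasure (distr ?M ?N ?\<phi>) (Pi\<^sub>E {..<Suc n} A)
      = emeasure ?M (A 0 \<times> Pi\<^sub>E {..<n} (\<lambda>i. A (Suc i)))"
    using meas by (simp add: emeasure_distr)
  also have "\<dots> = emeasure \<sigma> (A 0) * emeasure (power_measure \<sigma> n) (Pi\<^sub>E {..<n} (\<lambda>i. A (Suc i)))"
    using A by (intro P.emeasure_pair_measure_Times sets_PiM_I_finite) auto
  also have "\<dots> = emeasure \<sigma> (A 0) * (\<Prod>i<n. emeasure \<sigma> (A (Suc i)))"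
    using A by (subst emeasure_PiM) auto
  finally show "emeasure (distr ?M ?N ?\<phi>) (Pi\<^sub>E {..<Suc n} A) = (\<Prod>i<Suc n. emeasure \<sigma> (A i))"
    by (simp add: prod.lessThan_Suc_shift del: prod.lessThan_Suc)
qed simp_all

lemma nn_integral_power_measure_Suc:
  assumes [measurable]: "p \<in> borel_measurable list_borel"
  shows "(\<integral>\<^sup>+x. p (list_of (Suc n) x) \<partial>power_measure \<sigma> (Suc n)) =
         (\<integral>\<^sup>+x. \<integral>\<^sup>+t. p (t # list_of n x) \<partial>\<sigma> \<partial>power_measure \<sigma> n)"
proof -
  interpret P: pair_sigma_finite \<sigma> "power_measure \<sigma> n"
    using sigma_finite_power sigma_finite_sigma by (simp add: pair_sigma_finite_def)
  let ?\<phi> = "\<lambda>z. \<lambda>i\<in>{..<Suc n}. case i of 0 \<Rightarrow> fst z | Suc j \<Rightarrow> snd z j"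
  have [measurable]: "?\<phi> \<in> \<sigma> \<Otimes>\<^sub>M power_measure \<sigma> n \<rightarrow>\<^sub>M power_measure \<sigma> (Suc n)"
    by (rule measurable_restrict) (auto split: nat.split)
  have "(\<integral>\<^sup>+x. p (list_of (Suc n) x) \<partial>power_measure \<sigma> (Suc n)) =
      (\<integral>\<^sup>+z. p (list_of (Suc n) (?\<phi> z)) \<partial>(\<sigma> \<Otimes>\<^sub>M power_measure \<sigma> n))"
    by (subst distr_power_measure_Cons[symmetric], subst nn_integral_distr) measurable
  also have "\<dots> = (\<integral>\<^sup>+(t, x). p (t # list_of n x) \<partial>(\<sigma> \<Otimes>\<^sub>M power_measure \<sigma> n))"
    by (simp add: list_of_Suc split_beta')
  also have "\<dots> = (\<integral>\<^sup>+x. \<integral>\<^sup>+t. p (t # list_of n x) \<partial>\<sigma> \<partial>power_measure \<sigma> n)"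
    by (subst P.nn_integral_snd[symmetric]) auto
  finally show ?thesis .
qed

text \<open>
  Integration with respect to the measure \<open>\<Sum>n. \<sigma>\<^sup>n\<close> on lists.  The full Fock space is the
  \<open>L\<^sup>2\<close>-space of this measure.
\<close>

definition fock_nn_integral :: "('a list \<Rightarrow> ennreal) \<Rightarrow> ennreal" where
  "fock_nn_integral p = (\<Sum>n. \<integral>\<^sup>+x. p (list_of n x) \<partial>power_measure \<sigma> n)"

lemma fock_nn_integral_mono: "(\<And>ys. p ys \<le> q ys) \<Longrightarrow> fock_nn_integral p \<le> fock_nn_integral q"
  unfolding fock_nn_integral_def by (intro suminf_le nn_integral_mono) auto

lemma fock_nn_integral_cmult:
  assumes [measurable]: "p \<in> borel_measurable list_borel"
  shows "fock_nn_integral (\<lambda>ys. c * p ys) = c * fock_nn_integral p"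
  unfolding fock_nn_integral_def by (simp add: nn_integral_cmult)

lemma fock_nn_integral_add:
  assumes [measurable]: "p \<in> borel_measurable list_borel" "q \<in> borel_measurable list_borel"
  shows "fock_nn_integral (\<lambda>ys. p ys + q ys) = fock_nn_integral p + fock_nn_integral q"
  unfolding fock_nn_integral_def by (simp add: nn_integral_add suminf_add)

text \<open>
  The only property of product measures that the norm estimates need: a nonempty list is a pair
  of a first entry and a remaining list.
\<close>

lemma fock_nn_integral_Cons:
  assumes [measurable]: "p \<in> borel_measurable list_borel"
  shows "fock_nn_integral p = p [] + fock_nn_integral (\<lambda>ys. \<integral>\<^sup>+t. p (t # ys) \<partial>\<sigma>)"
proof -
  have "fock_nn_integral p = (\<integral>\<^sup>+x. p [] \<partial>power_measure \<sigma> 0) +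
      (\<Sum>n. \<integral>\<^sup>+x. p (list_of (Suc n) x) \<partial>power_measure \<sigma> (Suc n))"
    unfolding fock_nn_integral_def
    by (subst suminf_offset[of _ 1]) (simp_all add: add.commute)
  also have "(\<integral>\<^sup>+x. p [] \<partial>power_measure \<sigma> 0) = p []"
    by (simp add: PiM_empty)
  finally show ?thesis
    by (simp only: nn_integral_power_measure_Suc[OF assms] fock_nn_integral_def)
qed

lemma AE_finite_of_fock_nn_integral:
  assumes [measurable]: "p \<in> borel_measurable list_borel"
    and fin: "fock_nn_integral (\<lambda>ys. (p ys)\<^sup>2) < \<infinity>"
  shows "AE x in power_measure \<sigma> n. p (list_of n x) < \<infinity>"
proof -
  have "(\<integral>\<^sup>+x. (p (list_of n x))\<^sup>2 \<partial>power_measure \<sigma> n) \<le> fock_nn_integral (\<lambda>ys. (p ys)\<^sup>2)"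
    unfolding fock_nn_integral_def
    using sum_le_suminf[of "\<lambda>n. \<integral>\<^sup>+x. (p (list_of n x))\<^sup>2 \<partial>power_measure \<sigma> n" "{n}"] by simp
  with fin have "(\<integral>\<^sup>+x. (p (list_of n x))\<^sup>2 \<partial>power_measure \<sigma> n) \<noteq> \<infinity>" by auto
  then have "AE x in power_measure \<sigma> n. (p (list_of n x))\<^sup>2 \<noteq> \<infinity>"
    by (intro nn_integral_PInf_AE) simp_all
  then show ?thesis
    by eventually_elim (auto simp: less_top power2_eq_square ennreal_mult_eq_top_iff)
qed

lemma fock_space_iff:
  "g \<in> fock_space \<sigma> \<longleftrightarrow>
     g \<in> borel_measurable list_borel \<and> fock_nn_integral (\<lambda>ys. ennreal ((g ys)\<^sup>2)) < \<infinity>"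
proof -
  have meas: "(\<forall>n. coords n g \<in> borel_measurable (power_measure \<sigma> n)) \<longleftrightarrow>
      g \<in> borel_measurable list_borel"
    by (simp add: measurable_from_list_borel_iff coords_list_of
        measurable_cong_sets[OF sets_power_measure refl])
  show ?thesis
  proof (cases "g \<in> borel_measurable list_borel")
    case [measurable]: True
    let ?I = "\<lambda>n. \<integral>\<^sup>+x. ennreal ((g (list_of n x))\<^sup>2) \<partial>power_measure \<sigma> n"
    let ?R = "\<lambda>n. \<integral>x. (g (list_of n x))\<^sup>2 \<partial>power_measure \<sigma> n"
    have int: "integrable (power_measure \<sigma> n) (\<lambda>x. (g (list_of n x))\<^sup>2) \<longleftrightarrow> ?I n < \<infinity>" for n
      by (subst integrable_iff_bounded) auto
    have eq: "?I n = ennreal (?R n)" if "?I n < \<infinity>" for n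
      using that by (intro nn_integral_eq_integral) (auto simp: int)
    have nonneg: "?R n \<ge> 0" for n by simp
    have "(\<forall>n. ?I n < \<infinity>) \<and> summable ?R \<longleftrightarrow> (\<Sum>n. ?I n) < \<infinity>"
    proof
      assume *: "(\<forall>n. ?I n < \<infinity>) \<and> summable ?R"
      then have "(\<Sum>n. ?I n) = (\<Sum>n. ennreal (?R n))" using eq by auto
      also have "\<dots> = ennreal (\<Sum>n. ?R n)"
        using * by (intro suminf_ennreal2) auto
      finally show "(\<Sum>n. ?I n) < \<infinity>" by simp
    next
      assume fin: "(\<Sum>n. ?I n) < \<infinity>"
      have I: "?I n < \<infinity>" for n
        using sum_le_suminf[of ?I "{n}"] fin by (auto simp: less_top top_unique)
      have "(\<Sum>n. ?I n) = (\<Sum>n. ennreal (?R n))"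
        by (rule suminf_cong) (rule eq[OF I])
      with fin have "(\<Sum>n. ennreal (?R n)) \<noteq> top" by simp
      then have "summable ?R" by (intro summable_suminf_not_top) auto
      with I show "(\<forall>n. ?I n < \<infinity>) \<and> summable ?R" by auto
    qed
    then show ?thesis
      using True meas unfolding fock_space_def fock_nn_integral_def int[symmetric]
      by (auto simp: coords_list_of)
  next
    case False
    then show ?thesis using meas by (auto simp: fock_space_def)
  qed
qed

section \<open>Positive majorants and good points\<close>

text \<open>
  The word \<open>v\<close> applied to \<open>1\<^sub>K \<otimes> \<dots> \<otimes> 1\<^sub>K\<close> and \<open>\<bar>g\<bar>\<close>, with \<open>\<bar>lam\<bar>\<close> in place of \<open>lam\<close> and with values in
  the extended nonnegative reals, so that no integrability is required to define it.
\<close>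

primrec majorant :: "'a set \<Rightarrow> ('a list \<Rightarrow> real) \<Rightarrow> letter list \<Rightarrow> 'a list \<Rightarrow> ennreal" where
  "majorant K g [] = (\<lambda>ys. ennreal \<bar>g ys\<bar>)"
| "majorant K g (x # v) =
     (case x of
        Create \<Rightarrow> (\<lambda>ys. case ys of [] \<Rightarrow> 0 | y # zs \<Rightarrow> indicator K y * majorant K g v zs)
      | Annihilate \<Rightarrow> (\<lambda>ys. \<integral>\<^sup>+t. indicator K t * majorant K g v (t # ys) \<partial>\<sigma>)
      | Neutral \<Rightarrow>
          (\<lambda>ys. case ys of [] \<Rightarrow> 0 | y # zs \<Rightarrow> indicator K y * ennreal \<bar>lam y\<bar> * majorant K g v (y # zs)))"

lemma measurable_majorant:
  assumes [measurable]: "K \<in> sets borel" "g \<in> borel_measurable list_borel"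
  shows "majorant K g v \<in> borel_measurable list_borel"
proof (induction v)
  case (Cons x v)
  note [measurable] = Cons.IH
  show ?case
    by (cases x) simp_all
qed simp

text \<open>
  Each letter is bounded on \<open>L\<^sup>2\<close>: creation and annihilation with the indicator of \<open>K\<close> as smearing
  function have norm at most \<open>\<sigma>(K)\<^sup>1\<^sup>/\<^sup>2\<close>, the latter by the Cauchy-Schwarz inequality, and the
  neutral letter multiplies by a function bounded on \<open>K\<close>.
\<close>

lemma fock_nn_integral_majorant:
  assumes K: "compact K" and g: "g \<in> fock_space \<sigma>"
  shows "fock_nn_integral (\<lambda>ys. (majorant K g v ys)\<^sup>2) < \<infinity>"
proof (induction v)
  case Nil
  then show ?case
    using g by (simp add: fock_space_iff ennreal_power)
next
  case (Cons x v)
  have [measurable]: "K \<in> sets borel" "g \<in> borel_measurable list_borel"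
    using K g by (auto simp: compact_sets_borel fock_space_iff)
  note [measurable] = measurable_majorant[OF \<open>K \<in> sets borel\<close> \<open>g \<in> borel_measurable list_borel\<close>]
  have fin: "emeasure \<sigma> K < \<infinity>" using K by (rule compact_finite)
  let ?p = "majorant K g v"
  have ind2: "(indicator K t * c)\<^sup>2 = indicator K t * (c\<^sup>2 :: ennreal)" for t c
    by (simp add: indicator_def)
  show ?case
  proof (cases x)
    case Create
    have "fock_nn_integral (\<lambda>ys. (majorant K g (x # v) ys)\<^sup>2) =
        fock_nn_integral (\<lambda>ys. \<integral>\<^sup>+t. indicator K t * (?p ys)\<^sup>2 \<partial>\<sigma>)"
      by (subst fock_nn_integral_Cons) (simp_all add: Create ind2)
    also have "\<dots> = fock_nn_integral (\<lambda>ys. emeasure \<sigma> K * (?p ys)\<^sup>2)"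
      by (simp add: nn_integral_multc)
    also have "\<dots> = emeasure \<sigma> K * fock_nn_integral (\<lambda>ys. (?p ys)\<^sup>2)"
      by (rule fock_nn_integral_cmult) simp
    also have "\<dots> < \<infinity>" using fin Cons.IH by (simp add: ennreal_mult_less_top)
    finally show ?thesis .
  next
    case Annihilate
    have "fock_nn_integral (\<lambda>ys. (majorant K g (x # v) ys)\<^sup>2) \<le>
        fock_nn_integral (\<lambda>ys. emeasure \<sigma> K * (\<integral>\<^sup>+t. (?p (t # ys))\<^sup>2 \<partial>\<sigma>))"
    proof (rule fock_nn_integral_mono)
      fix ys
      have "(\<integral>\<^sup>+t. indicator K t * ?p (t # ys) \<partial>\<sigma>)\<^sup>2 \<le>
          (\<integral>\<^sup>+t. (indicator K t)\<^sup>2 \<partial>\<sigma>) * (\<integral>\<^sup>+t. (?p (t # ys))\<^sup>2 \<partial>\<sigma>)"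
        by (rule Cauchy_Schwarz_nn_integral) measurable
      also have "(\<integral>\<^sup>+t. (indicator K t)\<^sup>2 \<partial>\<sigma>) = emeasure \<sigma> K"
        using ind2[of _ 1] by simp
      finally show "(majorant K g (x # v) ys)\<^sup>2 \<le> emeasure \<sigma> K * (\<integral>\<^sup>+t. (?p (t # ys))\<^sup>2 \<partial>\<sigma>)"
        by (simp add: Annihilate)
    qed
    also have "\<dots> = emeasure \<sigma> K * fock_nn_integral (\<lambda>ys. \<integral>\<^sup>+t. (?p (t # ys))\<^sup>2 \<partial>\<sigma>)"
      by (rule fock_nn_integral_cmult) measurable
    also have "\<dots> \<le> emeasure \<sigma> K * fock_nn_integral (\<lambda>ys. (?p ys)\<^sup>2)"
      by (subst (2) fock_nn_integral_Cons) (auto intro!: mult_left_mono)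
    also have "\<dots> < \<infinity>" using fin Cons.IH by (simp add: ennreal_mult_less_top)
    finally show ?thesis .
  next
    case Neutral
    have "bounded (lam ` K)"
      using K continuous_lam by (intro compact_imp_bounded compact_continuous_image)
        (auto intro: continuous_on_subset)
    then obtain L where L: "\<And>y. y \<in> K \<Longrightarrow> \<bar>lam y\<bar> \<le> L"
      by (auto simp: bounded_iff)
    have "fock_nn_integral (\<lambda>ys. (majorant K g (x # v) ys)\<^sup>2) \<le>
        fock_nn_integral (\<lambda>ys. (ennreal L)\<^sup>2 * (?p ys)\<^sup>2)"
    proof (rule fock_nn_integral_mono)
      fix ys
      have "majorant K g (x # v) ys \<le> ennreal L * ?p ys"
        by (cases ys) (auto simp: Neutral indicator_def intro!: mult_right_mono ennreal_leI L)
      then show "(majorant K g (x # v) ys)\<^sup>2 \<le> (ennreal L)\<^sup>2 * (?p ys)\<^sup>2"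
        by (metis power_mono power_mult_distrib zero_le)
    qed
    also have "\<dots> = (ennreal L)\<^sup>2 * fock_nn_integral (\<lambda>ys. (?p ys)\<^sup>2)"
      by (rule fock_nn_integral_cmult) simp
    also have "\<dots> < \<infinity>" using Cons.IH by (simp add: ennreal_mult_less_top power_less_top_ennreal)
    finally show ?thesis .
  qed
qed

text \<open>
  The points at which all integrals that occur for kernels supported in \<open>K\<close> converge absolutely.
  The condition involves \<open>K\<close> and \<open>g\<close>, but not the kernel.  This uniformity is essential: an
  annihilation operator integrates over a variable on which the remaining kernel depends as well,
  so identities which hold outside a null set depending on the kernel could not be integrated.
\<close>

definition good :: "'a set \<Rightarrow> ('a list \<Rightarrow> real) \<Rightarrow> 'a list \<Rightarrow> bool" where
  "good K g ys \<longleftrightarrow> (\<forall>v. majorant K g v ys < \<infinity>)"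

lemma AE_good:
  assumes "compact K" "g \<in> fock_space \<sigma>"
  shows "AE x in power_measure \<sigma> n. good K g (list_of n x)"
proof -
  have "AE x in power_measure \<sigma> n. majorant K g v (list_of n x) < \<infinity>" for v
    using assms by (intro AE_finite_of_fock_nn_integral fock_nn_integral_majorant measurable_majorant)
      (auto simp: compact_sets_borel fock_space_iff)
  then show ?thesis by (simp add: good_def AE_all_countable)
qed

text \<open>
  The majorant for the word \<open>Create # v\<close> at \<open>y # ys\<close> is the one for \<open>v\<close> at \<open>ys\<close>.
\<close>

lemma good_Cons:
  assumes "good K g (y # ys)" "y \<in> K"
  shows "good K g ys"
  unfolding good_def
proof
  fix v
  have "majorant K g (Create # v) (y # ys) < \<infinity>" using assms(1) unfolding good_def by blast
  then show "majorant K g v ys < \<infinity>" using assms(2) by simp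
qed

text \<open>
  The majorant for \<open>Annihilate # v\<close> at \<open>ys\<close> is the integral over \<open>t \<in> K\<close> of the one for \<open>v\<close> at
  \<open>t # ys\<close>; its finiteness forces the integrand to be finite almost everywhere, and there are only
  countably many words.
\<close>

lemma AE_good_Cons:
  assumes "compact K" "g \<in> borel_measurable list_borel" "good K g ys"
  shows "AE t in \<sigma>. t \<in> K \<longrightarrow> good K g (t # ys)"
proof -
  have [measurable]: "K \<in> sets borel" using assms by (simp add: compact_sets_borel)
  note [measurable] = measurable_majorant[OF \<open>K \<in> sets borel\<close> assms(2)]
  have "AE t in \<sigma>. t \<in> K \<longrightarrow> majorant K g v (t # ys) < \<infinity>" for v
  proof -
    have "majorant K g (Annihilate # v) ys < \<infinity>" using assms(3) unfolding good_def by blast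
    then have "(\<integral>\<^sup>+t. indicator K t * majorant K g v (t # ys) \<partial>\<sigma>) \<noteq> \<infinity>" by simp
    then have "AE t in \<sigma>. indicator K t * majorant K g v (t # ys) \<noteq> \<infinity>"
      by (rule nn_integral_PInf_AE[rotated]) measurable
    then show ?thesis by eventually_elim (auto simp: less_top)
  qed
  then have "AE t in \<sigma>. \<forall>v. t \<in> K \<longrightarrow> majorant K g v (t # ys) < \<infinity>"
    unfolding AE_all_countable by blast
  then show ?thesis by eventually_elim (auto simp: good_def)
qed

end

section \<open>The calculus of words\<close>

lemma ennreal_abs_integral_le_nn_integral:
  "ennreal \<bar>\<integral>x. F x \<partial>M\<bar> \<le> (\<integral>\<^sup>+x. ennreal \<bar>F x\<bar> \<partial>M)" for F :: "'a \<Rightarrow> real"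
proof (cases "integrable M F")
  case True
  then show ?thesis using integral_norm_bound_ennreal[of M F] by simp
qed (simp add: not_integrable_integral_eq)

text \<open>
  The letters of a word consume the smearing variables from the right, and a prefix \<open>us\<close> of
  variables is carried along untouched.  Hence the first letter of a word acts on the result of
  the remaining word for a kernel whose first variable is frozen, which yields the three recursion
  equations for \<open>word_op\<close> below, valid at every point.
\<close>

lemma foldr_letter_op_prefix:
  "foldr (letter_op \<sigma> lam) v h us = foldr (letter_op \<sigma> lam) v (\<lambda>ts. h (us @ ts)) []"
proof (induction v arbitrary: h us)
  case (Cons x v)
  have *: "foldr (letter_op \<sigma> lam) v (\<lambda>ts. h (us @ ts)) [t] = foldr (letter_op \<sigma> lam) v h (us @ [t])" for t
    by (subst Cons.IH, subst (2) Cons.IH) simp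
  show ?case by (cases x) (simp_all add: *)
qed simp

lemma foldr_letter_op_eq_word_op:
  "foldr (letter_op \<sigma> lam) v (\<lambda>ts ys. f ts * g ys) us ys = word_op \<sigma> lam v (\<lambda>ts. f (us @ ts)) g ys"
  unfolding word_op_def by (subst foldr_letter_op_prefix) simp

lemma word_op_Nil [simp]: "word_op \<sigma> lam [] f g ys = f [] * g ys"
  by (simp add: word_op_def)

lemma word_op_Create [simp]:
  "word_op \<sigma> lam (Create # v) f g ys =
     (case ys of [] \<Rightarrow> 0 | y # zs \<Rightarrow> word_op \<sigma> lam v (\<lambda>ts. f (y # ts)) g zs)"
  using foldr_letter_op_eq_word_op[of \<sigma> lam v f g]
  by (simp add: word_op_def cong: list.case_cong)

lemma word_op_Annihilate [simp]:
  "word_op \<sigma> lam (Annihilate # v) f g ys = (\<integral>t. word_op \<sigma> lam v (\<lambda>ts. f (t # ts)) g (t # ys) \<partial>\<sigma>)"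
  using foldr_letter_op_eq_word_op[of \<sigma> lam v f g]
  by (simp add: word_op_def)

lemma word_op_Neutral [simp]:
  "word_op \<sigma> lam (Neutral # v) f g ys =
     (case ys of [] \<Rightarrow> 0 | y # zs \<Rightarrow> lam y * word_op \<sigma> lam v (\<lambda>ts. f (y # ts)) g (y # zs))"
  using foldr_letter_op_eq_word_op[of \<sigma> lam v f g]
  by (simp add: word_op_def cong: list.case_cong)

lemma word_op_cong:
  "(\<And>ts. length ts = length v \<Longrightarrow> f ts = f' ts) \<Longrightarrow> word_op \<sigma> lam v f g ys = word_op \<sigma> lam v f' g ys"
proof (induction v arbitrary: f f' ys)
  case (Cons x v)
  have *: "word_op \<sigma> lam v (\<lambda>ts. f (t # ts)) g zs = word_op \<sigma> lam v (\<lambda>ts. f' (t # ts)) g zs" for t zs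
    using Cons.prems by (intro Cons.IH) simp
  show ?case by (cases x) (simp_all add: * cong: list.case_cong)
qed simp

lemma word_op_scale: "word_op \<sigma> lam v (\<lambda>ts. c * f ts) g ys = c * word_op \<sigma> lam v f g ys"
proof (induction v arbitrary: f ys)
  case (Cons x v)
  show ?case
    by (cases x) (simp_all add: Cons.IH split: list.split)
qed simp

lemma word_op_zero [simp]: "word_op \<sigma> lam v (\<lambda>_. 0) g ys = 0"
  using word_op_scale[of \<sigma> lam v 0] by simp

definition dominated :: "'a set \<Rightarrow> real \<Rightarrow> ('a list \<Rightarrow> real) \<Rightarrow> bool" where
  "dominated K M f \<longleftrightarrow> (\<forall>ts. \<bar>f ts\<bar> \<le> M \<and> (f ts \<noteq> 0 \<longrightarrow> set ts \<subseteq> K))"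

lemma dominated_slice: "dominated K M f \<Longrightarrow> dominated K M (\<lambda>ts. f (t # ts))"
  unfolding dominated_def by (metis insert_subset list.set(2))

lemma dominated_slice_outside: "dominated K M f \<Longrightarrow> t \<notin> K \<Longrightarrow> (\<lambda>ts. f (t # ts)) = (\<lambda>_. 0)"
  unfolding dominated_def by (metis insert_subset list.set(2))

lemma dominated_nonneg: "dominated K M f \<Longrightarrow> 0 \<le> M"
  unfolding dominated_def by (meson abs_ge_zero order_trans)

context fock_model
begin

lemma measurable_letter_op:
  assumes [measurable]: "(\<lambda>(ts, ys). h ts ys) \<in> borel_measurable (list_borel \<Otimes>\<^sub>M list_borel)"
  shows "(\<lambda>(ts, ys). letter_op \<sigma> lam x h ts ys) \<in> borel_measurable (list_borel \<Otimes>\<^sub>M list_borel)"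
  by (cases x) simp_all

text \<open>
  Measurability jointly in the frozen variables \<open>us\<close> and in the argument.  The prefix has to be a
  list of arbitrary length for the induction over the word, in which annihilation adds a frozen
  variable and then integrates over it.
\<close>

lemma measurable_word_op_kernel:
  assumes [measurable]: "f \<in> borel_measurable list_borel" "g \<in> borel_measurable list_borel"
  shows "(\<lambda>(us, ys). word_op \<sigma> lam v (\<lambda>ts. f (us @ ts)) g ys) \<in> borel_measurable (list_borel \<Otimes>\<^sub>M list_borel)"
proof -
  have "(\<lambda>(us, ys). foldr (letter_op \<sigma> lam) v (\<lambda>ts ys. f ts * g ys) us ys)
      \<in> borel_measurable (list_borel \<Otimes>\<^sub>M list_borel)"
    by (induction v) (simp, simp add: measurable_letter_op)
  then show ?thesis by (simp add: foldr_letter_op_eq_word_op)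
qed

lemma measurable_word_op:
  assumes "f \<in> borel_measurable list_borel" "g \<in> borel_measurable list_borel"
    and "us \<in> M \<rightarrow>\<^sub>M list_borel" "ys \<in> M \<rightarrow>\<^sub>M list_borel"
  shows "(\<lambda>p. word_op \<sigma> lam v (\<lambda>ts. f (us p @ ts)) g (ys p)) \<in> borel_measurable M"
  using measurable_compose[OF measurable_Pair[OF assms(3,4)] measurable_word_op_kernel[OF assms(1,2)]]
  by simp

lemma measurable_word_op_slice:
  assumes [measurable]: "f \<in> borel_measurable list_borel" "g \<in> borel_measurable list_borel"
  shows "(\<lambda>t. word_op \<sigma> lam v (\<lambda>ts. f (t # ts)) g (t # ys)) \<in> borel_measurable \<sigma>"
  using measurable_word_op[OF assms, of "\<lambda>t. [t]" \<sigma> "\<lambda>t. t # ys"] by simp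

lemma word_op_bound:
  assumes [measurable]: "K \<in> sets borel" "g \<in> borel_measurable list_borel"
  shows "dominated K M f \<Longrightarrow> ennreal \<bar>word_op \<sigma> lam v f g ys\<bar> \<le> ennreal M * majorant K g v ys"
proof (induction v arbitrary: f ys)
  case Nil
  then have "\<bar>f []\<bar> \<le> M" by (simp add: dominated_def)
  then show ?case by (auto simp: abs_mult ennreal_mult intro!: mult_right_mono ennreal_leI)
next
  case (Cons x v)
  note [measurable] = measurable_majorant[OF assms]
  have *: "ennreal \<bar>word_op \<sigma> lam v (\<lambda>ts. f (t # ts)) g zs\<bar> \<le> ennreal M * (indicator K t * majorant K g v zs)" for t zs
  proof (cases "t \<in> K")
    case True
    then show ?thesis using Cons.IH[OF dominated_slice[OF Cons.prems]] by simp
  next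
    case False
    then show ?thesis using dominated_slice_outside[OF Cons.prems] by simp
  qed
  show ?case
  proof (cases x)
    case Create
    then show ?thesis using * by (cases ys) auto
  next
    case Annihilate
    have "ennreal \<bar>word_op \<sigma> lam (x # v) f g ys\<bar>
        \<le> (\<integral>\<^sup>+t. ennreal \<bar>word_op \<sigma> lam v (\<lambda>ts. f (t # ts)) g (t # ys)\<bar> \<partial>\<sigma>)"
      using Annihilate by (simp add: ennreal_abs_integral_le_nn_integral)
    also have "\<dots> \<le> (\<integral>\<^sup>+t. ennreal M * (indicator K t * majorant K g v (t # ys)) \<partial>\<sigma>)"
      by (intro nn_integral_mono *)
    also have "\<dots> = ennreal M * majorant K g (x # v) ys"
      using Annihilate by (simp add: nn_integral_cmult)
    finally show ?thesis .
  next
    case Neutral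
    show ?thesis
    proof (cases ys)
      case (Cons y zs)
      have "ennreal \<bar>word_op \<sigma> lam (x # v) f g ys\<bar> =
          ennreal \<bar>lam y\<bar> * ennreal \<bar>word_op \<sigma> lam v (\<lambda>ts. f (y # ts)) g ys\<bar>"
        by (simp add: Neutral Cons abs_mult ennreal_mult)
      also have "\<dots> \<le> ennreal \<bar>lam y\<bar> * (ennreal M * (indicator K y * majorant K g v ys))"
        by (intro mult_left_mono *) simp
      also have "\<dots> = ennreal M * majorant K g (x # v) ys"
        by (simp add: Neutral Cons mult_ac)
      finally show ?thesis .
    qed (simp add: Neutral)
  qed
qed

lemma integrable_word_op_slice:
  assumes K: "K \<in> sets borel" and f: "f \<in> borel_measurable list_borel" "dominated K M f"
    and g: "g \<in> borel_measurable list_borel" and good: "good K g ys"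
  shows "integrable \<sigma> (\<lambda>t. word_op \<sigma> lam v (\<lambda>ts. f (t # ts)) g (t # ys))"
proof (rule integrableI_bounded)
  note [measurable] = K measurable_majorant[OF K g]
  have "(\<integral>\<^sup>+t. ennreal (norm (word_op \<sigma> lam v (\<lambda>ts. f (t # ts)) g (t # ys))) \<partial>\<sigma>) \<le>
      (\<integral>\<^sup>+t. ennreal M * (indicator K t * majorant K g v (t # ys)) \<partial>\<sigma>)"
  proof (rule nn_integral_mono)
    fix t
    show "ennreal (norm (word_op \<sigma> lam v (\<lambda>ts. f (t # ts)) g (t # ys))) \<le>
        ennreal M * (indicator K t * majorant K g v (t # ys))"
      using word_op_bound[OF K g dominated_slice[OF f(2)]] dominated_slice_outside[OF f(2)]
      by (cases "t \<in> K") auto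
  qed
  also have "\<dots> = ennreal M * majorant K g (Annihilate # v) ys"
    by (simp add: nn_integral_cmult)
  also have "\<dots> < \<infinity>"
    using good[unfolded good_def, rule_format, of "Annihilate # v"] by (simp add: ennreal_mult_less_top)
  finally show "(\<integral>\<^sup>+t. ennreal (norm (word_op \<sigma> lam v (\<lambda>ts. f (t # ts)) g (t # ys))) \<partial>\<sigma>) < \<infinity>" .
qed (rule measurable_word_op_slice[OF f(1) g])

text \<open>
  How an identity at good points passes under the integral of an annihilation operator: almost
  all \<open>t \<in> K\<close> lead to good points again, and outside of \<open>K\<close> the kernels vanish.
\<close>

lemma AE_slice_eqI:
  assumes K: "compact K" and g: "g \<in> borel_measurable list_borel" and good: "good K g ys"
    and inside: "\<And>t. t \<in> K \<Longrightarrow> good K g (t # ys) \<Longrightarrow> F t = G t"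
    and outside: "\<And>t. t \<notin> K \<Longrightarrow> F t = G t"
  shows "AE t in \<sigma>. F t = G t"
  using AE_good_Cons[OF K g good] by eventually_elim (use inside outside in blast)

lemma word_op_add:
  assumes K: "compact K" and g: "g \<in> borel_measurable list_borel"
  shows "f \<in> borel_measurable list_borel \<Longrightarrow> dominated K M f \<Longrightarrow>
    f' \<in> borel_measurable list_borel \<Longrightarrow> dominated K M' f' \<Longrightarrow> good K g ys \<Longrightarrow>
    word_op \<sigma> lam v (\<lambda>ts. f ts + f' ts) g ys = word_op \<sigma> lam v f g ys + word_op \<sigma> lam v f' g ys"
proof (induction v arbitrary: f f' ys)
  case Nil
  then show ?case by (simp add: distrib_right)
next
  case (Cons x v)
  note [measurable] = g Cons.prems(1,3)
  note KB = compact_sets_borel[OF K]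
  have IH: "word_op \<sigma> lam v (\<lambda>ts. f (t # ts) + f' (t # ts)) g zs =
      word_op \<sigma> lam v (\<lambda>ts. f (t # ts)) g zs + word_op \<sigma> lam v (\<lambda>ts. f' (t # ts)) g zs"
    if "good K g zs" for t zs
    by (rule Cons.IH[OF _ dominated_slice[OF Cons.prems(2)] _ dominated_slice[OF Cons.prems(4)] that])
      measurable
  have out: "word_op \<sigma> lam v (\<lambda>ts. f (t # ts) + f' (t # ts)) g zs = 0"
      "word_op \<sigma> lam v (\<lambda>ts. f (t # ts)) g zs = 0" "word_op \<sigma> lam v (\<lambda>ts. f' (t # ts)) g zs = 0"
    if "t \<notin> K" for t zs
    using dominated_slice_outside[OF Cons.prems(2) that, THEN fun_cong]
      dominated_slice_outside[OF Cons.prems(4) that, THEN fun_cong] by simp_all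
  show ?case
  proof (cases x)
    case Create
    show ?thesis
    proof (cases ys)
      case (Cons y zs)
      then show ?thesis
        using Create IH out good_Cons[of K g y zs] \<open>good K g ys\<close> by (cases "y \<in> K") auto
    qed (simp add: Create)
  next
    case Neutral
    then show ?thesis
      using IH \<open>good K g ys\<close> by (cases ys) (auto simp: distrib_left)
  next
    case Annihilate
    have "(\<integral>t. word_op \<sigma> lam v (\<lambda>ts. f (t # ts) + f' (t # ts)) g (t # ys) \<partial>\<sigma>) =
        (\<integral>t. word_op \<sigma> lam v (\<lambda>ts. f (t # ts)) g (t # ys) + word_op \<sigma> lam v (\<lambda>ts. f' (t # ts)) g (t # ys) \<partial>\<sigma>)"
    proof (rule integral_cong_AE)
      show "AE t in \<sigma>. word_op \<sigma> lam v (\<lambda>ts. f (t # ts) + f' (t # ts)) g (t # ys) =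
          word_op \<sigma> lam v (\<lambda>ts. f (t # ts)) g (t # ys) + word_op \<sigma> lam v (\<lambda>ts. f' (t # ts)) g (t # ys)"
        by (rule AE_slice_eqI[OF K g \<open>good K g ys\<close>]) (simp_all add: IH out)
      show "(\<lambda>t. word_op \<sigma> lam v (\<lambda>ts. f (t # ts) + f' (t # ts)) g (t # ys)) \<in> borel_measurable \<sigma>"
        by (rule measurable_word_op_slice[where f = "\<lambda>ts. f ts + f' ts"]) measurable
      show "(\<lambda>t. word_op \<sigma> lam v (\<lambda>ts. f (t # ts)) g (t # ys) + word_op \<sigma> lam v (\<lambda>ts. f' (t # ts)) g (t # ys))
          \<in> borel_measurable \<sigma>"
        by (intro borel_measurable_add measurable_word_op_slice Cons.prems g)
    qed
    also have "\<dots> = (\<integral>t. word_op \<sigma> lam v (\<lambda>ts. f (t # ts)) g (t # ys) \<partial>\<sigma>) +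
        (\<integral>t. word_op \<sigma> lam v (\<lambda>ts. f' (t # ts)) g (t # ys) \<partial>\<sigma>)"
      using Cons.prems KB by (intro Bochner_Integration.integral_add integrable_word_op_slice[OF _ _ _ g]) auto
    finally show ?thesis using Annihilate by simp
  qed
qed

text \<open>
  Integration over a parameter of the kernel commutes with every word.  For the letters \<open>C\<close> and
  \<open>N\<close> this is immediate; for \<open>A\<close> it is Fubini's theorem, whose integrability hypothesis is
  the finiteness of the majorant at a good point.
\<close>

lemma word_op_integral:
  assumes K: "compact K" and g: "g \<in> borel_measurable list_borel"
  shows "(\<lambda>(s, ts). F s ts) \<in> borel_measurable (borel \<Otimes>\<^sub>M list_borel) \<Longrightarrow>
    (\<And>s. dominated K M (F s)) \<Longrightarrow> (\<And>s ts. s \<notin> K \<Longrightarrow> F s ts = 0) \<Longrightarrow> good K g ys \<Longrightarrow>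
    (\<integral>s. word_op \<sigma> lam v (F s) g ys \<partial>\<sigma>) = word_op \<sigma> lam v (\<lambda>ts. \<integral>s. F s ts \<partial>\<sigma>) g ys"
proof (induction v arbitrary: F ys)
  case Nil
  then show ?case by simp
next
  case (Cons x v)
  note [measurable] = g Cons.prems(1)
  note KB [measurable] = compact_sets_borel[OF K]
  note maj [measurable] = measurable_majorant[OF KB g]
  have IH: "(\<integral>s. word_op \<sigma> lam v (\<lambda>ts. F s (t # ts)) g zs \<partial>\<sigma>) =
      word_op \<sigma> lam v (\<lambda>ts. \<integral>s. F s (t # ts) \<partial>\<sigma>) g zs" if "good K g zs" for t zs
  proof (rule Cons.IH[OF _ dominated_slice[OF Cons.prems(2)] Cons.prems(3) that])
    have "(\<lambda>z. (fst z, t # snd z)) \<in> borel \<Otimes>\<^sub>M list_borel \<rightarrow>\<^sub>M borel \<Otimes>\<^sub>M list_borel"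
      by measurable
    from measurable_compose[OF this Cons.prems(1)]
    show "(\<lambda>(s, ts). F s (t # ts)) \<in> borel_measurable (borel \<Otimes>\<^sub>M list_borel)"
      by (simp add: split_beta')
  qed
  have out: "F s (t # ts) = 0" if "t \<notin> K" for s t ts
    using dominated_slice_outside[OF Cons.prems(2) that, THEN fun_cong] by simp
  show ?case
  proof (cases x)
    case Create
    show ?thesis
    proof (cases ys)
      case (Cons y zs)
      then show ?thesis
        using Create IH out good_Cons[of K g y zs] \<open>good K g ys\<close> by (cases "y \<in> K") auto
    qed (simp add: Create)
  next
    case Neutral
    then show ?thesis
      using IH \<open>good K g ys\<close> by (cases ys) auto
  next
    case Annihilate
    let ?W = "\<lambda>s t. word_op \<sigma> lam v (\<lambda>ts. F s (t # ts)) g (t # ys)"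
    have [measurable]: "(\<lambda>us. F (hd us) (tl us)) \<in> borel_measurable list_borel"
      by measurable
    have meas [measurable]: "(\<lambda>(s, t). ?W s t) \<in> borel_measurable (\<sigma> \<Otimes>\<^sub>M \<sigma>)"
      using measurable_word_op[of "\<lambda>us. F (hd us) (tl us)" g "\<lambda>z. [fst z, snd z]" "\<sigma> \<Otimes>\<^sub>M \<sigma>" "\<lambda>z. snd z # ys" v]
      by (simp add: split_beta')
    have bound: "ennreal \<bar>?W s t\<bar> \<le> ennreal M * indicator K s * (indicator K t * majorant K g v (t # ys))" for s t
    proof (cases "s \<in> K \<and> t \<in> K")
      case True
      then show ?thesis using word_op_bound[OF KB g dominated_slice[OF Cons.prems(2)]] by simp
    qed (use Cons.prems(3) out in \<open>auto split: split_indicator\<close>)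
    have int: "integrable (\<sigma> \<Otimes>\<^sub>M \<sigma>) (\<lambda>(s, t). ?W s t)"
    proof (rule integrableI_bounded)
      have "(\<integral>\<^sup>+z. ennreal (norm (case z of (s, t) \<Rightarrow> ?W s t)) \<partial>(\<sigma> \<Otimes>\<^sub>M \<sigma>)) \<le>
          (\<integral>\<^sup>+z. ennreal M * indicator K (fst z) * (indicator K (snd z) * majorant K g v (snd z # ys)) \<partial>(\<sigma> \<Otimes>\<^sub>M \<sigma>))"
        by (intro nn_integral_mono) (use bound in \<open>auto simp: split_beta'\<close>)
      also have "\<dots> = (\<integral>\<^sup>+s. \<integral>\<^sup>+t. ennreal M * indicator K s * (indicator K t * majorant K g v (t # ys)) \<partial>\<sigma> \<partial>\<sigma>)"
        by (subst sigma_finite_measure.nn_integral_fst[OF sigma_finite_sigma, symmetric]) simp_all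
      also have "\<dots> = ennreal M * emeasure \<sigma> K * majorant K g (Annihilate # v) ys"
        by (simp add: nn_integral_cmult nn_integral_multc)
      also have "\<dots> < \<infinity>"
        using \<open>good K g ys\<close>[unfolded good_def, rule_format, of "Annihilate # v"] compact_finite[OF K]
        by (simp add: ennreal_mult_less_top)
      finally show "(\<integral>\<^sup>+z. ennreal (norm (case z of (s, t) \<Rightarrow> ?W s t)) \<partial>(\<sigma> \<Otimes>\<^sub>M \<sigma>)) < \<infinity>" .
    qed measurable
    have "(\<integral>s. \<integral>t. ?W s t \<partial>\<sigma> \<partial>\<sigma>) = (\<integral>t. \<integral>s. ?W s t \<partial>\<sigma> \<partial>\<sigma>)"
      using Fubini_integral[OF int] by simp
    also have "\<dots> = (\<integral>t. word_op \<sigma> lam v (\<lambda>ts. \<integral>s. F s (t # ts) \<partial>\<sigma>) g (t # ys) \<partial>\<sigma>)"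
    proof (rule integral_cong_AE)
      show "AE t in \<sigma>. (\<integral>s. ?W s t \<partial>\<sigma>) = word_op \<sigma> lam v (\<lambda>ts. \<integral>s. F s (t # ts) \<partial>\<sigma>) g (t # ys)"
        by (rule AE_slice_eqI[OF K g \<open>good K g ys\<close>]) (simp_all add: IH out)
      show "(\<lambda>t. \<integral>s. ?W s t \<partial>\<sigma>) \<in> borel_measurable \<sigma>" by measurable
      show "(\<lambda>t. word_op \<sigma> lam v (\<lambda>ts. \<integral>s. F s (t # ts) \<partial>\<sigma>) g (t # ys)) \<in> borel_measurable \<sigma>"
        by (rule measurable_word_op_slice[where f = "\<lambda>ts. \<integral>s. F s ts \<partial>\<sigma>"]) measurable
    qed
    finally show ?thesis using Annihilate by simp
  qed
qed

lemma word_op_fock_space: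
  assumes K: "compact K" and f: "f \<in> borel_measurable list_borel" "dominated K M f"
    and g: "g \<in> fock_space \<sigma>"
  shows "word_op \<sigma> lam v f g \<in> fock_space \<sigma>"
  unfolding fock_space_iff
proof
  note KB = compact_sets_borel[OF K]
  have gm: "g \<in> borel_measurable list_borel" using g by (simp add: fock_space_iff)
  note [measurable] = measurable_majorant[OF KB gm]
  show "word_op \<sigma> lam v f g \<in> borel_measurable list_borel"
    using measurable_word_op[OF f(1) gm measurable_Nil measurable_ident, of v]
    by (simp only: append_Nil id_apply)
  have "fock_nn_integral (\<lambda>ys. ennreal ((word_op \<sigma> lam v f g ys)\<^sup>2)) \<le>
      fock_nn_integral (\<lambda>ys. (ennreal M)\<^sup>2 * (majorant K g v ys)\<^sup>2)"
  proof (rule fock_nn_integral_mono)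
    fix ys
    have "ennreal ((word_op \<sigma> lam v f g ys)\<^sup>2) = (ennreal \<bar>word_op \<sigma> lam v f g ys\<bar>)\<^sup>2"
      by (simp add: ennreal_power)
    also have "\<dots> \<le> (ennreal M * majorant K g v ys)\<^sup>2"
      using word_op_bound[OF KB gm f(2)] by (intro power_mono) auto
    finally show "ennreal ((word_op \<sigma> lam v f g ys)\<^sup>2) \<le> (ennreal M)\<^sup>2 * (majorant K g v ys)\<^sup>2"
      by (simp add: power_mult_distrib)
  qed
  also have "\<dots> = (ennreal M)\<^sup>2 * fock_nn_integral (\<lambda>ys. (majorant K g v ys)\<^sup>2)"
    by (rule fock_nn_integral_cmult) simp
  also have "\<dots> < \<infinity>"
    using fock_nn_integral_majorant[OF K g] by (simp add: ennreal_mult_less_top power_less_top_ennreal)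
  finally show "fock_nn_integral (\<lambda>ys. ennreal ((word_op \<sigma> lam v f g ys)\<^sup>2)) < \<infinity>" .
qed

end

section \<open>Compactly supported kernels and their contractions\<close>

text \<open>
  Test functions, normalized to vanish on lists of the wrong length and with the compact set that
  contains all coordinates of the support made explicit.  Continuity is expressed on \<open>nat \<Rightarrow> 'a\<close>,
  where coordinate changes are continuous maps of one and the same space.
\<close>

definition kernels :: "nat \<Rightarrow> 'a set \<Rightarrow> ('a::topological_space list \<Rightarrow> real) set" where
  "kernels n K = {f. (\<forall>ts. f ts \<noteq> 0 \<longrightarrow> length ts = n \<and> set ts \<subseteq> K) \<and>
     continuous_on UNIV (\<lambda>x. f (list_of n x))}"

lemma kernelsI:
  assumes "\<And>ts. f ts \<noteq> 0 \<Longrightarrow> length ts = n" "\<And>ts. f ts \<noteq> 0 \<Longrightarrow> set ts \<subseteq> K"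
    and "continuous_on UNIV (\<lambda>x. f (list_of n x))"
  shows "f \<in> kernels n K"
  using assms by (simp add: kernels_def)

lemma kernelsD:
  assumes "f \<in> kernels n K"
  shows "f ts \<noteq> 0 \<Longrightarrow> length ts = n" "f ts \<noteq> 0 \<Longrightarrow> set ts \<subseteq> K"
    "continuous_on UNIV (\<lambda>x. f (list_of n x))"
  using assms by (auto simp: kernels_def)

lemma kernels_mono: "K \<subseteq> K' \<Longrightarrow> kernels n K \<subseteq> kernels n K'"
  by (auto simp: kernels_def)

lemma kernels_zero [simp]: "(\<lambda>_. 0) \<in> kernels n K"
  by (simp add: kernels_def)

lemma kernels_add: "f \<in> kernels n K \<Longrightarrow> f' \<in> kernels n K \<Longrightarrow> (\<lambda>ts. f ts + f' ts) \<in> kernels n K"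
proof (rule kernelsI)
  fix ts assume f: "f \<in> kernels n K" "f' \<in> kernels n K" "f ts + f' ts \<noteq> 0"
  then have "f ts \<noteq> 0 \<or> f' ts \<noteq> 0" by auto
  with f show "length ts = n" "set ts \<subseteq> K" using kernelsD(1,2) by blast+
qed (intro continuous_on_add kernelsD(3))

lemma kernels_scale: "f \<in> kernels n K \<Longrightarrow> (\<lambda>ts. c * f ts) \<in> kernels n K"
  by (rule kernelsI) (auto intro: continuous_on_mult_left kernelsD dest: kernelsD)

lemma continuous_on_reindex:
  assumes "continuous_on UNIV h" and "\<And>i. continuous_on UNIV (\<lambda>x. \<phi> x i)"
  shows "continuous_on UNIV (\<lambda>x. h (\<phi> x :: nat \<Rightarrow> 'a::topological_space))"
  using continuous_on_compose2[OF assms(1) continuous_on_coordinatewise_then_product[OF assms(2)]]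
  by simp

lemma continuous_on_eval [simp]: "continuous_on S (\<lambda>x::nat \<Rightarrow> 'a::topological_space. x i)"
  by (rule continuous_on_subset[OF continuous_on_product_coordinates]) simp

lemma kernels_slice:
  assumes "f \<in> kernels (Suc n) K"
  shows "(\<lambda>ts. f (t # ts)) \<in> kernels n K"
proof (rule kernelsI)
  have "continuous_on UNIV (\<lambda>x. f (list_of (Suc n) (case_nat t x)))"
  proof (rule continuous_on_reindex[OF kernelsD(3)[OF assms]])
    fix i show "continuous_on UNIV (\<lambda>x. case_nat t x i)" by (cases i) auto
  qed
  then show "continuous_on UNIV (\<lambda>x. f (t # list_of n x))"
    by (simp add: list_of_Suc)
qed (use kernelsD[OF assms] in force)+

lemma kernels_slice_outside: "f \<in> kernels n K \<Longrightarrow> t \<notin> K \<Longrightarrow> f (t # ts) = 0"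
  using kernelsD(2) by fastforce

lemma kernels_measurable:
  fixes f :: "'a::second_countable_topology list \<Rightarrow> real"
  assumes "f \<in> kernels n K"
  shows "f \<in> borel_measurable list_borel"
  unfolding measurable_from_list_borel_iff
proof
  fix m
  show "(\<lambda>x. f (list_of m x)) \<in> borel_measurable (borel_power m)"
  proof (cases "m = n")
    case True
    have 1: "(\<lambda>x. f (list_of n x)) \<in> borel_measurable (Pi\<^sub>M UNIV (\<lambda>_. borel))"
      using borel_measurable_continuous_onI[OF kernelsD(3)[OF assms]]
      by (simp cong: measurable_cong_sets add: sets_PiM_equal_borel)
    have 2: "(\<lambda>x i. if i < n then x i else undefined) \<in> borel_power n \<rightarrow>\<^sub>M Pi\<^sub>M UNIV (\<lambda>_. borel :: 'a measure)"
    proof (rule measurable_PiM_single')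
      fix i
      show "(\<lambda>x. if i < n then x i else undefined) \<in> borel_power n \<rightarrow>\<^sub>M (borel :: 'a measure)"
        by (cases "i < n") auto
    qed auto
    have "list_of n (\<lambda>i. if i < n then x i else undefined) = list_of n x" for x :: "nat \<Rightarrow> 'a"
      by (rule list_of_cong) simp
    with measurable_compose[OF 2 1] True show ?thesis by simp
  next
    case False
    then have "f (list_of m x) = 0" for x using kernelsD(1)[OF assms] by force
    then show ?thesis by simp
  qed
qed

lemma kernels_dominated:
  assumes K: "compact K" and f: "f \<in> kernels n K"
  obtains M where "dominated K M f"
proof -
  let ?X = "\<Pi>\<^sub>E i\<in>UNIV. if i < n then K else {undefined}"
  have "compactin (product_topology (\<lambda>_::nat. euclidean) UNIV) ?X"
    using K by (simp add: compactin_PiE)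
  then have "compact ?X" by (simp add: euclidean_product_topology)
  then have "compact ((\<lambda>x. f (list_of n x)) ` ?X)"
    by (rule compact_continuous_image[rotated]) (rule continuous_on_subset[OF kernelsD(3)[OF f]], simp)
  then obtain M where M: "\<forall>x\<in>?X. \<bar>f (list_of n x)\<bar> \<le> M"
    by (auto dest!: compact_imp_bounded simp: bounded_iff)
  have "\<bar>f ts\<bar> \<le> max M 0" for ts
  proof (cases "f ts = 0")
    case False
    then have ts: "length ts = n" "set ts \<subseteq> K" using kernelsD[OF f] by auto
    let ?x = "\<lambda>i. if i < n then ts ! i else undefined"
    have "list_of n ?x = list_of n (\<lambda>i. ts ! i)" by (rule list_of_cong) simp
    also have "\<dots> = ts" using ts(1) by (rule list_of_nth)
    finally have "list_of n ?x = ts" .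
    moreover have "?x \<in> ?X" using ts by (auto simp: subset_iff)
    ultimately show ?thesis using M[rule_format, of ?x] by simp
  qed simp
  then have "dominated K (max M 0) f"
    using kernelsD[OF f] by (auto simp: dominated_def)
  then show ?thesis by (rule that)
qed

lemma continuous_map_power_topology_iff:
  "continuous_map (power_topology n) euclideanreal (coords n f) \<longleftrightarrow>
     continuous_on UNIV (\<lambda>x. f (list_of n x))"
proof
  assume c: "continuous_map (power_topology n) euclideanreal (coords n f)"
  have "continuous_map euclidean (power_topology n) (\<lambda>x. restrict x {..<n})"
    by (auto simp: continuous_map_componentwise)
  from continuous_map_compose[OF this c]
  show "continuous_on UNIV (\<lambda>x. f (list_of n x))" by (simp add: o_def coords_list_of)
next
  assume c: "continuous_on UNIV (\<lambda>x. f (list_of n x))"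
  have "continuous_map (power_topology n) (product_topology (\<lambda>_. euclidean) UNIV) (\<lambda>x. x)"
    unfolding continuous_map_componentwise_UNIV
  proof
    fix k
    show "continuous_map (power_topology n) euclidean (\<lambda>x. x k)"
    proof (cases "k < n")
      case False
      have "continuous_map (power_topology n) euclidean (\<lambda>x. undefined)" by simp
      then show ?thesis
        by (rule continuous_map_eq) (use False in \<open>auto simp: PiE_iff extensional_def\<close>)
    qed (use continuous_map_product_projection[of k "{..<n}" "\<lambda>_. euclidean"] in simp)
  qed
  from continuous_map_compose[OF this, of euclideanreal "coords n f"] c
  show "continuous_map (power_topology n) euclideanreal (coords n f)"
    by (simp add: o_def coords_list_of euclidean_product_topology)
qed

lemma kernels_imp_test_functions:
  fixes f :: "'a::t2_space list \<Rightarrow> real"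
  assumes K: "compact K" and f: "f \<in> kernels n K"
  shows "f \<in> test_functions n"
proof -
  let ?S = "{x \<in> topspace (power_topology n). coords n f x \<noteq> 0}"
  have c: "compactin (power_topology n) (\<Pi>\<^sub>E i\<in>{..<n}. K)"
    using K by (simp add: compactin_PiE)
  have "closedin (power_topology n) (\<Pi>\<^sub>E i\<in>{..<n}. K)"
    using K by (simp add: closedin_product_topology compact_imp_closed)
  moreover have "?S \<subseteq> (\<Pi>\<^sub>E i\<in>{..<n}. K)"
  proof
    fix x assume x: "x \<in> ?S"
    then have "set (list_of n x) \<subseteq> K"
      using kernelsD(2)[OF f] by (simp add: coords_list_of)
    then show "x \<in> (\<Pi>\<^sub>E i\<in>{..<n}. K)"
      using x by (auto simp: PiE_iff list_of_def)
  qed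
  ultimately have "power_topology n closure_of ?S \<subseteq> (\<Pi>\<^sub>E i\<in>{..<n}. K)"
    by (rule closure_of_minimal[rotated])
  then have "compactin (power_topology n) (power_topology n closure_of ?S)"
    by (rule closed_compactin[OF c]) simp
  then show ?thesis
    using kernelsD(3)[OF f] by (simp add: test_functions_def continuous_map_power_topology_iff)
qed

text \<open>
  The compact set is the union of the coordinate projections of the support.
\<close>

lemma test_functions_imp_kernels:
  fixes f :: "'a::t2_space list \<Rightarrow> real"
  assumes "f \<in> test_functions n"
  obtains K where "compact K" "(\<lambda>ts. if length ts = n then f ts else 0) \<in> kernels n K"
proof -
  let ?S = "{x \<in> topspace (power_topology n). coords n f x \<noteq> 0}"
  let ?C = "power_topology n closure_of ?S"
  define K where "K = (\<Union>i<n. (\<lambda>x. x i) ` ?C)"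
  have C: "compactin (power_topology n) ?C" and cont: "continuous_on UNIV (\<lambda>x. f (list_of n x))"
    using assms by (auto simp: test_functions_def continuous_map_power_topology_iff)
  have "compact ((\<lambda>x. x i) ` ?C)" if "i < n" for i
    using image_compactin[OF C continuous_map_product_projection, of i] that by simp
  then have "compact K" unfolding K_def by (intro compact_UN) auto
  moreover have "(\<lambda>ts. if length ts = n then f ts else 0) \<in> kernels n K"
  proof (rule kernelsI)
    fix ts :: "'a list"
    assume *: "(if length ts = n then f ts else 0) \<noteq> 0"
    then have n: "length ts = n" and nz: "f ts \<noteq> 0" by (auto split: if_splits)
    let ?x = "restrict (\<lambda>i. ts ! i) {..<n}"
    have "?x \<in> ?S" using nz by (simp add: coords_list_of list_of_nth[OF n])
    moreover have "?S \<subseteq> ?C" by (rule closure_of_subset) auto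
    ultimately have x: "?x \<in> ?C" by blast
    show "set ts \<subseteq> K"
    proof
      fix t assume "t \<in> set ts"
      then obtain i where "i < n" "ts ! i = t" using n by (auto simp: in_set_conv_nth)
      with x show "t \<in> K" unfolding K_def by (force intro!: bexI[of _ i] image_eqI[of _ _ ?x])
    qed
  qed (use cont in \<open>auto split: if_splits\<close>)
  ultimately show ?thesis by (rule that)
qed

text \<open>
  Restriction to the diagonal \<open>t\<^sub>k = t\<^sub>k\<^sub>+\<^sub>1\<close> (counting from 0), weighted by \<open>w\<close>.  Together with
  integration over the variable that remains, it describes the contraction
  \<open>\<partial>\<^sub>s\<partial>\<^sup>\<dagger>\<^sub>t = \<delta>(s,t)\<close>.
\<close>

definition diagonal :: "('a \<Rightarrow> real) \<Rightarrow> nat \<Rightarrow> ('a list \<Rightarrow> real) \<Rightarrow> 'a list \<Rightarrow> real" where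
  "diagonal w k f ts = (if k < length ts then w (ts ! k) * f (take (Suc k) ts @ drop k ts) else 0)"

lemma diagonal_0 [simp]: "diagonal w 0 f (t # ts) = w t * f (t # t # ts)"
  by (simp add: diagonal_def)

lemma diagonal_Suc [simp]: "diagonal w (Suc k) f (t # ts) = diagonal w k (\<lambda>ts. f (t # ts)) ts"
  by (simp add: diagonal_def)

lemma kernels_diagonal:
  assumes w: "continuous_on UNIV w" and f: "f \<in> kernels (Suc n) K"
  shows "diagonal w k f \<in> kernels n K"
proof (rule kernelsI)
  fix ts assume "diagonal w k f ts \<noteq> 0"
  then have *: "f (take (Suc k) ts @ drop k ts) \<noteq> 0" "k < length ts"
    by (auto simp: diagonal_def split: if_splits)
  show "length ts = n" using kernelsD(1)[OF f *(1)] *(2) by auto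
  have "set ts = set (take k ts) \<union> set (drop k ts)"
    by (metis append_take_drop_id set_append)
  also have "\<dots> \<subseteq> set (take (Suc k) ts @ drop k ts)"
    using set_take_subset_set_take[of k "Suc k" ts] by auto
  also have "\<dots> \<subseteq> K" using kernelsD(2)[OF f *(1)] .
  finally show "set ts \<subseteq> K" .
next
  show "continuous_on UNIV (\<lambda>x. diagonal w k f (list_of n x))"
  proof (cases "k < n")
    case True
    have "take (Suc k) (list_of n x) @ drop k (list_of n x) =
        list_of (Suc n) (\<lambda>i. if i \<le> k then x i else x (i - 1))" for x :: "nat \<Rightarrow> 'a"
      using True by (intro nth_equalityI) (auto simp: nth_append min_def intro!: arg_cong[where f = x])
    then have eq: "diagonal w k f (list_of n x) =
        w (x k) * f (list_of (Suc n) (\<lambda>i. if i \<le> k then x i else x (i - 1)))" for x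
      using True by (simp add: diagonal_def)
    have "continuous_on UNIV (\<lambda>x. f (list_of (Suc n) (\<lambda>i. if i \<le> k then x i else x (i - 1))))"
    proof (rule continuous_on_reindex[OF kernelsD(3)[OF f]])
      fix i show "continuous_on UNIV (\<lambda>x. if i \<le> k then x i else x (i - 1))"
        by (cases "i \<le> k") simp_all
    qed
    moreover have "continuous_on UNIV (\<lambda>x::nat \<Rightarrow> 'a. w (x k))"
      by (rule continuous_on_compose2[OF w]) auto
    ultimately show ?thesis unfolding eq by (rule continuous_on_mult[rotated])
  qed (simp add: diagonal_def)
qed

context fock_model
begin

definition integrate_out :: "nat \<Rightarrow> ('a list \<Rightarrow> real) \<Rightarrow> 'a list \<Rightarrow> real" where
  "integrate_out k f ts = (\<integral>s. f (take k ts @ s # drop k ts) \<partial>\<sigma>)"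

lemma integrate_out_0 [simp]: "integrate_out 0 f ts = (\<integral>s. f (s # ts) \<partial>\<sigma>)"
  by (simp add: integrate_out_def)

lemma integrate_out_Suc [simp]:
  "integrate_out (Suc k) f (t # ts) = integrate_out k (\<lambda>ts. f (t # ts)) ts"
  by (simp add: integrate_out_def)

text \<open>
  Continuity of a parameter integral by dominated convergence.  Sequences suffice since the
  topology of \<open>nat \<Rightarrow> 'a\<close> is first countable, and the integrand is dominated by a multiple of
  \<open>1\<^sub>K\<close> because the variable integrated over is one of the coordinates of the kernel.
\<close>

lemma kernels_integrate_out:
  assumes K: "compact K" and f: "f \<in> kernels (Suc n) K" and k: "k \<le> n"
  shows "integrate_out k f \<in> kernels n K"
proof (rule kernelsI)
  fix ts assume "integrate_out k f ts \<noteq> 0"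
  then obtain s where s: "f (take k ts @ s # drop k ts) \<noteq> 0"
    unfolding integrate_out_def by (metis (mono_tags, lifting) integral_zero Bochner_Integration.integral_cong)
  show "length ts = n" using kernelsD(1)[OF f s] by auto
  have "set ts = set (take k ts) \<union> set (drop k ts)"
    by (metis append_take_drop_id set_append)
  also have "\<dots> \<subseteq> K" using kernelsD(2)[OF f s] by auto
  finally show "set ts \<subseteq> K" .
next
  obtain M where M: "dominated K M f" using kernels_dominated[OF K f] .
  \<comment> \<open>\<open>\<phi> s x\<close> inserts the value \<open>s\<close> at position \<open>k\<close>.\<close>
  define \<phi> where "\<phi> = (\<lambda>s (x :: nat \<Rightarrow> 'a) i. if i < k then x i else if i = k then s else x (i - 1))"
  have "take k (list_of n x) @ s # drop k (list_of n x) = list_of (Suc n) (\<phi> s x)" for s x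
    using k by (intro nth_equalityI) (auto simp: nth_append nth_Cons \<phi>_def split: nat.split intro!: arg_cong[where f = x])
  then have eq: "integrate_out k f (list_of n x) = (\<integral>s. f (list_of (Suc n) (\<phi> s x)) \<partial>\<sigma>)" for x
    by (simp add: integrate_out_def)
  have c: "continuous_on UNIV (\<lambda>x. f (list_of (Suc n) (\<phi> s x)))" for s
  proof (rule continuous_on_reindex[OF kernelsD(3)[OF f]])
    fix i show "continuous_on UNIV (\<lambda>x. \<phi> s x i)"
      unfolding \<phi>_def by (cases "i < k"; cases "i = k") simp_all
  qed
  have c': "continuous_on UNIV (\<lambda>s. f (list_of (Suc n) (\<phi> s x)))" for x
  proof (rule continuous_on_reindex[OF kernelsD(3)[OF f]])
    fix i show "continuous_on UNIV (\<lambda>s. \<phi> s x i)"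
      unfolding \<phi>_def by (cases "i < k"; cases "i = k") simp_all
  qed
  have meas: "(\<lambda>s. f (list_of (Suc n) (\<phi> s y))) \<in> borel_measurable \<sigma>" for y
    using borel_measurable_continuous_onI[OF c'[of y]]
    by (simp cong: measurable_cong_sets add: sets_sigma)
  have bound: "\<bar>f (list_of (Suc n) (\<phi> s x))\<bar> \<le> M * indicator K s" for s x
  proof (cases "f (list_of (Suc n) (\<phi> s x)) = 0")
    case False
    then have "set (list_of (Suc n) (\<phi> s x)) \<subseteq> K" using M by (simp add: dominated_def)
    moreover have "list_of (Suc n) (\<phi> s x) ! k \<in> set (list_of (Suc n) (\<phi> s x))"
      using k by (intro nth_mem) simp
    ultimately have "list_of (Suc n) (\<phi> s x) ! k \<in> K" by blast
    then have "\<phi> s x k \<in> K" using k by simp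
    then show ?thesis using M by (simp add: dominated_def \<phi>_def)
  qed (simp add: dominated_nonneg[OF M])
  have "((\<lambda>x. integrate_out k f (list_of n x)) \<longlongrightarrow> integrate_out k f (list_of n x)) (at x)" for x
    unfolding tendsto_at_iff_sequentially
  proof (intro allI impI)
    fix X :: "nat \<Rightarrow> nat \<Rightarrow> 'a" assume X: "X \<longlonglongrightarrow> x"
    have "(\<lambda>i. \<integral>s. f (list_of (Suc n) (\<phi> s (X i))) \<partial>\<sigma>) \<longlonglongrightarrow> (\<integral>s. f (list_of (Suc n) (\<phi> s x)) \<partial>\<sigma>)"
    proof (rule integral_dominated_convergence[where w = "\<lambda>s. M * indicator K s"])
      show "integrable \<sigma> (\<lambda>s. M * indicator K s)"
        using compact_finite[OF K] compact_sets_borel[OF K]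
        by (intro integrable_mult_right integrable_real_indicator) (auto simp: sets_sigma)
      show "AE s in \<sigma>. (\<lambda>i. f (list_of (Suc n) (\<phi> s (X i)))) \<longlonglongrightarrow> f (list_of (Suc n) (\<phi> s x))"
        by (intro AE_I2 continuous_on_tendsto_compose[OF c X]) auto
    qed (use bound meas in auto)
    then show "((\<lambda>x. integrate_out k f (list_of n x)) \<circ> X) \<longlonglongrightarrow> integrate_out k f (list_of n x)"
      by (simp add: o_def eq)
  qed
  then show "continuous_on UNIV (\<lambda>x. integrate_out k f (list_of n x))"
    by (simp add: continuous_on_def)
qed

end

section \<open>The contraction identity\<close>

text \<open>
  The words of \<open>\<omega>(t\<^sub>1)\<dots>\<omega>(t\<^sub>k):\<omega>(t\<^sub>k\<^sub>+\<^sub>1)\<dots>\<omega>(t\<^sub>k\<^sub>+\<^sub>m):\<close>, which interpolates between the Wick product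
  (\<open>k = 0\<close>) and the monomial (\<open>m = 0\<close>).
\<close>

primrec mixed_words :: "nat \<Rightarrow> nat \<Rightarrow> letter list set" where
  "mixed_words 0 m = wick_words m"
| "mixed_words (Suc k) m = (\<Union>x. (#) x ` mixed_words k m)"

lemma UNIV_letter: "(UNIV :: letter set) = {Create, Annihilate, Neutral}"
  using letter.exhaust by auto

lemma wick_words_0 [simp]: "wick_words 0 = {[]}"
  by (auto simp: wick_words_def)

lemma finite_wick_words [simp]: "finite (wick_words n)"
  by (induction n) (simp_all add: wick_words_Suc)

lemma finite_mixed_words [simp]: "finite (mixed_words k m)"
  by (induction k) (simp_all add: UNIV_letter)

lemma length_wick_words: "w \<in> wick_words n \<Longrightarrow> length w = n"
  by (simp add: wick_words_eq)

lemma length_mixed_words: "w \<in> mixed_words k m \<Longrightarrow> length w = k + m"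
  by (induction k arbitrary: w) (auto simp: length_wick_words)

lemma mixed_words_all: "mixed_words n 0 = {w. length w = n}"
proof (induction n)
  case (Suc n)
  then show ?case by (auto simp: length_Suc_conv)
qed auto

text \<open>
  A Wick product with one factor is that factor: \<open>:\<omega>(t): = \<omega>(t)\<close>.
\<close>

lemma mixed_words_Suc_0: "mixed_words k (Suc 0) = mixed_words (Suc k) 0"
  by (induction k) (auto simp: wick_words_Suc UNIV_letter)

lemma sum_mixed_words_Suc:
  "(\<Sum>w\<in>mixed_words (Suc k) m. F w) =
     (\<Sum>u\<in>mixed_words k m. F (Create # u)) + (\<Sum>u\<in>mixed_words k m. F (Annihilate # u)) +
     (\<Sum>u\<in>mixed_words k m. F (Neutral # u))"
proof -
  have "(\<Sum>w\<in>mixed_words (Suc k) m. F w) =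
      (\<Sum>x\<in>UNIV. \<Sum>w\<in>(#) x ` mixed_words k m. F w)"
    unfolding mixed_words.simps by (rule sum.UNION_disjoint) (auto simp: UNIV_letter)
  also have "\<dots> = (\<Sum>x\<in>UNIV. \<Sum>u\<in>mixed_words k m. F (x # u))"
    by (simp add: sum.reindex)
  finally show ?thesis by (simp add: UNIV_letter add.assoc)
qed

lemma sum_wick_words_Suc:
  "(\<Sum>w\<in>wick_words (Suc m). F w) =
     F (Neutral # replicate m Annihilate) + F (Annihilate # replicate m Annihilate) +
     (\<Sum>v\<in>wick_words m. F (Create # v))"
proof -
  have "Neutral # replicate m Annihilate \<notin>
      insert (Annihilate # replicate m Annihilate) ((#) Create ` wick_words m)"
    and "Annihilate # replicate m Annihilate \<notin> (#) Create ` wick_words m"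
    by auto
  then show ?thesis
    unfolding wick_words_Suc replicate_Suc by (simp add: sum.reindex add.assoc)
qed

definition word_sum ::
  "'a measure \<Rightarrow> ('a \<Rightarrow> real) \<Rightarrow> letter list set \<Rightarrow> ('a list \<Rightarrow> real) \<Rightarrow> 'a operator" where
  "word_sum \<sigma> lam S f = (\<lambda>g ys. \<Sum>w\<in>S. word_op \<sigma> lam w f g ys)"

lemma free_wick_product_word_sum: "free_wick_product \<sigma> lam n f = word_sum \<sigma> lam (mixed_words 0 n) f"
  by (simp add: free_wick_product_def word_sum_def)

lemma monomial_word_sum: "monomial \<sigma> lam n f = word_sum \<sigma> lam (mixed_words n 0) f"
  by (simp add: monomial_def word_sum_def mixed_words_all)

lemma word_sum_zero [simp]: "word_sum \<sigma> lam S (\<lambda>_. 0) g ys = 0"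
  by (simp add: word_sum_def)

lemma word_sum_scale: "word_sum \<sigma> lam S (\<lambda>ts. c * f ts) g ys = c * word_sum \<sigma> lam S f g ys"
  by (simp add: word_sum_def word_op_scale sum_distrib_left)

lemma sum_Create_words:
  "(\<Sum>u\<in>S. word_op \<sigma> lam (Create # u) f g ys) =
     (case ys of [] \<Rightarrow> 0 | y # zs \<Rightarrow> word_sum \<sigma> lam S (\<lambda>ts. f (y # ts)) g zs)"
  by (cases ys) (simp_all add: word_sum_def)

lemma sum_Neutral_words:
  "(\<Sum>u\<in>S. word_op \<sigma> lam (Neutral # u) f g ys) =
     (case ys of [] \<Rightarrow> 0 | y # zs \<Rightarrow> lam y * word_sum \<sigma> lam S (\<lambda>ts. f (y # ts)) g (y # zs))"
  by (cases ys) (simp_all add: word_sum_def sum_distrib_left)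

text \<open>
  In this and the two following rules, \<open>N\<close> acts through the delta function in
  \<open>lam(s)\<partial>\<^sup>\<dagger>\<^sub>s\<partial>\<^sub>s\<partial>\<^sup>\<dagger>\<^sub>t = lam(s)\<delta>(s,t)\<partial>\<^sup>\<dagger>\<^sub>s\<close> and its relatives: two adjacent letters merge into one, and
  the kernel is restricted to the diagonal with weight \<open>lam\<close>.
\<close>

lemma word_op_Annihilate_Neutral:
  "word_op \<sigma> lam (Annihilate # Neutral # v) f g ys =
     word_op \<sigma> lam (Annihilate # v) (diagonal lam 0 f) g ys"
  by (simp add: word_op_scale)

lemma word_op_Neutral_Neutral:
  "word_op \<sigma> lam (Neutral # Neutral # v) f g ys =
     word_op \<sigma> lam (Neutral # v) (diagonal lam 0 f) g ys"
  by (simp add: word_op_scale split: list.split)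

lemma word_op_Neutral_Create:
  "word_op \<sigma> lam (Neutral # Create # v) f g ys =
     word_op \<sigma> lam (Create # v) (diagonal lam 0 f) g ys"
  by (simp add: word_op_scale split: list.split)

context fock_model
begin

text \<open>
  The contraction \<open>\<partial>\<^sub>s\<partial>\<^sup>\<dagger>\<^sub>t = \<delta>(s,t)\<close>.  The integral over the diagonal variable has to be moved
  past the remaining word, which is where good points enter.
\<close>

lemma word_op_Annihilate_Create:
  assumes K: "compact K" and g: "g \<in> borel_measurable list_borel"
    and f: "f \<in> kernels (Suc (Suc m)) K" and good: "good K g ys"
  shows "word_op \<sigma> lam (Annihilate # Create # v) f g ys =
     word_op \<sigma> lam v (integrate_out 0 (diagonal (\<lambda>_. 1) 0 f)) g ys"
proof -
  obtain M where M: "dominated K M f" using kernels_dominated[OF K f] .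
  note [measurable] = kernels_measurable[OF f]
  have "(\<integral>s. word_op \<sigma> lam v (\<lambda>ts. f (s # s # ts)) g ys \<partial>\<sigma>) =
      word_op \<sigma> lam v (\<lambda>ts. \<integral>s. f (s # s # ts) \<partial>\<sigma>) g ys"
  proof (rule word_op_integral[OF K g _ _ _ good])
    show "(\<lambda>(s, ts). f (s # s # ts)) \<in> borel_measurable (borel \<Otimes>\<^sub>M list_borel)" by measurable
    show "dominated K M (\<lambda>ts. f (s # s # ts))" for s
      by (rule dominated_slice[OF dominated_slice[OF M]])
    show "f (s # s # ts) = 0" if "s \<notin> K" for s ts
      using kernels_slice_outside[OF f that] .
  qed
  then show ?thesis by (simp add: integrate_out_def[abs_def] diagonal_def)
qed

lemma integrable_word_sum:
  assumes K: "compact K" and g: "g \<in> borel_measurable list_borel"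
    and f: "f \<in> kernels n K" and good: "good K g ys"
  shows "integrable \<sigma> (\<lambda>t. word_sum \<sigma> lam S (\<lambda>ts. f (t # ts)) g (t # ys))"
proof -
  obtain M where M: "dominated K M f" using kernels_dominated[OF K f] .
  show ?thesis
    unfolding word_sum_def
    by (intro Bochner_Integration.integrable_sum
        integrable_word_op_slice[OF compact_sets_borel[OF K] kernels_measurable[OF f] M g good])
qed

lemma sum_Annihilate_words:
  assumes K: "compact K" and g: "g \<in> borel_measurable list_borel"
    and f: "f \<in> kernels n K" and good: "good K g ys"
  shows "(\<Sum>u\<in>S. word_op \<sigma> lam (Annihilate # u) f g ys) =
    (\<integral>t. word_sum \<sigma> lam S (\<lambda>ts. f (t # ts)) g (t # ys) \<partial>\<sigma>)"
proof -
  obtain M where M: "dominated K M f" using kernels_dominated[OF K f] .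
  show ?thesis
    unfolding word_sum_def word_op_Annihilate
    by (rule Bochner_Integration.integral_sum[symmetric])
      (rule integrable_word_op_slice[OF compact_sets_borel[OF K] kernels_measurable[OF f] M g good])
qed

text \<open>
  In formal notation,
  \<open>\<omega>(s):\<omega>(t\<^sub>1)\<dots>\<omega>(t\<^sub>m\<^sub>+\<^sub>1): = :\<omega>(s)\<omega>(t\<^sub>1)\<dots>\<omega>(t\<^sub>m\<^sub>+\<^sub>1): + lam(s)\<delta>(s,t\<^sub>1):\<omega>(s)\<omega>(t\<^sub>2)\<dots>\<omega>(t\<^sub>m\<^sub>+\<^sub>1): + \<delta>(s,t\<^sub>1):\<omega>(t\<^sub>2)\<dots>\<omega>(t\<^sub>m\<^sub>+\<^sub>1):\<close>.
  The Wick words of length \<open>m + 2\<close> are \<open>Cv\<close>, \<open>A\<^sup>m\<^sup>+\<^sup>2\<close> and \<open>NA\<^sup>m\<^sup>+\<^sup>1\<close>.  Of the remaining words on the left,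
  \<open>ACv\<close> gives the last term, while \<open>NCv\<close>, \<open>ANA\<^sup>m\<close> and \<open>NNA\<^sup>m\<close> merge into the words \<open>Cv\<close>, \<open>A\<^sup>m\<^sup>+\<^sup>1\<close> and
  \<open>NA\<^sup>m\<close> of the middle term.
\<close>

lemma contraction_first:
  assumes K: "compact K" and g: "g \<in> borel_measurable list_borel"
    and f: "f \<in> kernels (Suc (Suc m)) K" and good: "good K g ys"
  shows "word_sum \<sigma> lam (mixed_words (Suc 0) (Suc m)) f g ys =
    word_sum \<sigma> lam (wick_words (Suc (Suc m))) f g ys +
    word_sum \<sigma> lam (wick_words (Suc m)) (diagonal lam 0 f) g ys +
    word_sum \<sigma> lam (wick_words m) (integrate_out 0 (diagonal (\<lambda>_. 1) 0 f)) g ys"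
  unfolding word_sum_def sum_mixed_words_Suc mixed_words.simps(1)
  unfolding sum_wick_words_Suc[of _ "Suc m"]
  unfolding sum_wick_words_Suc[of "\<lambda>w. word_op \<sigma> lam (Annihilate # w) f g ys"]
    sum_wick_words_Suc[of "\<lambda>w. word_op \<sigma> lam (Neutral # w) f g ys"]
    sum_wick_words_Suc[of "\<lambda>w. word_op \<sigma> lam w (diagonal lam 0 f) g ys"]
    word_op_Annihilate_Neutral word_op_Neutral_Neutral word_op_Neutral_Create
    word_op_Annihilate_Create[OF K g f good] replicate_Suc
  by simp

text \<open>
  The preceding identity multiplied from the left by \<open>\<omega>(t\<^sub>1)\<dots>\<omega>(t\<^sub>k)\<close>.  Each factor acts on the
  identity for kernels with frozen first variable, and the contractions at position \<open>k + 1\<close>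
  become contractions at position \<open>k\<close> of the frozen kernel.
\<close>

lemma contraction:
  assumes K: "compact K" and g: "g \<in> borel_measurable list_borel"
  shows "f \<in> kernels (Suc (Suc (k + m))) K \<Longrightarrow> good K g ys \<Longrightarrow>
    word_sum \<sigma> lam (mixed_words (Suc k) (Suc m)) f g ys =
    word_sum \<sigma> lam (mixed_words k (Suc (Suc m))) f g ys +
    word_sum \<sigma> lam (mixed_words k (Suc m)) (diagonal lam k f) g ys +
    word_sum \<sigma> lam (mixed_words k m) (integrate_out k (diagonal (\<lambda>_. 1) k f)) g ys"
proof (induction k arbitrary: f ys)
  case 0
  then show ?case
    using contraction_first[OF K g, of f m ys] by (simp only: add_0 mixed_words.simps(1))
next
  case (Suc k)
  let ?S1 = "mixed_words (Suc k) (Suc m)" and ?S2 = "mixed_words k (Suc (Suc m))"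
    and ?S3 = "mixed_words k (Suc m)" and ?S4 = "mixed_words k m"
  let ?D = "diagonal lam (Suc k) f"
  let ?D1 = "diagonal (\<lambda>_. 1) (Suc k) f"
  let ?I = "integrate_out (Suc k) ?D1"
  note f = Suc.prems(1) and good = Suc.prems(2)
  have D: "?D \<in> kernels (Suc (Suc (k + m))) K" and D1: "?D1 \<in> kernels (Suc (Suc (k + m))) K"
    using f continuous_lam by (auto intro!: kernels_diagonal)
  have I: "?I \<in> kernels (Suc (k + m)) K"
    using kernels_integrate_out[OF K D1] by simp
  have IH: "word_sum \<sigma> lam ?S1 (\<lambda>ts. f (t # ts)) g zs =
      word_sum \<sigma> lam ?S2 (\<lambda>ts. f (t # ts)) g zs + word_sum \<sigma> lam ?S3 (\<lambda>ts. ?D (t # ts)) g zs +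
      word_sum \<sigma> lam ?S4 (\<lambda>ts. ?I (t # ts)) g zs" if "good K g zs" for t zs
    using Suc.IH[of "\<lambda>ts. f (t # ts)", OF kernels_slice that] f by simp
  have out: "word_sum \<sigma> lam S (\<lambda>ts. f (t # ts)) g zs = 0"
      "word_sum \<sigma> lam S (\<lambda>ts. ?D (t # ts)) g zs = 0"
      "word_sum \<sigma> lam S (\<lambda>ts. ?I (t # ts)) g zs = 0" if "t \<notin> K" for S t zs
    using kernels_slice_outside[OF f that] kernels_slice_outside[OF D that] kernels_slice_outside[OF I that]
    by (simp_all del: diagonal_Suc integrate_out_Suc)
  note int = integrable_word_sum[OF K g _ good]
  have C: "(\<Sum>u\<in>?S1. word_op \<sigma> lam (Create # u) f g ys) =
      (\<Sum>u\<in>?S2. word_op \<sigma> lam (Create # u) f g ys) +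
      (\<Sum>u\<in>?S3. word_op \<sigma> lam (Create # u) ?D g ys) + (\<Sum>u\<in>?S4. word_op \<sigma> lam (Create # u) ?I g ys)"
  proof (cases ys)
    case (Cons y zs)
    then show ?thesis
      unfolding sum_Create_words using IH[of zs y] out[of y] good_Cons[of K g y zs] good
      by (cases "y \<in> K") (simp_all del: diagonal_Suc integrate_out_Suc)
  qed (simp add: sum_Create_words)
  have N: "(\<Sum>u\<in>?S1. word_op \<sigma> lam (Neutral # u) f g ys) =
      (\<Sum>u\<in>?S2. word_op \<sigma> lam (Neutral # u) f g ys) +
      (\<Sum>u\<in>?S3. word_op \<sigma> lam (Neutral # u) ?D g ys) + (\<Sum>u\<in>?S4. word_op \<sigma> lam (Neutral # u) ?I g ys)"
  proof (cases ys)
    case (Cons y zs)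
    then show ?thesis
      unfolding sum_Neutral_words using IH[of ys y] good
      by (simp add: distrib_left del: diagonal_Suc integrate_out_Suc)
  qed (simp add: sum_Neutral_words)
  have "(\<Sum>u\<in>?S1. word_op \<sigma> lam (Annihilate # u) f g ys) =
      (\<integral>t. word_sum \<sigma> lam ?S2 (\<lambda>ts. f (t # ts)) g (t # ys) + word_sum \<sigma> lam ?S3 (\<lambda>ts. ?D (t # ts)) g (t # ys) +
        word_sum \<sigma> lam ?S4 (\<lambda>ts. ?I (t # ts)) g (t # ys) \<partial>\<sigma>)"
    unfolding sum_Annihilate_words[OF K g f good]
  proof (rule integral_cong_AE)
    show "AE t in \<sigma>. word_sum \<sigma> lam ?S1 (\<lambda>ts. f (t # ts)) g (t # ys) =
        word_sum \<sigma> lam ?S2 (\<lambda>ts. f (t # ts)) g (t # ys) + word_sum \<sigma> lam ?S3 (\<lambda>ts. ?D (t # ts)) g (t # ys) +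
        word_sum \<sigma> lam ?S4 (\<lambda>ts. ?I (t # ts)) g (t # ys)"
      by (rule AE_slice_eqI[OF K g good]) (simp_all add: IH out del: diagonal_Suc integrate_out_Suc mixed_words.simps)
  qed (intro borel_measurable_add borel_measurable_integrable int[OF f] int[OF D] int[OF I])+
  also have "\<dots> = (\<integral>t. word_sum \<sigma> lam ?S2 (\<lambda>ts. f (t # ts)) g (t # ys) \<partial>\<sigma>) +
      (\<integral>t. word_sum \<sigma> lam ?S3 (\<lambda>ts. ?D (t # ts)) g (t # ys) \<partial>\<sigma>) +
      (\<integral>t. word_sum \<sigma> lam ?S4 (\<lambda>ts. ?I (t # ts)) g (t # ys) \<partial>\<sigma>)"
    using int[OF f] int[OF D] int[OF I]
    by (simp add: Bochner_Integration.integral_add Bochner_Integration.integrable_add del: diagonal_Suc integrate_out_Suc)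
  finally have A: "(\<Sum>u\<in>?S1. word_op \<sigma> lam (Annihilate # u) f g ys) =
      (\<Sum>u\<in>?S2. word_op \<sigma> lam (Annihilate # u) f g ys) +
      (\<Sum>u\<in>?S3. word_op \<sigma> lam (Annihilate # u) ?D g ys) + (\<Sum>u\<in>?S4. word_op \<sigma> lam (Annihilate # u) ?I g ys)"
    unfolding sum_Annihilate_words[OF K g f good] sum_Annihilate_words[OF K g D good]
      sum_Annihilate_words[OF K g I good] .
  show ?case
    unfolding word_sum_def
    unfolding sum_mixed_words_Suc[of _ "Suc k"] sum_mixed_words_Suc[of _ k "Suc (Suc m)"]
      sum_mixed_words_Suc[of "\<lambda>w. word_op \<sigma> lam w ?D g ys" k] sum_mixed_words_Suc[of "\<lambda>w. word_op \<sigma> lam w ?I g ys" k]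
      C N A
    by simp
qed

lemma fock_space_scale: "g \<in> fock_space \<sigma> \<Longrightarrow> (\<lambda>ys. c * g ys) \<in> fock_space \<sigma>"
proof -
  assume g: "g \<in> fock_space \<sigma>"
  then have [measurable]: "g \<in> borel_measurable list_borel" by (simp add: fock_space_iff)
  have "fock_nn_integral (\<lambda>ys. ennreal ((c * g ys)\<^sup>2)) =
      fock_nn_integral (\<lambda>ys. ennreal (c\<^sup>2) * ennreal ((g ys)\<^sup>2))"
    by (simp add: power_mult_distrib ennreal_mult)
  also have "\<dots> = ennreal (c\<^sup>2) * fock_nn_integral (\<lambda>ys. ennreal ((g ys)\<^sup>2))"
    by (rule fock_nn_integral_cmult) simp
  finally show ?thesis using g by (simp add: fock_space_iff ennreal_mult_less_top)
qed

lemma fock_space_add: "g \<in> fock_space \<sigma> \<Longrightarrow> h \<in> fock_space \<sigma> \<Longrightarrow> (\<lambda>ys. g ys + h ys) \<in> fock_space \<sigma>"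
proof -
  assume gh: "g \<in> fock_space \<sigma>" "h \<in> fock_space \<sigma>"
  then have [measurable]: "g \<in> borel_measurable list_borel" "h \<in> borel_measurable list_borel"
    by (simp_all add: fock_space_iff)
  have "fock_nn_integral (\<lambda>ys. ennreal ((g ys + h ys)\<^sup>2)) \<le>
      fock_nn_integral (\<lambda>ys. 2 * ennreal ((g ys)\<^sup>2) + 2 * ennreal ((h ys)\<^sup>2))"
  proof (rule fock_nn_integral_mono)
    fix ys
    have "(g ys + h ys)\<^sup>2 \<le> 2 * (g ys)\<^sup>2 + 2 * (h ys)\<^sup>2"
      using sum_squares_bound[of "g ys" "h ys"] by (simp add: power2_sum)
    then have "ennreal ((g ys + h ys)\<^sup>2) \<le> ennreal (2 * (g ys)\<^sup>2 + 2 * (h ys)\<^sup>2)"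
      by (rule ennreal_leI)
    then show "ennreal ((g ys + h ys)\<^sup>2) \<le> 2 * ennreal ((g ys)\<^sup>2) + 2 * ennreal ((h ys)\<^sup>2)"
      by (simp add: ennreal_mult)
  qed
  also have "\<dots> = 2 * fock_nn_integral (\<lambda>ys. ennreal ((g ys)\<^sup>2)) + 2 * fock_nn_integral (\<lambda>ys. ennreal ((h ys)\<^sup>2))"
    by (simp add: fock_nn_integral_add fock_nn_integral_cmult)
  also have "\<dots> < \<infinity>" using gh by (simp add: fock_space_iff ennreal_mult_less_top)
  finally show ?thesis using gh by (simp add: fock_space_iff)
qed

lemma fock_space_diff: "g \<in> fock_space \<sigma> \<Longrightarrow> h \<in> fock_space \<sigma> \<Longrightarrow> (\<lambda>ys. g ys - h ys) \<in> fock_space \<sigma>"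
  using fock_space_add[OF _ fock_space_scale[of h "-1"]] by simp

lemma fock_space_zero [simp]: "(\<lambda>_. 0) \<in> fock_space \<sigma>"
  by (simp add: fock_space_iff fock_nn_integral_def)

lemma fock_space_sum: "(\<And>i. i \<in> I \<Longrightarrow> g i \<in> fock_space \<sigma>) \<Longrightarrow> (\<lambda>ys. \<Sum>i\<in>I. g i ys) \<in> fock_space \<sigma>"
  by (induction I rule: infinite_finite_induct) (auto intro: fock_space_add)

lemma word_sum_fock_space:
  assumes K: "compact K" and f: "f \<in> kernels n K" and g: "g \<in> fock_space \<sigma>"
  shows "word_sum \<sigma> lam S f g \<in> fock_space \<sigma>"
proof -
  obtain M where M: "dominated K M f" using kernels_dominated[OF K f] .
  show ?thesis
    unfolding word_sum_def
    by (intro fock_space_sum word_op_fock_space[OF K kernels_measurable[OF f] M g])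
qed

lemma word_sum_add:
  assumes K: "compact K" and g: "g \<in> borel_measurable list_borel"
    and f: "f \<in> kernels n K" "f' \<in> kernels n' K" and good: "good K g ys"
  shows "word_sum \<sigma> lam S (\<lambda>ts. f ts + f' ts) g ys = word_sum \<sigma> lam S f g ys + word_sum \<sigma> lam S f' g ys"
proof -
  obtain M where M: "dominated K M f" using kernels_dominated[OF K f(1)] .
  obtain M' where M': "dominated K M' f'" using kernels_dominated[OF K f(2)] .
  show ?thesis
    unfolding word_sum_def
    by (simp add: word_op_add[OF K g kernels_measurable[OF f(1)] M kernels_measurable[OF f(2)] M' good] sum.distrib)
qed

section \<open>Monomials and Wick products span the same operators\<close>

lemma fock_eq_refl: "g \<in> fock_space \<sigma> \<Longrightarrow> fock_eq \<sigma> g g"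
  by (simp add: fock_eq_def)

lemma fock_eq_trans: "fock_eq \<sigma> f g \<Longrightarrow> fock_eq \<sigma> g h \<Longrightarrow> fock_eq \<sigma> f h"
  unfolding fock_eq_def
proof (intro conjI allI; elim conjE)
  fix n
  assume "\<forall>n. AE x in power_measure \<sigma> n. coords n f x = coords n g x"
    "\<forall>n. AE x in power_measure \<sigma> n. coords n g x = coords n h x"
  then have "AE x in power_measure \<sigma> n. coords n f x = coords n g x"
    "AE x in power_measure \<sigma> n. coords n g x = coords n h x"
    by blast+
  then show "AE x in power_measure \<sigma> n. coords n f x = coords n h x"
    by eventually_elim simp
qed

lemma fock_eq_add:
  assumes "fock_eq \<sigma> g g'" "fock_eq \<sigma> h h'"
  shows "fock_eq \<sigma> (\<lambda>ys. g ys + h ys) (\<lambda>ys. g' ys + h' ys)"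
  unfolding fock_eq_def
proof (intro conjI allI fock_space_add)
  fix n
  have "AE x in power_measure \<sigma> n. coords n g x = coords n g' x"
    "AE x in power_measure \<sigma> n. coords n h x = coords n h' x"
    using assms by (auto simp: fock_eq_def)
  then show "AE x in power_measure \<sigma> n. coords n (\<lambda>ys. g ys + h ys) x = coords n (\<lambda>ys. g' ys + h' ys) x"
    by eventually_elim (simp add: coords_def)
qed (use assms in \<open>auto simp: fock_eq_def\<close>)

lemma fock_eq_scale:
  assumes "fock_eq \<sigma> g g'"
  shows "fock_eq \<sigma> (\<lambda>ys. c * g ys) (\<lambda>ys. c * g' ys)"
  unfolding fock_eq_def
proof (intro conjI allI fock_space_scale)
  fix n
  have "AE x in power_measure \<sigma> n. coords n g x = coords n g' x"
    using assms by (auto simp: fock_eq_def)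
  then show "AE x in power_measure \<sigma> n. coords n (\<lambda>ys. c * g ys) x = coords n (\<lambda>ys. c * g' ys) x"
    by eventually_elim (simp add: coords_def)
qed (use assms in \<open>auto simp: fock_eq_def\<close>)

lemma op_eq_trans: "op_eq \<sigma> P Q \<Longrightarrow> op_eq \<sigma> Q R \<Longrightarrow> op_eq \<sigma> P R"
  unfolding op_eq_def using fock_eq_trans by blast

lemma op_eq_refl: "(\<And>g. g \<in> fock_space \<sigma> \<Longrightarrow> P g \<in> fock_space \<sigma>) \<Longrightarrow> op_eq \<sigma> P P"
  unfolding op_eq_def using fock_eq_refl by blast

lemma op_eq_add:
  "op_eq \<sigma> P P' \<Longrightarrow> op_eq \<sigma> Q Q' \<Longrightarrow> op_eq \<sigma> (\<lambda>g ys. P g ys + Q g ys) (\<lambda>g ys. P' g ys + Q' g ys)"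
  unfolding op_eq_def using fock_eq_add by blast

lemma op_eq_scale:
  "op_eq \<sigma> P P' \<Longrightarrow> op_eq \<sigma> (\<lambda>g ys. c * P g ys) (\<lambda>g ys. c * P' g ys)"
  unfolding op_eq_def using fock_eq_scale by blast

lemma op_eq_goodI:
  assumes K: "compact K"
    and P: "\<And>g. g \<in> fock_space \<sigma> \<Longrightarrow> P g \<in> fock_space \<sigma>"
    and Q: "\<And>g. g \<in> fock_space \<sigma> \<Longrightarrow> Q g \<in> fock_space \<sigma>"
    and eq: "\<And>g ys. g \<in> borel_measurable list_borel \<Longrightarrow> good K g ys \<Longrightarrow> P g ys = Q g ys"
  shows "op_eq \<sigma> P Q"
  unfolding op_eq_def fock_eq_def
proof (intro ballI conjI allI)
  fix g n assume g: "g \<in> fock_space \<sigma>"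
  then have gm: "g \<in> borel_measurable list_borel" by (simp add: fock_space_iff)
  show "AE x in power_measure \<sigma> n. coords n (P g) x = coords n (Q g) x"
    using AE_good[OF K g, of n] by eventually_elim (simp add: coords_list_of eq[OF gm])
qed (use P Q in auto)

lemma word_sum_test_functions_fock_space:
  assumes "f \<in> test_functions n" "\<And>w. w \<in> S \<Longrightarrow> length w = n" "g \<in> fock_space \<sigma>"
  shows "word_sum \<sigma> lam S f g \<in> fock_space \<sigma>"
proof -
  obtain K where K: "compact K" "(\<lambda>ts. if length ts = n then f ts else 0) \<in> kernels n K"
    using test_functions_imp_kernels[OF assms(1)] .
  have "word_sum \<sigma> lam S f g = word_sum \<sigma> lam S (\<lambda>ts. if length ts = n then f ts else 0) g"
    unfolding word_sum_def by (intro ext sum.cong refl word_op_cong) (use assms(2) in auto)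
  with word_sum_fock_space[OF K assms(3)] show ?thesis by simp
qed

text \<open>
  The closure properties shared by the spaces \<open>CP_le\<close> of polynomials and by the spans of Wick
  products.  Stating the induction for an arbitrary filtration makes it serve in both directions:
  Wick products are polynomials, and polynomials are sums of Wick products.
\<close>

definition filtration :: "(nat \<Rightarrow> 'a operator set) \<Rightarrow> bool" where
  "filtration X \<longleftrightarrow>
     (\<forall>n P Q. op_eq \<sigma> P Q \<longrightarrow> Q \<in> X n \<longrightarrow> P \<in> X n) \<and>
     (\<forall>n P Q. P \<in> X n \<longrightarrow> Q \<in> X n \<longrightarrow> (\<lambda>g ys. P g ys + Q g ys) \<in> X n) \<and>
     (\<forall>n P c. P \<in> X n \<longrightarrow> (\<lambda>g ys. c * P g ys) \<in> X n) \<and>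
     (\<forall>n. (\<lambda>g ys. 0) \<in> X n) \<and> (\<forall>n. X n \<subseteq> X (Suc n))"

lemma filtrationD:
  assumes "filtration X"
  shows "op_eq \<sigma> P Q \<Longrightarrow> Q \<in> X n \<Longrightarrow> P \<in> X n"
    and "P \<in> X n \<Longrightarrow> Q \<in> X n \<Longrightarrow> (\<lambda>g ys. P g ys + Q g ys) \<in> X n"
    and "P \<in> X n \<Longrightarrow> (\<lambda>g ys. c * P g ys) \<in> X n"
    and "(\<lambda>g ys. 0) \<in> X n"
    and "m \<le> n \<Longrightarrow> X m \<subseteq> X n"
proof -
  note X = assms[unfolded filtration_def]
  show "op_eq \<sigma> P Q \<Longrightarrow> Q \<in> X n \<Longrightarrow> P \<in> X n"
    by (rule X[THEN conjunct1, rule_format])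
  show "P \<in> X n \<Longrightarrow> Q \<in> X n \<Longrightarrow> (\<lambda>g ys. P g ys + Q g ys) \<in> X n"
    by (rule X[THEN conjunct2, THEN conjunct1, rule_format])
  show "P \<in> X n \<Longrightarrow> (\<lambda>g ys. c * P g ys) \<in> X n"
    by (rule X[THEN conjunct2, THEN conjunct2, THEN conjunct1, rule_format])
  show "(\<lambda>g ys. 0) \<in> X n"
    by (rule X[THEN conjunct2, THEN conjunct2, THEN conjunct2, THEN conjunct1, rule_format])
  show "m \<le> n \<Longrightarrow> X m \<subseteq> X n"
    by (rule lift_Suc_mono_le[of X])
      (rule X[THEN conjunct2, THEN conjunct2, THEN conjunct2, THEN conjunct2, THEN spec])
qed

lemma filtration_diff:
  assumes "filtration X" "P \<in> X n" "Q \<in> X n"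
  shows "op_diff P Q \<in> X n"
  using filtrationD(2)[OF assms(1,2) filtrationD(3)[OF assms(1,3), of "-1"]]
  by (simp add: op_diff_def)

text \<open>
  By the contraction identity, moving one factor out of the Wick product changes the operator by
  terms of lower order only.
\<close>

lemma mixed_step_in_lower:
  assumes X: "filtration X" and K: "compact K"
    and lower: "\<And>m k f. m < n \<Longrightarrow> k \<le> m \<Longrightarrow> f \<in> kernels m K \<Longrightarrow>
      word_sum \<sigma> lam (mixed_words k (m - k)) f \<in> X m"
    and k: "Suc k \<le> n" and f: "f \<in> kernels n K"
  shows "op_diff (word_sum \<sigma> lam (mixed_words (Suc k) (n - Suc k)) f)
      (word_sum \<sigma> lam (mixed_words k (n - k)) f) \<in> X (n - 1)"
proof (cases "n - Suc k")
  case 0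
  \<comment> \<open>Only one factor is left inside the Wick product, which is therefore the plain factor.\<close>
  then have "n - k = Suc 0" using k by simp
  with 0 show ?thesis
    using filtrationD(4)[OF X] by (simp add: mixed_words_Suc_0 op_diff_def del: mixed_words.simps)
next
  case (Suc m)
  then have n: "n = Suc (Suc (k + m))" by simp
  let ?D = "diagonal lam k f"
  let ?I = "integrate_out k (diagonal (\<lambda>_. 1) k f)"
  have D: "?D \<in> kernels (Suc (k + m)) K" "diagonal (\<lambda>_. 1) k f \<in> kernels (Suc (k + m)) K"
    using f continuous_lam by (auto intro!: kernels_diagonal simp: n)
  then have I: "?I \<in> kernels (k + m) K"
    by (intro kernels_integrate_out K) auto
  have "op_eq \<sigma>
      (op_diff (word_sum \<sigma> lam (mixed_words (Suc k) (Suc m)) f) (word_sum \<sigma> lam (mixed_words k (Suc (Suc m))) f))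
      (\<lambda>g ys. word_sum \<sigma> lam (mixed_words k (Suc m)) ?D g ys + word_sum \<sigma> lam (mixed_words k m) ?I g ys)"
  proof (rule op_eq_goodI[OF K])
    fix g assume g: "g \<in> fock_space \<sigma>"
    show "op_diff (word_sum \<sigma> lam (mixed_words (Suc k) (Suc m)) f)
        (word_sum \<sigma> lam (mixed_words k (Suc (Suc m))) f) g \<in> fock_space \<sigma>"
      unfolding op_diff_def by (intro fock_space_diff word_sum_fock_space[OF K f g])
    show "(\<lambda>ys. word_sum \<sigma> lam (mixed_words k (Suc m)) ?D g ys + word_sum \<sigma> lam (mixed_words k m) ?I g ys)
        \<in> fock_space \<sigma>"
      by (intro fock_space_add word_sum_fock_space[OF K D(1) g] word_sum_fock_space[OF K I g])
  next
    fix g ys assume "g \<in> borel_measurable list_borel" "good K g ys"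
    then show "op_diff (word_sum \<sigma> lam (mixed_words (Suc k) (Suc m)) f)
          (word_sum \<sigma> lam (mixed_words k (Suc (Suc m))) f) g ys =
        word_sum \<sigma> lam (mixed_words k (Suc m)) ?D g ys + word_sum \<sigma> lam (mixed_words k m) ?I g ys"
      using contraction[OF K, of g f k m ys] f by (simp add: op_diff_def n del: mixed_words.simps)
  qed
  moreover have "(\<lambda>g ys. word_sum \<sigma> lam (mixed_words k (Suc m)) ?D g ys + word_sum \<sigma> lam (mixed_words k m) ?I g ys)
      \<in> X (n - 1)"
  proof (rule filtrationD(2)[OF X])
    show "word_sum \<sigma> lam (mixed_words k (Suc m)) ?D \<in> X (n - 1)"
      using lower[of "Suc (k + m)" k ?D] D by (simp add: n Suc_diff_le)
    show "word_sum \<sigma> lam (mixed_words k m) ?I \<in> X (n - 1)"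
      using lower[of "k + m" k ?I] I filtrationD(5)[OF X, of "k + m" "n - 1"] by (auto simp: n)
  qed
  moreover have "n - k = Suc (Suc m)" using n by simp
  ultimately show ?thesis using filtrationD(1)[OF X] Suc by simp
qed

lemma mixed_minus_wick_in_lower:
  assumes X: "filtration X" and K: "compact K"
    and lower: "\<And>m k f. m < n \<Longrightarrow> k \<le> m \<Longrightarrow> f \<in> kernels m K \<Longrightarrow>
      word_sum \<sigma> lam (mixed_words k (m - k)) f \<in> X m"
    and f: "f \<in> kernels n K"
  shows "j \<le> n \<Longrightarrow>
    op_diff (word_sum \<sigma> lam (mixed_words j (n - j)) f) (word_sum \<sigma> lam (mixed_words 0 n) f) \<in> X (n - 1)"
proof (induction j)
  case 0
  then show ?case using filtrationD(4)[OF X] by (simp add: op_diff_def)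
next
  case (Suc j)
  have "op_diff (word_sum \<sigma> lam (mixed_words (Suc j) (n - Suc j)) f) (word_sum \<sigma> lam (mixed_words j (n - j)) f)
      \<in> X (n - 1)"
    using mixed_step_in_lower[OF X K lower Suc.prems f] .
  from filtrationD(2)[OF X this Suc.IH] Suc.prems show ?case by (simp add: op_diff_def)
qed

text \<open>
  All mixed products of the same kernel agree up to lower order, so as soon as one of them belongs
  to the filtration at each order, all do.
\<close>

lemma mixed_in_filtration:
  assumes X: "filtration X" and K: "compact K"
    and base: "\<And>n. \<exists>b\<le>n. \<forall>f\<in>kernels n K. word_sum \<sigma> lam (mixed_words b (n - b)) f \<in> X n"
  shows "k \<le> n \<Longrightarrow> f \<in> kernels n K \<Longrightarrow> word_sum \<sigma> lam (mixed_words k (n - k)) f \<in> X n"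
proof (induction n arbitrary: k f rule: less_induct)
  case (less n)
  obtain b where b: "b \<le> n" "word_sum \<sigma> lam (mixed_words b (n - b)) f \<in> X n"
    using base[of n] less.prems by blast
  \<comment> \<open>Both the given product and the known one are compared with the Wick product.\<close>
  let ?d = "\<lambda>j. op_diff (word_sum \<sigma> lam (mixed_words j (n - j)) f) (word_sum \<sigma> lam (mixed_words 0 n) f)"
  have d: "?d j \<in> X n" if "j \<le> n" for j
    by (rule subsetD[OF filtrationD(5)[OF X diff_le_self]])
      (rule mixed_minus_wick_in_lower[OF X K less.IH less.prems(2) that])
  have "(\<lambda>g ys. word_sum \<sigma> lam (mixed_words b (n - b)) f g ys + op_diff (?d k) (?d b) g ys) \<in> X n"
    by (intro filtrationD(2)[OF X] b filtration_diff[OF X] d less.prems)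
  then show ?case by (simp add: op_diff_def)
qed

lemma CP_le_op_eq: "op_eq \<sigma> P Q \<Longrightarrow> Q \<in> CP_le \<sigma> lam n \<Longrightarrow> P \<in> CP_le \<sigma> lam n"
  unfolding CP_le_def by (blast intro: op_eq_trans)

lemma filtration_CP_le: "filtration (CP_le \<sigma> lam)"
  unfolding filtration_def
proof (intro conjI allI impI)
  fix n P Q assume "op_eq \<sigma> P Q" "Q \<in> CP_le \<sigma> lam n"
  then show "P \<in> CP_le \<sigma> lam n" by (rule CP_le_op_eq)
next
  fix n P Q assume "P \<in> CP_le \<sigma> lam n" "Q \<in> CP_le \<sigma> lam n"
  then obtain xs zs where
    xs: "\<forall>(i, f)\<in>set xs. i \<le> n \<and> f \<in> test_functions i"
      "op_eq \<sigma> P (\<lambda>g ys. \<Sum>(i, f)\<leftarrow>xs. monomial \<sigma> lam i f g ys)"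
    and zs: "\<forall>(i, f)\<in>set zs. i \<le> n \<and> f \<in> test_functions i"
      "op_eq \<sigma> Q (\<lambda>g ys. \<Sum>(i, f)\<leftarrow>zs. monomial \<sigma> lam i f g ys)"
    unfolding CP_le_def by blast
  have "op_eq \<sigma> (\<lambda>g ys. P g ys + Q g ys) (\<lambda>g ys. \<Sum>(i, f)\<leftarrow>xs @ zs. monomial \<sigma> lam i f g ys)"
    using op_eq_add[OF xs(2) zs(2)] by simp
  with xs(1) zs(1) show "(\<lambda>g ys. P g ys + Q g ys) \<in> CP_le \<sigma> lam n"
    unfolding CP_le_def by (intro CollectI exI[of _ "xs @ zs"]) auto
next
  fix n P and c :: real assume "P \<in> CP_le \<sigma> lam n"
  then obtain xs where
    xs: "\<forall>(i, f)\<in>set xs. i \<le> n \<and> f \<in> test_functions i"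
      "op_eq \<sigma> P (\<lambda>g ys. \<Sum>(i, f)\<leftarrow>xs. monomial \<sigma> lam i f g ys)"
    unfolding CP_le_def by blast
  let ?xs = "map (\<lambda>(i, f). (i, \<lambda>ts. c * f ts)) xs"
  have "(\<lambda>ts. c * f ts) \<in> test_functions i" if fi: "f \<in> test_functions i" for i and f :: "'a list \<Rightarrow> real"
  proof -
    obtain K where K: "compact K" "(\<lambda>ts. if length ts = i then f ts else 0) \<in> kernels i K"
      using test_functions_imp_kernels[OF fi] .
    have "(\<lambda>ts. c * (if length ts = i then f ts else 0)) \<in> test_functions i"
      by (rule kernels_imp_test_functions[OF K(1) kernels_scale[OF K(2)]])
    moreover have "coords i (\<lambda>ts. c * (if length ts = i then f ts else 0)) = coords i (\<lambda>ts. c * f ts)"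
      by (simp add: coords_list_of)
    ultimately show ?thesis by (simp add: test_functions_def)
  qed
  then have "\<forall>(i, f)\<in>set ?xs. i \<le> n \<and> f \<in> test_functions i"
    using xs(1) by fastforce
  moreover have "(\<Sum>(i, f)\<leftarrow>?xs. monomial \<sigma> lam i f g ys) = c * (\<Sum>(i, f)\<leftarrow>xs. monomial \<sigma> lam i f g ys)" for g ys
    by (simp add: sum_list_const_mult[symmetric] o_def case_prod_unfold monomial_word_sum word_sum_scale)
  ultimately show "(\<lambda>g ys. c * P g ys) \<in> CP_le \<sigma> lam n"
    using op_eq_scale[OF xs(2), of c] unfolding CP_le_def by (intro CollectI exI[of _ ?xs]) simp
next
  fix n
  show "(\<lambda>g ys. 0) \<in> CP_le \<sigma> lam n"
    unfolding CP_le_def by (intro CollectI exI[of _ "[]"]) (simp add: op_eq_refl)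
next
  fix n
  show "CP_le \<sigma> lam n \<subseteq> CP_le \<sigma> lam (Suc n)"
    unfolding CP_le_def by fastforce
qed

lemma monomial_in_CP_le:
  assumes "f \<in> test_functions n"
  shows "monomial \<sigma> lam n f \<in> CP_le \<sigma> lam n"
proof -
  have "op_eq \<sigma> (monomial \<sigma> lam n f) (\<lambda>g ys. \<Sum>(i, f)\<leftarrow>[(n, f)]. monomial \<sigma> lam i f g ys)"
    using word_sum_test_functions_fock_space[OF assms, of "{w. length w = n}"]
    by (auto intro!: op_eq_refl simp: monomial_word_sum mixed_words_all)
  with assms show ?thesis
    unfolding CP_le_def by (intro CollectI exI[of _ "[(n, f)]"]) simp
qed

lemma mixed_in_CP_le:
  assumes K: "compact K" and "k \<le> n" "f \<in> kernels n K"
  shows "word_sum \<sigma> lam (mixed_words k (n - k)) f \<in> CP_le \<sigma> lam n"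
  using filtration_CP_le K _ assms(2,3)
proof (rule mixed_in_filtration)
  show "\<exists>b\<le>n. \<forall>f\<in>kernels n K. word_sum \<sigma> lam (mixed_words b (n - b)) f \<in> CP_le \<sigma> lam n" for n
    using monomial_in_CP_le kernels_imp_test_functions[OF K]
    by (intro exI[of _ n]) (simp add: monomial_word_sum)
qed

lemma free_wick_product_in_CP_le:
  assumes K: "compact K" and f: "f \<in> kernels n K"
  shows "free_wick_product \<sigma> lam n f \<in> CP_le \<sigma> lam n"
  using mixed_in_CP_le[OF K _ f, of 0] by (simp add: free_wick_product_word_sum)

lemma monomial_minus_free_wick_product_in_CP_le:
  assumes K: "compact K" and f: "f \<in> kernels n K"
  shows "op_diff (monomial \<sigma> lam n f) (free_wick_product \<sigma> lam n f) \<in> CP_le \<sigma> lam (n - 1)"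
  using mixed_minus_wick_in_lower[OF filtration_CP_le K mixed_in_CP_le[OF K] f, of n]
  by (simp add: free_wick_product_word_sum monomial_word_sum)

text \<open>
  There is one kernel for each order, so that an element of the span can be recovered from its
  value at the vacuum.
\<close>

definition wick_span :: "nat \<Rightarrow> 'a operator set" where
  "wick_span n = {P. \<exists>K h. compact K \<and> (\<forall>i. h i \<in> kernels i K) \<and>
     op_eq \<sigma> P (\<lambda>g ys. \<Sum>i\<le>n. free_wick_product \<sigma> lam i (h i) g ys)}"

lemma sum_wick_fock_space:
  assumes "compact K" "\<And>i. h i \<in> kernels i K" "g \<in> fock_space \<sigma>"
  shows "(\<lambda>ys. \<Sum>i\<le>(n::nat). free_wick_product \<sigma> lam i (h i) g ys) \<in> fock_space \<sigma>"
  unfolding free_wick_product_word_sum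
  by (intro fock_space_sum word_sum_fock_space[OF assms(1) assms(2) assms(3)])

lemma filtration_wick_span: "filtration wick_span"
  unfolding filtration_def
proof (intro conjI allI impI)
  fix n P Q assume "op_eq \<sigma> P Q" "Q \<in> wick_span n"
  then show "P \<in> wick_span n" unfolding wick_span_def using op_eq_trans by blast
next
  fix n P Q assume "P \<in> wick_span n" "Q \<in> wick_span n"
  then obtain K h K' h' where h: "compact K" "\<And>i. h i \<in> kernels i K"
      "op_eq \<sigma> P (\<lambda>g ys. \<Sum>i\<le>n. free_wick_product \<sigma> lam i (h i) g ys)"
    and h': "compact K'" "\<And>i. h' i \<in> kernels i K'"
      "op_eq \<sigma> Q (\<lambda>g ys. \<Sum>i\<le>n. free_wick_product \<sigma> lam i (h' i) g ys)"
    unfolding wick_span_def by blast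
  let ?K = "K \<union> K'"
  have K: "compact ?K" using h h' by (intro compact_Un)
  have hK: "h i \<in> kernels i ?K" "h' i \<in> kernels i ?K" for i
    using h(2)[of i] h'(2)[of i] kernels_mono[of K ?K i] kernels_mono[of K' ?K i] by auto
  let ?h = "\<lambda>i ts. h i ts + h' i ts"
  have hh: "?h i \<in> kernels i ?K" for i using kernels_add[OF hK] .
  have "op_eq \<sigma> (\<lambda>g ys. (\<Sum>i\<le>n. free_wick_product \<sigma> lam i (h i) g ys) + (\<Sum>i\<le>n. free_wick_product \<sigma> lam i (h' i) g ys))
      (\<lambda>g ys. \<Sum>i\<le>n. free_wick_product \<sigma> lam i (?h i) g ys)"
  proof (rule op_eq_goodI[OF K])
    fix g assume g: "g \<in> fock_space \<sigma>"
    show "(\<lambda>ys. (\<Sum>i\<le>n. free_wick_product \<sigma> lam i (h i) g ys) + (\<Sum>i\<le>n. free_wick_product \<sigma> lam i (h' i) g ys))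
        \<in> fock_space \<sigma>"
      by (intro fock_space_add sum_wick_fock_space[OF K hK(1) g] sum_wick_fock_space[OF K hK(2) g])
    show "(\<lambda>ys. \<Sum>i\<le>n. free_wick_product \<sigma> lam i (?h i) g ys) \<in> fock_space \<sigma>"
      by (rule sum_wick_fock_space[OF K hh g])
  next
    fix g ys assume g: "g \<in> borel_measurable list_borel" "good ?K g ys"
    show "(\<Sum>i\<le>n. free_wick_product \<sigma> lam i (h i) g ys) + (\<Sum>i\<le>n. free_wick_product \<sigma> lam i (h' i) g ys) =
        (\<Sum>i\<le>n. free_wick_product \<sigma> lam i (?h i) g ys)"
      by (simp add: free_wick_product_word_sum word_sum_add[OF K g(1) hK(1) hK(2) g(2)] sum.distrib)
  qed
  from op_eq_trans[OF op_eq_add[OF h(3) h'(3)] this] K hh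
  show "(\<lambda>g ys. P g ys + Q g ys) \<in> wick_span n"
    unfolding wick_span_def by (intro CollectI exI[of _ ?K] exI[of _ ?h]) simp
next
  fix n P and c :: real assume "P \<in> wick_span n"
  then obtain K h where h: "compact K" "\<And>i. h i \<in> kernels i K"
      "op_eq \<sigma> P (\<lambda>g ys. \<Sum>i\<le>n. free_wick_product \<sigma> lam i (h i) g ys)"
    unfolding wick_span_def by blast
  have "(\<lambda>g ys. c * (\<Sum>i\<le>n. free_wick_product \<sigma> lam i (h i) g ys)) =
      (\<lambda>g ys. \<Sum>i\<le>n. free_wick_product \<sigma> lam i (\<lambda>ts. c * h i ts) g ys)"
    by (simp add: free_wick_product_word_sum word_sum_scale sum_distrib_left)
  with op_eq_scale[OF h(3), of c] h(1) kernels_scale[OF h(2)]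
  show "(\<lambda>g ys. c * P g ys) \<in> wick_span n"
    unfolding wick_span_def by (intro CollectI exI[of _ K] exI[of _ "\<lambda>i ts. c * h i ts"]) simp
next
  fix n
  show "(\<lambda>g ys. 0) \<in> wick_span n"
    unfolding wick_span_def
    by (intro CollectI exI[of _ "{}"] exI[of _ "\<lambda>_ _. 0"])
      (simp add: op_eq_refl free_wick_product_word_sum)
next
  fix n
  show "wick_span n \<subseteq> wick_span (Suc n)"
  proof
    fix P assume "P \<in> wick_span n"
    then obtain K h where h: "compact K" "\<And>i. h i \<in> kernels i K"
        "op_eq \<sigma> P (\<lambda>g ys. \<Sum>i\<le>n. free_wick_product \<sigma> lam i (h i) g ys)"
      unfolding wick_span_def by blast
    let ?h = "h(Suc n := \<lambda>_. 0)"
    have "(\<Sum>i\<le>Suc n. free_wick_product \<sigma> lam i (?h i) g ys) =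
        (\<Sum>i\<le>n. free_wick_product \<sigma> lam i (h i) g ys)" for g ys
      by (simp add: free_wick_product_word_sum del: mixed_words.simps)
    with h show "P \<in> wick_span (Suc n)"
      unfolding wick_span_def by (intro CollectI exI[of _ K] exI[of _ ?h]) simp
  qed
qed

lemma free_wick_product_in_wick_span:
  assumes K: "compact K" and f: "f \<in> kernels n K"
  shows "free_wick_product \<sigma> lam n f \<in> wick_span n"
proof -
  let ?h = "(\<lambda>_ _. 0)(n := f)"
  have h: "?h i \<in> kernels i K" for i using f by simp
  have "(\<Sum>i\<le>n. free_wick_product \<sigma> lam i (?h i) g ys) = free_wick_product \<sigma> lam n f g ys" for g ys
  proof -
    have "(\<Sum>i\<le>n. free_wick_product \<sigma> lam i (?h i) g ys) =
        (\<Sum>i\<in>{n}. free_wick_product \<sigma> lam i (?h i) g ys)"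
      by (rule sum.mono_neutral_right) (auto simp: free_wick_product_word_sum)
    then show ?thesis by simp
  qed
  moreover have "op_eq \<sigma> (free_wick_product \<sigma> lam n f) (free_wick_product \<sigma> lam n f)"
    unfolding free_wick_product_word_sum by (intro op_eq_refl word_sum_fock_space[OF K f])
  ultimately show ?thesis
    unfolding wick_span_def using K h by (intro CollectI exI[of _ K] exI[of _ ?h]) simp
qed

lemma monomial_in_wick_span:
  assumes "f \<in> test_functions n"
  shows "monomial \<sigma> lam n f \<in> wick_span n"
proof -
  obtain K where K: "compact K" and f: "(\<lambda>ts. if length ts = n then f ts else 0) \<in> kernels n K"
    using test_functions_imp_kernels[OF assms] .
  have "word_sum \<sigma> lam (mixed_words n (n - n)) (\<lambda>ts. if length ts = n then f ts else 0) \<in> wick_span n"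
    using filtration_wick_span K _ order_refl f
  proof (rule mixed_in_filtration)
    show "\<exists>b\<le>n. \<forall>f\<in>kernels n K. word_sum \<sigma> lam (mixed_words b (n - b)) f \<in> wick_span n" for n
      using free_wick_product_in_wick_span[OF K]
      by (intro exI[of _ 0]) (simp add: free_wick_product_word_sum)
  qed
  moreover have "word_sum \<sigma> lam (mixed_words n 0) f =
      word_sum \<sigma> lam (mixed_words n 0) (\<lambda>ts. if length ts = n then f ts else 0)"
    unfolding word_sum_def by (intro ext sum.cong refl word_op_cong) (auto dest: length_mixed_words)
  ultimately show ?thesis by (simp add: monomial_word_sum)
qed

lemma CP_le_subset_wick_span: "CP_le \<sigma> lam n \<subseteq> wick_span n"
proof
  fix P assume "P \<in> CP_le \<sigma> lam n"
  then obtain xs where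
    xs: "\<forall>(i, f)\<in>set xs. i \<le> n \<and> f \<in> test_functions i"
      "op_eq \<sigma> P (\<lambda>g ys. \<Sum>(i, f)\<leftarrow>xs. monomial \<sigma> lam i f g ys)"
    unfolding CP_le_def by blast
  note X = filtration_wick_span
  have "(\<lambda>g ys. \<Sum>(i, f)\<leftarrow>xs. monomial \<sigma> lam i f g ys) \<in> wick_span n"
    using xs(1)
  proof (induction xs)
    case Nil
    then show ?case using filtrationD(4)[OF X] by simp
  next
    case (Cons a xs)
    obtain i f where a: "a = (i, f)" by fastforce
    have "monomial \<sigma> lam i f \<in> wick_span n"
      using monomial_in_wick_span filtrationD(5)[OF X, of i n] Cons.prems a by auto
    from filtrationD(2)[OF X this Cons.IH] Cons.prems show ?case by (simp add: a)
  qed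
  with xs(2) show "P \<in> wick_span n" using filtrationD(1)[OF X] by blast
qed

end

section \<open>The inner product of the Fock space\<close>

lemma abs_mult_le_sum_squares: "\<bar>a * b\<bar> \<le> a\<^sup>2 + b\<^sup>2" for a b :: real
proof -
  have "2 * \<bar>a * b\<bar> \<le> a\<^sup>2 + b\<^sup>2"
    using sum_squares_bound[of "\<bar>a\<bar>" "\<bar>b\<bar>"] by (simp add: abs_mult mult.assoc)
  then show ?thesis using abs_ge_zero[of "a * b"] by linarith
qed

context fock_model
begin

lemma fock_spaceD:
  assumes "g \<in> fock_space \<sigma>"
  shows "coords n g \<in> borel_measurable (power_measure \<sigma> n)"
    "integrable (power_measure \<sigma> n) (\<lambda>x. (coords n g x)\<^sup>2)"
    "summable (\<lambda>n. \<integral>x. (coords n g x)\<^sup>2 \<partial>power_measure \<sigma> n)"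
  using assms by (auto simp: fock_space_def)

lemma fock_product_integrable:
  assumes "g \<in> fock_space \<sigma>" "h \<in> fock_space \<sigma>"
  shows "integrable (power_measure \<sigma> n) (\<lambda>x. coords n g x * coords n h x)"
proof (rule Bochner_Integration.integrable_bound)
  show "integrable (power_measure \<sigma> n) (\<lambda>x. (coords n g x)\<^sup>2 + (coords n h x)\<^sup>2)"
    by (intro Bochner_Integration.integrable_add fock_spaceD assms)
  show "(\<lambda>x. coords n g x * coords n h x) \<in> borel_measurable (power_measure \<sigma> n)"
    by (intro borel_measurable_times fock_spaceD assms)
qed (simp add: abs_mult_le_sum_squares)

lemma fock_product_summable:
  assumes "g \<in> fock_space \<sigma>" "h \<in> fock_space \<sigma>"
  shows "summable (\<lambda>n. \<integral>x. coords n g x * coords n h x \<partial>power_measure \<sigma> n)"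
proof (rule summable_comparison_test')
  show "summable (\<lambda>n. (\<integral>x. (coords n g x)\<^sup>2 \<partial>power_measure \<sigma> n) + (\<integral>x. (coords n h x)\<^sup>2 \<partial>power_measure \<sigma> n))"
    by (intro summable_add fock_spaceD assms)
  fix n
  have "norm (\<integral>x. coords n g x * coords n h x \<partial>power_measure \<sigma> n) \<le>
      (\<integral>x. (coords n g x)\<^sup>2 + (coords n h x)\<^sup>2 \<partial>power_measure \<sigma> n)"
    by (rule integral_norm_bound[THEN order_trans], rule integral_mono)
      (auto intro!: fock_product_integrable fock_spaceD assms simp: abs_mult_le_sum_squares)
  then show "norm (\<integral>x. coords n g x * coords n h x \<partial>power_measure \<sigma> n) \<le>
      (\<integral>x. (coords n g x)\<^sup>2 \<partial>power_measure \<sigma> n) + (\<integral>x. (coords n h x)\<^sup>2 \<partial>power_measure \<sigma> n)"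
    using fock_spaceD(2)[OF assms(1), of n] fock_spaceD(2)[OF assms(2), of n] by simp
qed

lemma fock_inner_commute: "fock_inner \<sigma> g h = fock_inner \<sigma> h g"
  by (simp add: fock_inner_def mult.commute)

lemma fock_inner_add_left:
  assumes "g \<in> fock_space \<sigma>" "g' \<in> fock_space \<sigma>" "h \<in> fock_space \<sigma>"
  shows "fock_inner \<sigma> (\<lambda>ys. g ys + g' ys) h = fock_inner \<sigma> g h + fock_inner \<sigma> g' h"
proof -
  have "(\<integral>x. coords n (\<lambda>ys. g ys + g' ys) x * coords n h x \<partial>power_measure \<sigma> n) =
      (\<integral>x. coords n g x * coords n h x \<partial>power_measure \<sigma> n) +
      (\<integral>x. coords n g' x * coords n h x \<partial>power_measure \<sigma> n)" for n
    using fock_product_integrable[OF assms(1,3), of n] fock_product_integrable[OF assms(2,3), of n]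
    by (simp add: coords_def distrib_right)
  then show ?thesis
    unfolding fock_inner_def
    by (simp add: suminf_add[OF fock_product_summable[OF assms(1,3)] fock_product_summable[OF assms(2,3)]])
qed

lemma fock_inner_scale_left:
  assumes "g \<in> fock_space \<sigma>" "h \<in> fock_space \<sigma>"
  shows "fock_inner \<sigma> (\<lambda>ys. c * g ys) h = c * fock_inner \<sigma> g h"
proof -
  have "(\<integral>x. coords n (\<lambda>ys. c * g ys) x * coords n h x \<partial>power_measure \<sigma> n) =
      c * (\<integral>x. coords n g x * coords n h x \<partial>power_measure \<sigma> n)" for n
    by (simp add: coords_def mult.assoc)
  then show ?thesis
    unfolding fock_inner_def by (simp add: suminf_mult[OF fock_product_summable[OF assms]])
qed

lemma fock_inner_diff_left:
  assumes "g \<in> fock_space \<sigma>" "g' \<in> fock_space \<sigma>" "h \<in> fock_space \<sigma>"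
  shows "fock_inner \<sigma> (\<lambda>ys. g ys - g' ys) h = fock_inner \<sigma> g h - fock_inner \<sigma> g' h"
  using fock_inner_add_left[OF assms(1) fock_space_scale[OF assms(2), of "-1"] assms(3)]
    fock_inner_scale_left[OF assms(2,3), of "-1"] by simp

lemma fock_inner_cong:
  assumes "fock_eq \<sigma> g g'" "h \<in> fock_space \<sigma>"
  shows "fock_inner \<sigma> g h = fock_inner \<sigma> g' h"
proof -
  have "(\<integral>x. coords n g x * coords n h x \<partial>power_measure \<sigma> n) =
      (\<integral>x. coords n g' x * coords n h x \<partial>power_measure \<sigma> n)" for n
  proof (rule integral_cong_AE)
    have "AE x in power_measure \<sigma> n. coords n g x = coords n g' x"
      using assms by (simp add: fock_eq_def)
    then show "AE x in power_measure \<sigma> n. coords n g x * coords n h x = coords n g' x * coords n h x"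
      by eventually_elim simp
  qed (use assms in \<open>auto simp: fock_eq_def intro!: borel_measurable_times fock_spaceD(1)\<close>)
  then show ?thesis by (simp add: fock_inner_def)
qed

lemma fock_inner_nonneg: "g \<in> fock_space \<sigma> \<Longrightarrow> 0 \<le> fock_inner \<sigma> g g"
  unfolding fock_inner_def by (rule suminf_nonneg[OF fock_product_summable]) simp_all

text \<open>
  The discriminant of \<open>t \<mapsto> \<parallel>g + t h\<parallel>\<^sup>2 \<ge> 0\<close>.
\<close>

lemma fock_Cauchy_Schwarz:
  assumes g: "g \<in> fock_space \<sigma>" and h: "h \<in> fock_space \<sigma>"
  shows "\<bar>fock_inner \<sigma> g h\<bar> \<le> fock_norm \<sigma> g * fock_norm \<sigma> h"
proof -
  define A B C where "A = fock_inner \<sigma> g g" and "B = fock_inner \<sigma> g h" and "C = fock_inner \<sigma> h h"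
  have pos: "0 \<le> A + 2 * t * B + t\<^sup>2 * C" for t
  proof -
    have th: "(\<lambda>ys. t * h ys) \<in> fock_space \<sigma>" by (rule fock_space_scale[OF h])
    let ?u = "\<lambda>ys. g ys + t * h ys"
    have u: "?u \<in> fock_space \<sigma>" by (rule fock_space_add[OF g th])
    have gu: "fock_inner \<sigma> g ?u = A + t * B"
      unfolding fock_inner_commute[of g]
      by (simp add: fock_inner_add_left[OF g th g] fock_inner_scale_left[OF h g] A_def B_def
          fock_inner_commute[of h g])
    have hu: "fock_inner \<sigma> h ?u = B + t * C"
      unfolding fock_inner_commute[of h]
      by (simp add: fock_inner_add_left[OF g th h] fock_inner_scale_left[OF h h] B_def C_def)
    have "fock_inner \<sigma> ?u ?u = A + 2 * t * B + t\<^sup>2 * C"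
      by (simp add: fock_inner_add_left[OF g th u] fock_inner_scale_left[OF h u] gu hu
          power2_eq_square algebra_simps)
    with fock_inner_nonneg[OF u] show ?thesis by simp
  qed
  have A: "A \<ge> 0" and C: "C \<ge> 0" using fock_inner_nonneg g h by (simp_all add: A_def C_def)
  have "B\<^sup>2 \<le> A * C"
  proof (cases "C = 0")
    case True
    have "B = 0"
    proof (rule ccontr)
      assume "B \<noteq> 0"
      \<comment> \<open>The quadratic is linear, with value \<open>-1\<close> at this point.\<close>
      with pos[of "- (A + 1) / (2 * B)"] True show False by (simp add: field_simps)
    qed
    with True show ?thesis by simp
  next
    case False
    with C have "C > 0" by simp
    \<comment> \<open>The minimum of the quadratic.\<close>
    with pos[of "- B / C"] show ?thesis by (simp add: field_simps power2_eq_square)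
  qed
  then have "sqrt (B\<^sup>2) \<le> sqrt (A * C)" by (rule real_sqrt_le_mono)
  then show ?thesis by (simp add: real_sqrt_mult fock_norm_def A_def B_def C_def)
qed

lemma fock_norm_nonneg: "g \<in> fock_space \<sigma> \<Longrightarrow> 0 \<le> fock_norm \<sigma> g"
  by (simp add: fock_norm_def fock_inner_nonneg)

lemma fock_norm_square: "g \<in> fock_space \<sigma> \<Longrightarrow> (fock_norm \<sigma> g)\<^sup>2 = fock_inner \<sigma> g g"
  by (simp add: fock_norm_def fock_inner_nonneg)

lemma fock_norm_diff_commute:
  assumes g: "g \<in> fock_space \<sigma>" and h: "h \<in> fock_space \<sigma>"
  shows "fock_norm \<sigma> (\<lambda>ys. g ys - h ys) = fock_norm \<sigma> (\<lambda>ys. h ys - g ys)"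
proof -
  have "coords n (\<lambda>ys. g ys - h ys) x * coords n (\<lambda>ys. g ys - h ys) x =
      coords n (\<lambda>ys. h ys - g ys) x * coords n (\<lambda>ys. h ys - g ys) x" for n x
    by (simp add: coords_def algebra_simps)
  then show ?thesis by (simp add: fock_norm_def fock_inner_def)
qed

lemma fock_norm_triangle:
  assumes g: "g \<in> fock_space \<sigma>" and h: "h \<in> fock_space \<sigma>"
  shows "fock_norm \<sigma> g \<le> fock_norm \<sigma> (\<lambda>ys. g ys - h ys) + fock_norm \<sigma> h"
proof (cases "fock_norm \<sigma> g = 0")
  case True
  then show ?thesis using fock_norm_nonneg[OF fock_space_diff[OF g h]] fock_norm_nonneg[OF h] by simp
next
  case False
  then have pos: "0 < fock_norm \<sigma> g" using fock_norm_nonneg[OF g] by simp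
  have "fock_norm \<sigma> g * fock_norm \<sigma> g = fock_inner \<sigma> (\<lambda>ys. g ys - h ys) g + fock_inner \<sigma> h g"
    using fock_norm_square[OF g] by (simp add: fock_inner_diff_left[OF g h g] power2_eq_square)
  also have "\<dots> \<le> fock_norm \<sigma> (\<lambda>ys. g ys - h ys) * fock_norm \<sigma> g + fock_norm \<sigma> h * fock_norm \<sigma> g"
    using fock_Cauchy_Schwarz[OF fock_space_diff[OF g h] g] fock_Cauchy_Schwarz[OF h g] by linarith
  finally have "fock_norm \<sigma> g * fock_norm \<sigma> g \<le>
      (fock_norm \<sigma> (\<lambda>ys. g ys - h ys) + fock_norm \<sigma> h) * fock_norm \<sigma> g"
    by (simp add: distrib_right)
  then show ?thesis using pos by (rule mult_right_le_imp_le)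
qed

section \<open>The vacuum vector\<close>

lemma vacuum_fock_space: "vacuum \<in> fock_space \<sigma>"
  unfolding fock_space_iff
proof
  show [measurable]: "(vacuum :: 'a list \<Rightarrow> real) \<in> borel_measurable list_borel"
    by (simp add: measurable_from_list_borel_iff vacuum_def flip: length_0_conv)
  have "(\<lambda>ys :: 'a list. ennreal ((vacuum ys)\<^sup>2)) \<in> borel_measurable list_borel"
    by measurable
  from fock_nn_integral_Cons[OF this] have "fock_nn_integral (\<lambda>ys. ennreal ((vacuum ys)\<^sup>2)) = 1"
    by (simp add: vacuum_def fock_nn_integral_def)
  then show "fock_nn_integral (\<lambda>ys. ennreal ((vacuum ys)\<^sup>2)) < \<infinity>" by simp
qed

text \<open>
  At \<open>ys\<close>, the word \<open>A\<^sup>k\<close> looks at the component of index \<open>k + length ys\<close> only, and the vacuum is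
  concentrated in the component of index 0.
\<close>

lemma annihilate_vacuum:
  "0 < k \<or> ys \<noteq> [] \<Longrightarrow> word_op \<sigma> lam (replicate k Annihilate) f vacuum ys = 0"
  by (induction k arbitrary: f ys) (auto simp: vacuum_def)

text \<open>
  Of all Wick words only \<open>C\<^sup>n\<close> survives at the vacuum, since every other one ends in \<open>A\<close> or \<open>N\<close>.
  The Wick product is thus the operator whose value at the vacuum is its kernel.
\<close>

lemma free_wick_product_vacuum:
  "free_wick_product \<sigma> lam n f vacuum ys = (if length ys = n then f ys else 0)"
  unfolding free_wick_product_def
proof (induction n arbitrary: f ys)
  case 0
  then show ?case by (simp add: vacuum_def)
next
  case (Suc n)
  have "word_op \<sigma> lam (Neutral # replicate n Annihilate) f vacuum ys = 0"
    by (simp add: annihilate_vacuum split: list.split)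
  moreover have "word_op \<sigma> lam (Annihilate # replicate n Annihilate) f vacuum ys = 0"
    using annihilate_vacuum[of "Suc n"] by simp
  moreover have "(\<Sum>v\<in>wick_words n. word_op \<sigma> lam (Create # v) f vacuum ys) =
      (if length ys = Suc n then f ys else 0)"
    by (cases ys) (simp_all add: Suc.IH)
  ultimately show ?case unfolding sum_wick_words_Suc by simp
qed

lemma kernel_fock_space:
  assumes K: "compact K" and f: "f \<in> kernels n K"
  shows "f \<in> fock_space \<sigma>" and "free_wick_product \<sigma> lam n f vacuum = f"
proof -
  show eq: "free_wick_product \<sigma> lam n f vacuum = f"
    using kernelsD(1)[OF f] by (intro ext) (auto simp: free_wick_product_vacuum)
  show "f \<in> fock_space \<sigma>"
    using word_sum_fock_space[OF K f vacuum_fock_space, of "mixed_words 0 n"]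
    by (simp only: free_wick_product_word_sum[symmetric] eq)
qed

lemma wick_span_vacuum:
  assumes "P \<in> wick_span n"
  obtains K h where "compact K" "\<forall>i. h i \<in> kernels i K"
    "op_eq \<sigma> P (\<lambda>g ys. \<Sum>i\<le>n. free_wick_product \<sigma> lam i (h i) g ys)"
    "fock_eq \<sigma> (P vacuum) (\<lambda>ys. if length ys \<le> n then h (length ys) ys else 0)"
proof -
  obtain K h where h: "compact K" "\<forall>i. h i \<in> kernels i K"
      "op_eq \<sigma> P (\<lambda>g ys. \<Sum>i\<le>n. free_wick_product \<sigma> lam i (h i) g ys)"
    using assms unfolding wick_span_def by blast
  have "(\<Sum>i\<le>n. free_wick_product \<sigma> lam i (h i) vacuum ys) =
      (if length ys \<le> n then h (length ys) ys else 0)" for ys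
    by (simp add: free_wick_product_vacuum)
  with h(3) vacuum_fock_space
  have "fock_eq \<sigma> (P vacuum) (\<lambda>ys. if length ys \<le> n then h (length ys) ys else 0)"
    unfolding op_eq_def by fastforce
  with h that show ?thesis by blast
qed

lemma kernel_orthogonal_CP_le:
  assumes K: "compact K" and f: "f \<in> kernels n K" and P: "P \<in> CP_le \<sigma> lam m" and "m < n"
  shows "fock_inner \<sigma> f (P vacuum) = 0"
proof -
  have "P \<in> wick_span m" using P CP_le_subset_wick_span by blast
  then obtain L h where h: "compact L" "\<forall>i. h i \<in> kernels i L"
      "op_eq \<sigma> P (\<lambda>g ys. \<Sum>i\<le>m. free_wick_product \<sigma> lam i (h i) g ys)"
      "fock_eq \<sigma> (P vacuum) (\<lambda>ys. if length ys \<le> m then h (length ys) ys else 0)"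
    by (rule wick_span_vacuum)
  let ?H = "\<lambda>ys. if length ys \<le> m then h (length ys) ys else 0"
  have zero: "coords i ?H x * coords i f x = 0" for i x
    using kernelsD(1)[OF f, of "list_of i x"] \<open>m < n\<close> by (auto simp: coords_list_of)
  have "fock_inner \<sigma> f (P vacuum) = fock_inner \<sigma> ?H f"
    unfolding fock_inner_commute[of f] by (rule fock_inner_cong[OF h(4) kernel_fock_space(1)[OF K f]])
  also have "\<dots> = 0"
    unfolding fock_inner_def zero by simp
  finally show ?thesis .
qed

text \<open>
  The measure \<open>\<sigma>\<^sup>n\<close> charges every nonempty open box, so a continuous function that vanishes almost
  everywhere vanishes.
\<close>

lemma kernel_zero:
  assumes f: "f \<in> kernels n K" and zero: "AE x in power_measure \<sigma> n. f (list_of n x) = 0"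
  shows "f ts = 0"
proof (rule ccontr)
  assume nz: "f ts \<noteq> 0"
  then have n: "length ts = n" using kernelsD(1)[OF f] by blast
  let ?x = "\<lambda>i. ts ! i"
  let ?U = "{x. f (list_of n x) \<noteq> 0}"
  \<comment> \<open>Around a point where \<open>f\<close> does not vanish there is a box where it does not vanish.\<close>
  have "open ?U"
    by (rule open_Collect_neq[OF kernelsD(3)[OF f]]) simp
  then have "openin (product_topology (\<lambda>_. euclidean) UNIV) ?U"
    by (simp add: euclidean_product_topology)
  moreover have "?x \<in> ?U" using nz list_of_nth[OF n] by simp
  ultimately obtain X where X: "?x \<in> Pi\<^sub>E UNIV X" "\<And>i. open (X i)" "Pi\<^sub>E UNIV X \<subseteq> ?U"
    using product_topology_open_contains_basis[of "\<lambda>_. euclidean" UNIV ?U ?x] by auto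
  have [measurable]: "f \<in> borel_measurable list_borel" by (rule kernels_measurable[OF f])
  let ?N = "{x \<in> space (power_measure \<sigma> n). f (list_of n x) \<noteq> 0}"
  have N: "?N \<in> sets (power_measure \<sigma> n)" by measurable
  have "Pi\<^sub>E {..<n} X \<subseteq> ?N"
  proof
    fix x assume x: "x \<in> Pi\<^sub>E {..<n} X"
    let ?y = "\<lambda>i. if i < n then x i else ts ! i"
    have "?y \<in> Pi\<^sub>E UNIV X" using x X(1) by (auto simp: PiE_iff)
    moreover have "list_of n ?y = list_of n x" by (rule list_of_cong) simp
    ultimately show "x \<in> ?N" using X(3) x by (auto simp: space_PiM PiE_iff)
  qed
  then have "emeasure (power_measure \<sigma> n) (Pi\<^sub>E {..<n} X) \<le> emeasure (power_measure \<sigma> n) ?N"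
    using N by (rule emeasure_mono)
  also have "\<dots> = 0" using zero AE_iff_measurable[OF N] by simp
  also have "emeasure (power_measure \<sigma> n) (Pi\<^sub>E {..<n} X) = (\<Prod>i<n. emeasure \<sigma> (X i))"
    using X(2) by (intro emeasure_PiM) (auto simp: sets_sigma)
  finally have "(\<Prod>i<n. emeasure \<sigma> (X i)) = 0" by simp
  moreover have "0 < emeasure \<sigma> (X i)" for i
    using X(1,2) by (intro open_positive) auto
  then have "(\<Prod>i<m. emeasure \<sigma> (X i)) \<noteq> 0" for m
    by (induction m) (auto simp: less_le)
  ultimately show False by blast
qed

text \<open>
  A polynomial is a sum of Wick products, and its value at the vacuum lists their kernels.  If this
  value is zero, then the kernels vanish almost everywhere, hence everywhere by continuity, and so
  does the operator.
\<close>

lemma vacuum_separating: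
  assumes P: "P \<in> CP \<sigma> lam" and zero: "fock_inner \<sigma> (P vacuum) (P vacuum) = 0"
  shows "op_eq \<sigma> P (\<lambda>g ys. 0)"
proof -
  obtain n where "P \<in> CP_le \<sigma> lam n" using P by (auto simp: CP_def)
  then have "P \<in> wick_span n" using CP_le_subset_wick_span by blast
  then obtain K h where h: "compact K" "\<forall>i. h i \<in> kernels i K"
      "op_eq \<sigma> P (\<lambda>g ys. \<Sum>i\<le>n. free_wick_product \<sigma> lam i (h i) g ys)"
      "fock_eq \<sigma> (P vacuum) (\<lambda>ys. if length ys \<le> n then h (length ys) ys else 0)"
    by (rule wick_span_vacuum)
  have PV: "P vacuum \<in> fock_space \<sigma>" using h(4) by (simp add: fock_eq_def)
  have summable: "summable (\<lambda>n. \<integral>x. coords n (P vacuum) x * coords n (P vacuum) x \<partial>power_measure \<sigma> n)"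
    by (rule fock_product_summable[OF PV PV])
  have "h i = (\<lambda>_. 0)" if "i \<le> n" for i
  proof
    fix ts
    have "(\<integral>x. coords i (P vacuum) x * coords i (P vacuum) x \<partial>power_measure \<sigma> i) = 0"
      using zero suminf_eq_zero_iff[OF summable] unfolding fock_inner_def by simp
    then have "AE x in power_measure \<sigma> i. coords i (P vacuum) x * coords i (P vacuum) x = 0"
      using integral_nonneg_eq_0_iff_AE[OF fock_product_integrable[OF PV PV]] by simp
    moreover have "AE x in power_measure \<sigma> i. coords i (P vacuum) x =
        coords i (\<lambda>ys. if length ys \<le> n then h (length ys) ys else 0) x"
      using h(4) unfolding fock_eq_def by blast
    ultimately have "AE x in power_measure \<sigma> i. h i (list_of i x) = 0"
      by eventually_elim (use that in \<open>simp add: coords_list_of\<close>)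
    then show "h i ts = 0" by (rule kernel_zero[OF h(2)[THEN spec]])
  qed
  then have "(\<lambda>g ys. \<Sum>i\<le>n. free_wick_product \<sigma> lam i (h i) g ys) = (\<lambda>g ys. 0)"
    by (intro ext sum.neutral) (simp add: free_wick_product_word_sum)
  with h(3) show ?thesis by simp
qed

section \<open>The orthogonal projection\<close>

lemma CP_fock_space: "P \<in> CP \<sigma> lam \<Longrightarrow> g \<in> fock_space \<sigma> \<Longrightarrow> P g \<in> fock_space \<sigma>"
proof -
  assume P: "P \<in> CP \<sigma> lam" and g: "g \<in> fock_space \<sigma>"
  then obtain Q where "op_eq \<sigma> P Q" unfolding CP_def CP_le_def by blast
  with g have "fock_eq \<sigma> (P g) (Q g)" unfolding op_eq_def by blast
  then show "P g \<in> fock_space \<sigma>" unfolding fock_eq_def by blast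
qed

lemma CP_le_CP: "P \<in> CP_le \<sigma> lam n \<Longrightarrow> P \<in> CP \<sigma> lam"
  by (auto simp: CP_def)

lemma CP_diff:
  assumes "P \<in> CP \<sigma> lam" "Q \<in> CP \<sigma> lam"
  shows "op_diff P Q \<in> CP \<sigma> lam"
proof -
  obtain m n where "P \<in> CP_le \<sigma> lam m" "Q \<in> CP_le \<sigma> lam n"
    using assms by (auto simp: CP_def)
  then have "P \<in> CP_le \<sigma> lam (max m n)" "Q \<in> CP_le \<sigma> lam (max m n)"
    using filtrationD(5)[OF filtration_CP_le, of m "max m n"] filtrationD(5)[OF filtration_CP_le, of n "max m n"]
    by auto
  from filtration_diff[OF filtration_CP_le this] show ?thesis by (rule CP_le_CP)
qed

lemma L2_inner_embed: "L2_inner \<sigma> (L2_embed P) (L2_embed Q) = fock_inner \<sigma> (P vacuum) (Q vacuum)"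
  by (simp add: L2_inner_def L2_embed_def tau_inner_def)

lemma L2_inner_commute: "L2_inner \<sigma> X Y = L2_inner \<sigma> Y X"
  by (simp add: L2_inner_def tau_inner_def fock_inner_commute)

lemma L2_diff_embed: "L2_diff (L2_embed P) (L2_embed Q) = L2_embed (op_diff P Q)"
  by (simp add: L2_diff_def L2_embed_def)

lemma fock_inner_zero_left: "fock_inner \<sigma> (\<lambda>ys. 0) h = 0"
  by (simp add: fock_inner_def coords_def)

lemma embed_in_MP:
  assumes "P \<in> CP_le \<sigma> lam n"
  shows "L2_embed P \<in> MP \<sigma> lam n"
proof -
  have "tau_norm \<sigma> (op_diff P P) = 0"
    by (simp add: tau_norm_def fock_norm_def op_diff_def fock_inner_zero_left)
  moreover have "L2_norm \<sigma> (L2_diff (L2_embed P) (L2_embed P)) = 0"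
    by (simp add: L2_norm_def L2_diff_embed L2_inner_embed op_diff_def fock_inner_zero_left)
  moreover from calculation(1) have "L2_embed P \<in> L2_tau \<sigma> lam"
    using CP_le_CP[OF assms] by (simp add: L2_tau_def L2_embed_def)
  ultimately show ?thesis
    using assms unfolding MP_def by (intro CollectI conjI allI impI bexI[of _ P]) simp_all
qed

text \<open>
  Orthogonality to \<open>CP_le\<close> extends to its closure.  The closure is taken in a completion by Cauchy
  sequences: the distances of the members of \<open>Y\<close> from a polynomial \<open>P\<close> form a Cauchy sequence,
  whose limit is the distance from \<open>Y\<close> to \<open>P\<close>, and the Cauchy-Schwarz inequality bounds the
  inner products with \<open>g\<close> by these distances.
\<close>

lemma inner_MP_tendsto_zero:
  assumes Y: "Y \<in> MP \<sigma> lam m" and g: "g \<in> fock_space \<sigma>"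
    and orth: "\<And>P. P \<in> CP_le \<sigma> lam m \<Longrightarrow> fock_inner \<sigma> g (P vacuum) = 0"
  shows "(\<lambda>k. fock_inner \<sigma> g (Y k vacuum)) \<longlonglongrightarrow> 0"
proof (rule LIMSEQ_I)
  fix e :: real assume "0 < e"
  \<comment> \<open>The summand 1 keeps \<open>c\<close> positive when \<open>g\<close> is a null vector.\<close>
  define c where "c = fock_norm \<sigma> g + 1"
  have "0 < c" using fock_norm_nonneg[OF g] by (simp add: c_def)
  then have "0 < e / c" using \<open>0 < e\<close> by simp
  then obtain P where P: "P \<in> CP_le \<sigma> lam m"
    and close: "L2_norm \<sigma> (L2_diff Y (L2_embed P)) < e / c"
    using Y unfolding MP_def by blast
  have YV: "Y k vacuum \<in> fock_space \<sigma>" for k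
    using Y CP_fock_space[OF _ vacuum_fock_space] by (auto simp: MP_def L2_tau_def)
  have PV: "P vacuum \<in> fock_space \<sigma>" by (rule CP_fock_space[OF CP_le_CP[OF P] vacuum_fock_space])
  define d where "d = (\<lambda>k ys. Y k vacuum ys - P vacuum ys)"
  have d: "d k \<in> fock_space \<sigma>" for k unfolding d_def by (rule fock_space_diff[OF YV PV])
  define r where "r = (\<lambda>k. fock_norm \<sigma> (d k))"
  have dist: "\<bar>r j - r k\<bar> \<le> tau_norm \<sigma> (op_diff (Y j) (Y k))" for j k
  proof -
    have eq: "tau_norm \<sigma> (op_diff (Y j) (Y k)) = fock_norm \<sigma> (\<lambda>ys. d j ys - d k ys)"
      by (simp add: tau_norm_def op_diff_def d_def)
    show ?thesis
      using fock_norm_triangle[OF d d, of j k] fock_norm_triangle[OF d d, of k j]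
        fock_norm_diff_commute[OF d d, of j k]
      unfolding eq r_def by linarith
  qed
  have "Cauchy r"
  proof (rule metric_CauchyI)
    fix e :: real assume "0 < e"
    then obtain N where "\<forall>j\<ge>N. \<forall>k\<ge>N. tau_norm \<sigma> (op_diff (Y j) (Y k)) < e"
      using Y unfolding MP_def L2_tau_def by blast
    then have "dist (r j) (r k) < e" if "j \<ge> N" "k \<ge> N" for j k
      using dist[of j k] that by (fastforce simp: dist_real_def)
    then show "\<exists>M. \<forall>m\<ge>M. \<forall>n\<ge>M. dist (r m) (r n) < e" by blast
  qed
  then obtain s where s: "r \<longlonglongrightarrow> s" using Cauchy_convergent convergent_def by blast
  have "0 \<le> s" by (rule LIMSEQ_le_const[OF s]) (auto simp: r_def fock_norm_nonneg[OF d])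
  have "(\<lambda>k. (r k)\<^sup>2) \<longlonglongrightarrow> s\<^sup>2" by (intro tendsto_power s)
  moreover have "(r k)\<^sup>2 = tau_inner \<sigma> (L2_diff Y (L2_embed P) k) (L2_diff Y (L2_embed P) k)" for k
    using fock_norm_square[OF d, of k]
    by (simp add: r_def tau_inner_def L2_diff_def L2_embed_def op_diff_def d_def)
  ultimately have "L2_inner \<sigma> (L2_diff Y (L2_embed P)) (L2_diff Y (L2_embed P)) = s\<^sup>2"
    unfolding L2_inner_def by (intro limI) simp
  then have "s < e / c" using close \<open>0 \<le> s\<close> by (simp add: L2_norm_def)
  then have "eventually (\<lambda>k. r k < e / c) sequentially" using s by (rule order_tendstoD(2)[rotated])
  then obtain N where N: "\<And>k. k \<ge> N \<Longrightarrow> r k < e / c" unfolding eventually_sequentially by blast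
  have "norm (fock_inner \<sigma> g (Y k vacuum) - 0) < e" if "k \<ge> N" for k
  proof -
    have "fock_inner \<sigma> g (d k) = fock_inner \<sigma> g (Y k vacuum)"
      using fock_inner_diff_left[OF YV PV g, of k] orth[OF P]
      by (simp add: d_def fock_inner_commute[of _ g])
    then have "\<bar>fock_inner \<sigma> g (Y k vacuum)\<bar> \<le> fock_norm \<sigma> g * r k"
      using fock_Cauchy_Schwarz[OF g d, of k] by (simp add: r_def)
    also have "\<dots> \<le> c * r k"
      using fock_norm_nonneg[OF d, of k] by (intro mult_right_mono) (simp_all add: c_def r_def)
    also have "\<dots> < c * (e / c)" using N[OF that] \<open>0 < c\<close> by (rule mult_strict_left_mono)
    also have "\<dots> = e" using \<open>0 < c\<close> by simp
    finally show ?thesis by simp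
  qed
  then show "\<exists>N. \<forall>k\<ge>N. norm (fock_inner \<sigma> g (Y k vacuum) - 0) < e" by blast
qed

text \<open>
  At the vacuum, the Wick product is a vector of particle number \<open>n\<close>, while polynomials of order
  below \<open>n\<close> produce particle numbers below \<open>n\<close> only.
\<close>

lemma free_wick_product_in_OP:
  assumes K: "compact K" and f: "f \<in> kernels n K"
  shows "L2_embed (free_wick_product \<sigma> lam n f) \<in> OP \<sigma> lam n"
  unfolding OP_def
proof (intro CollectI conjI impI ballI)
  show "L2_embed (free_wick_product \<sigma> lam n f) \<in> MP \<sigma> lam n"
    by (rule embed_in_MP[OF free_wick_product_in_CP_le[OF K f]])
  fix Y assume "1 \<le> n" and Y: "Y \<in> MP \<sigma> lam (n - 1)"
  have "(\<lambda>k. fock_inner \<sigma> f (Y k vacuum)) \<longlonglongrightarrow> 0"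
    using \<open>1 \<le> n\<close>
    by (intro inner_MP_tendsto_zero[OF Y kernel_fock_space(1)[OF K f]] kernel_orthogonal_CP_le[OF K f]) auto
  then show "L2_inner \<sigma> (L2_embed (free_wick_product \<sigma> lam n f)) Y = 0"
    by (simp add: L2_inner_def tau_inner_def L2_embed_def kernel_fock_space(2)[OF K f] limI)
qed

lemma is_P_free_wick_product:
  assumes K: "compact K" and f: "f \<in> kernels n K" and n: "1 \<le> n"
  shows "is_P \<sigma> lam n f (free_wick_product \<sigma> lam n f)"
  unfolding is_P_def is_orthogonal_projection_def
proof (intro conjI ballI)
  show "free_wick_product \<sigma> lam n f \<in> CP \<sigma> lam"
    by (rule CP_le_CP[OF free_wick_product_in_CP_le[OF K f]])
  show "L2_embed (free_wick_product \<sigma> lam n f) \<in> OP \<sigma> lam n"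
    by (rule free_wick_product_in_OP[OF K f])
  fix Y assume "Y \<in> OP \<sigma> lam n"
  moreover have "L2_embed (op_diff (monomial \<sigma> lam n f) (free_wick_product \<sigma> lam n f)) \<in> MP \<sigma> lam (n - 1)"
    by (rule embed_in_MP[OF monomial_minus_free_wick_product_in_CP_le[OF K f]])
  ultimately have
    "L2_inner \<sigma> Y (L2_embed (op_diff (monomial \<sigma> lam n f) (free_wick_product \<sigma> lam n f))) = 0"
    using n unfolding OP_def by blast
  then show "L2_inner \<sigma> (L2_diff (L2_embed (monomial \<sigma> lam n f)) (L2_embed (free_wick_product \<sigma> lam n f))) Y = 0"
    unfolding L2_diff_embed by (subst L2_inner_commute)
qed

text \<open>
  Orthogonality determines the vector \<open>R \<Omega>\<close>, and the vacuum separates polynomials.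
\<close>

lemma is_P_unique:
  assumes R: "is_P \<sigma> lam n f R" and R': "is_P \<sigma> lam n f R'" and f: "f \<in> test_functions n"
  shows "op_eq \<sigma> R R'"
proof -
  let ?M = "monomial \<sigma> lam n f"
  have CP: "R \<in> CP \<sigma> lam" "R' \<in> CP \<sigma> lam" using R R' by (auto simp: is_P_def)
  have V: "R vacuum \<in> fock_space \<sigma>" "R' vacuum \<in> fock_space \<sigma>" "?M vacuum \<in> fock_space \<sigma>"
    using CP CP_le_CP[OF monomial_in_CP_le[OF f]] CP_fock_space[OF _ vacuum_fock_space] by auto
  have orth: "fock_inner \<sigma> (?M vacuum) (S vacuum) = fock_inner \<sigma> (Q vacuum) (S vacuum)"
    if Q: "is_P \<sigma> lam n f Q" and S: "is_P \<sigma> lam n f S" for Q S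
  proof -
    have QS: "Q vacuum \<in> fock_space \<sigma>" "S vacuum \<in> fock_space \<sigma>"
      using Q S CP_fock_space[OF _ vacuum_fock_space] by (auto simp: is_P_def)
    have "fock_inner \<sigma> (op_diff ?M Q vacuum) (S vacuum) = 0"
      using Q S unfolding is_P_def is_orthogonal_projection_def L2_diff_embed
      by (metis L2_inner_embed)
    then show ?thesis using fock_inner_diff_left[OF V(3) QS] by (simp add: op_diff_def)
  qed
  have D: "op_diff R R' vacuum = (\<lambda>ys. R vacuum ys - R' vacuum ys)" by (simp add: op_diff_def)
  note DV = fock_space_diff[OF V(1,2)]
  have "fock_inner \<sigma> (op_diff R R' vacuum) (S vacuum) = 0" if "is_P \<sigma> lam n f S" for S
    using fock_inner_diff_left[OF V(1,2), of "S vacuum"] orth[OF R that] orth[OF R' that] that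
      CP_fock_space[OF _ vacuum_fock_space, of S]
    by (simp add: D is_P_def)
  from this[OF R] this[OF R'] have "fock_inner \<sigma> (op_diff R R' vacuum) (op_diff R R' vacuum) = 0"
    unfolding D by (subst fock_inner_diff_left[OF V(1,2) DV]) (simp add: fock_inner_commute[of "_ vacuum"])
  from vacuum_separating[OF CP_diff[OF CP] this]
  have zero: "op_eq \<sigma> (op_diff R R') (\<lambda>g ys. 0)" .
  show ?thesis
    unfolding op_eq_def fock_eq_def
  proof (intro ballI conjI allI)
    fix g i assume g: "g \<in> fock_space \<sigma>"
    show "R g \<in> fock_space \<sigma>" "R' g \<in> fock_space \<sigma>" using CP CP_fock_space g by auto
    have "AE x in power_measure \<sigma> i. coords i (op_diff R R' g) x = coords i (\<lambda>ys. 0) x"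
      using zero g unfolding op_eq_def fock_eq_def by blast
    then show "AE x in power_measure \<sigma> i. coords i (R g) x = coords i (R' g) x"
      by eventually_elim (simp add: coords_def op_diff_def)
  qed
qed

end

text \<open>
  The members of a countable base that lie in some compact set cover the space.
\<close>

lemma sigma_finite_of_locally_compact:
  fixes \<sigma> :: "'a::{t2_space, second_countable_topology} measure"
  assumes lc: "locally_compact_space (euclidean :: 'a topology)"
    and sets: "sets \<sigma> = sets borel"
    and fin: "\<And>K. compact K \<Longrightarrow> emeasure \<sigma> K < \<infinity>"
  shows "sigma_finite_measure \<sigma>"
proof -
  obtain B :: "'a set set" where B: "countable B" "topological_basis B"
    using ex_countable_basis by blast
  define A where "A = {b \<in> B. \<exists>K. compact K \<and> b \<subseteq> K}"
  have "\<exists>b\<in>A. x \<in> b" for x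
  proof -
    have "\<exists>U K. openin euclidean U \<and> compactin euclidean K \<and> x \<in> U \<and> U \<subseteq> K"
      using lc unfolding locally_compact_space_def by simp
    then obtain U K where "openin euclidean U" "compactin euclidean K" and x: "x \<in> U" "U \<subseteq> K"
      by blast
    then have UK: "open U" "compact K" by simp_all
    then obtain b where "b \<in> B" "x \<in> b" "b \<subseteq> U" using topological_basisE[OF B(2) UK(1) x(1)] by blast
    with UK x show ?thesis unfolding A_def by blast
  qed
  then have cover: "\<Union>A = space \<sigma>" using sets_eq_imp_space_eq[OF sets] by auto
  have "A \<subseteq> sets \<sigma>" using topological_basis_open[OF B(2)] by (auto simp: A_def sets)
  moreover have "emeasure \<sigma> b \<noteq> \<infinity>" if b: "b \<in> A" for b
  proof -
    obtain K where K: "compact K" "b \<subseteq> K" using b unfolding A_def by blast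
    then have "emeasure \<sigma> b \<le> emeasure \<sigma> K"
      by (intro emeasure_mono) (auto simp: sets compact_imp_closed)
    also have "\<dots> < \<infinity>" by (rule fin[OF K(1)])
    finally show ?thesis by simp
  qed
  moreover have "countable A" using B(1) by (auto simp: A_def)
  ultimately show ?thesis using cover by (intro sigma_finite_measure.intro exI[of _ A]) auto
qed

theorem theorem2p2:
  fixes \<sigma> :: "'a::{t2_space, second_countable_topology, perfect_space} measure"
    and lam :: "'a \<Rightarrow> real"
    and n :: nat
    and f :: "'a list \<Rightarrow> real"
  assumes "locally_compact_space (euclidean :: 'a topology)"
    and "radon_measure \<sigma>"
    and "nonatomic \<sigma>"
    and "\<And>U. open U \<Longrightarrow> U \<noteq> {} \<Longrightarrow> 0 < emeasure \<sigma> U"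
    and "continuous_on UNIV lam"
    and "1 \<le> n"
    and "f \<in> test_functions n"
  shows "is_P \<sigma> lam n f (free_wick_product \<sigma> lam n f) \<and>
         (\<forall>R. is_P \<sigma> lam n f R \<longrightarrow> op_eq \<sigma> R (free_wick_product \<sigma> lam n f))"
proof -
  note radon = assms(2)[unfolded radon_measure_def]
  have sets: "sets \<sigma> = sets borel"
    by (rule radon[THEN conjunct1])
  have fin: "emeasure \<sigma> K < \<infinity>" if "compact K" for K
    using that by (rule radon[THEN conjunct2, THEN conjunct1, rule_format])
  interpret fock_model \<sigma> lam
    by (intro fock_model.intro sets sigma_finite_of_locally_compact[OF assms(1) sets fin] fin assms(4,5))
  obtain K where K: "compact K" and f: "(\<lambda>ts. if length ts = n then f ts else 0) \<in> kernels n K"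
    using test_functions_imp_kernels[OF assms(7)] .
  \<comment> \<open>The values of \<open>f\<close> on lists of other lengths are arbitrary, and no word of length \<open>n\<close> sees them.\<close>
  let ?f = "\<lambda>ts. if length ts = n then f ts else 0"
  have eq: "word_sum \<sigma> lam S ?f = word_sum \<sigma> lam S f" if "\<And>w. w \<in> S \<Longrightarrow> length w = n" for S
    unfolding word_sum_def by (intro ext sum.cong refl word_op_cong) (simp add: that)
  have "monomial \<sigma> lam n ?f = monomial \<sigma> lam n f"
    unfolding monomial_word_sum by (rule eq) (auto dest: length_mixed_words)
  moreover have "free_wick_product \<sigma> lam n ?f = free_wick_product \<sigma> lam n f"
    unfolding free_wick_product_word_sum by (rule eq) (auto dest: length_wick_words)
  moreover note is_P_free_wick_product[OF K f assms(6)]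
  ultimately have "is_P \<sigma> lam n f (free_wick_product \<sigma> lam n f)" by (simp add: is_P_def)
  then show ?thesis using is_P_unique[OF _ _ assms(7)] by blast
qed

end
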